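(* Let $\phi(\xi)=e^{-|\xi|}$ and let $Lv=(1-\phi^2)v'+\phi\phi' v$ on $L^2(\mathbb{R})$ with domain $\mathrm{Dom}(L)=\{v\in L^2(\mathbb{R}):(1-\phi^2)v'\in L^2(\mathbb{R})\}$. For every $\mathfrak{v}_0\in\mathrm{Dom}(L)$, the initial-value problem $$\tilde v_t=L\tilde v,\qquad \tilde v(\xi,0)=\mathfrak{v}_0(\xi),$$ admits a unique global solution $\tilde v$ for $t>0$, and for all $t>0$ it satisfies $$\|\tilde v(\cdot,t)\|_{L^2(0,\infty)}\le\|\mathfrak{v}_0\|_{L^2(0,\infty)}\quad\text{and}\quad \|\tilde v(\cdot,t)\|_{L^2(-\infty,0)}\le e^{2t}\|\mathfrak{v}_0\|_{L^2(-\infty,0)}.$$ Furthermore, for each $\lambda_0\in(0,2)$ there exists $\mathfrak{v}_0\in\mathrm{Dom}(L)$, not identically zero on $(-\infty,0)$, such that the corresponding solution satisfies $\|\tilde v(\cdot,t)\|_{L^2(-\infty,0)}=e^{\lambda_0t}\|\mathfrak{v}_0\|_{L^2(-\infty,0)}$ for all $t>0$.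
   Context: Functions are complex-valued on $\mathbb{R}$ (variable $\xi$); $v'$ denotes the distributional derivative in $\xi$, and $\phi'(\xi)=-\operatorname{sgn}(\xi)e^{-|\xi|}$ for $\xi\ne0$. A global solution is a function $\tilde v\in C([0,\infty),\mathrm{Dom}(L))$ ($\mathrm{Dom}(L)$ with the graph norm), continuously differentiable in $t$ with values in $L^2(\mathbb{R})$, satisfying the equation and the initial condition. *)

theory Defs
  imports "HOL-Analysis.Analysis"
begin

text \<open>
  An element of \<open>L\<^sup>2(\<real>)\<close> is given by a Borel representative \<open>real \<Rightarrow> complex\<close> (every class of
  Lebesgue measurable functions has one); equality in \<open>L\<^sup>2(\<real>)\<close> is equality almost everywhere.
\<close>

definition L2 :: "(real \<Rightarrow> complex) set" where
  "L2 = {v. v \<in> borel_measurable lborel \<and> integrable lborel (\<lambda>\<xi>. (cmod (v \<xi>))\<^sup>2)}"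

definition L2_norm_on :: "real set \<Rightarrow> (real \<Rightarrow> complex) \<Rightarrow> real" where
  "L2_norm_on A v = sqrt (set_lebesgue_integral lborel A (\<lambda>\<xi>. (cmod (v \<xi>))\<^sup>2))"

abbreviation L2_norm :: "(real \<Rightarrow> complex) \<Rightarrow> real" where
  "L2_norm \<equiv> L2_norm_on UNIV"

definition phi :: "real \<Rightarrow> real" where
  "phi \<xi> = exp (- \<bar>\<xi>\<bar>)"

definition phi' :: "real \<Rightarrow> real" where
  "phi' \<xi> = - sgn \<xi> * exp (- \<bar>\<xi>\<bar>)"

text \<open>
  Real-valued test functions suffice for complex distributions, by linearity.
\<close>

definition test_functions :: "(real \<Rightarrow> real) set" where
  "test_functions =
     {\<psi>. (\<forall>n x. (deriv ^^ n) \<psi> differentiable (at x)) \<and> compact (closure {x. \<psi> x \<noteq> 0})}"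

text \<open>
  The product of a Lipschitz coefficient \<open>a\<close> and the distributional derivative \<open>v'\<close> of
  \<open>v \<in> L\<^sup>2(\<real>)\<close>: \<open>\<langle>a v', \<psi>\<rangle> = \<langle>v', a \<psi>\<rangle> = - \<integral> v (a \<psi>)'\<close>.  Here \<open>a \<psi>\<close> is Lipschitz with compact
  support, so its classical derivative exists almost everywhere and is bounded; for
  \<open>a = 1 - \<phi>\<^sup>2\<close> it exists except possibly at 0.  Note that \<open>v'\<close> itself need not be locally integrable
  near 0.
\<close>

definition mult_distr_deriv ::
    "(real \<Rightarrow> real) \<Rightarrow> (real \<Rightarrow> complex) \<Rightarrow> (real \<Rightarrow> real) \<Rightarrow> complex" where
  "mult_distr_deriv a v \<psi> = - (\<integral>\<xi>. v \<xi> * of_real (deriv (\<lambda>\<eta>. a \<eta> * \<psi> \<eta>) \<xi>) \<partial>lborel)"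

definition represents_distr :: "(real \<Rightarrow> complex) \<Rightarrow> ((real \<Rightarrow> real) \<Rightarrow> complex) \<Rightarrow> bool" where
  "represents_distr w T \<longleftrightarrow>
     (\<forall>\<psi>\<in>test_functions. (\<integral>\<xi>. w \<xi> * of_real (\<psi> \<xi>) \<partial>lborel) = T \<psi>)"

definition Dom_L :: "(real \<Rightarrow> complex) set" where
  "Dom_L = {v \<in> L2. \<exists>w\<in>L2. represents_distr w (mult_distr_deriv (\<lambda>\<xi>. 1 - (phi \<xi>)\<^sup>2) v)}"

text \<open>
  For \<open>v \<in> Dom_L\<close> the function chosen here is unique up to a null set.
\<close>

definition transport_term :: "(real \<Rightarrow> complex) \<Rightarrow> real \<Rightarrow> complex" where
  "transport_term v =
     (SOME w. w \<in> L2 \<and> represents_distr w (mult_distr_deriv (\<lambda>\<xi>. 1 - (phi \<xi>)\<^sup>2) v))"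

definition L_op :: "(real \<Rightarrow> complex) \<Rightarrow> real \<Rightarrow> complex" where
  "L_op v = (\<lambda>\<xi>. transport_term v \<xi> + of_real (phi \<xi> * phi' \<xi>) * v \<xi>)"

definition graph_norm :: "(real \<Rightarrow> complex) \<Rightarrow> real" where
  "graph_norm v = sqrt ((L2_norm v)\<^sup>2 + (L2_norm (L_op v))\<^sup>2)"

definition continuous_into_Dom_L :: "(real \<Rightarrow> real \<Rightarrow> complex) \<Rightarrow> bool" where
  "continuous_into_Dom_L v \<longleftrightarrow>
     (\<forall>t\<ge>0. v t \<in> Dom_L \<and>
        ((\<lambda>s. graph_norm (\<lambda>\<xi>. v s \<xi> - v t \<xi>)) \<longlongrightarrow> 0) (at t within {0..}))"

definition continuous_into_L2 :: "(real \<Rightarrow> real \<Rightarrow> complex) \<Rightarrow> bool" where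
  "continuous_into_L2 v \<longleftrightarrow>
     (\<forall>t\<ge>0. v t \<in> L2 \<and>
        ((\<lambda>s. L2_norm (\<lambda>\<xi>. v s \<xi> - v t \<xi>)) \<longlongrightarrow> 0) (at t within {0..}))"

text \<open>
  \<open>dv t\<close> is the (at \<open>t = 0\<close> one-sided) derivative of \<open>v\<close> at \<open>t\<close> in the norm of \<open>L\<^sup>2(\<real>)\<close>.
\<close>

definition has_L2_time_deriv ::
    "(real \<Rightarrow> real \<Rightarrow> complex) \<Rightarrow> (real \<Rightarrow> real \<Rightarrow> complex) \<Rightarrow> bool" where
  "has_L2_time_deriv v dv \<longleftrightarrow>
     (\<forall>t\<ge>0. v t \<in> L2 \<and> dv t \<in> L2 \<and>
        ((\<lambda>s. L2_norm (\<lambda>\<xi>. (v s \<xi> - v t \<xi>) / of_real (s - t) - dv t \<xi>)) \<longlongrightarrow> 0)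
          (at t within {0..}))"

text \<open>
  Functions of time take the time as first argument; values at negative times are irrelevant.
\<close>

definition global_solution :: "(real \<Rightarrow> complex) \<Rightarrow> (real \<Rightarrow> real \<Rightarrow> complex) \<Rightarrow> bool" where
  "global_solution v0 v \<longleftrightarrow>
     continuous_into_Dom_L v \<and>
     (\<exists>dv. has_L2_time_deriv v dv \<and> continuous_into_L2 dv \<and>
        (\<forall>t\<ge>0. AE \<xi> in lborel. dv t \<xi> = L_op (v t) \<xi>)) \<and>
     (AE \<xi> in lborel. v 0 \<xi> = v0 \<xi>)"

end

theory Submission
  imports Defs
begin

text \<open>
  Along the characteristics \<open>dX/dt = 1 - \<phi>(X)\<^sup>2\<close> the equation is solved by an explicit group \<open>S(t)\<close> of
  bounded operators on \<open>L\<^sup>2\<close>, which preserves both half-lines because 0 is a fixed point of the flow.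
  The change of variables \<open>x = X(t, \<xi>)\<close> gives the two norm bounds.  Testing the difference quotients
  of \<open>S(t) f\<close> with \<open>C\<^sup>1\<close> functions shows that the generator of the group is exactly \<open>L\<close> on its
  distributional domain.  Existence follows, and uniqueness because \<open>S(-t) w(t)\<close> is constant in time
  for every solution \<open>w\<close>.  The growing solutions start from eigenfunctions of \<open>L\<close> supported on the
  negative axis.
\<close>

section \<open>Smooth cutoff functions\<close>

text \<open>The coefficient \<open>1 - (phi x)\<^sup>2\<close> vanishes at 0 with a corner, and for
  nonzero t the slope of the flow jumps there from \<open>exp (- 2 * t)\<close> on the left to
  \<open>exp (2 * t)\<close> on the right. So the dual group does not preserve differentiability at
  0, and the distributional definition of \<open>L_op\<close> cannot be tested directly with
  transported test functions. Two facts repair this. Test functions that vanish near 0 are still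
  dense in L2, since a point is a null set, and the dual group keeps them zero near 0. Away from 0
  one continuous derivative survives the transport, and one derivative is enough: the distributional
  identity involves only a test function and its first derivative, so it extends to C^1 functions by
  uniform approximation of both. The density statement also turns weak estimates into norm
  estimates, which yields a derivative in norm without any resolvent or semigroup generation
  theorem.\<close>

fun times_differentiable :: "nat \<Rightarrow> (real \<Rightarrow> real) \<Rightarrow> bool" where
  "times_differentiable 0 f = (\<forall>x. f differentiable (at x))"
| "times_differentiable (Suc n) f = ((\<forall>x. f differentiable (at x)) \<and> times_differentiable n (deriv f))"

definition smooth :: "(real \<Rightarrow> real) \<Rightarrow> bool" where
  "smooth f \<longleftrightarrow> (\<forall>n. times_differentiable n f)"

lemma times_differentiable_imp_differentiable: "times_differentiable n f \<Longrightarrow> f differentiable (at x)"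
  by (cases n) auto

lemma times_differentiable_DERIV:
  "times_differentiable n f \<Longrightarrow> (f has_real_derivative deriv f x) (at x)"
  using times_differentiable_imp_differentiable DERIV_deriv_iff_real_differentiable by blast

lemma times_differentiable_SucD: "times_differentiable (Suc n) f \<Longrightarrow> times_differentiable n f"
  by (induction n arbitrary: f) auto

lemma times_differentiable_SucI:
  assumes "\<And>x. (f has_real_derivative f' x) (at x)" "times_differentiable n f'"
  shows "times_differentiable (Suc n) f"
proof -
  have "deriv f = f'" using assms(1) by (auto intro!: DERIV_imp_deriv)
  then show ?thesis using assms by (auto simp: real_differentiable_def)
qed

text \<open>Links the recursive notion, for which closure properties are plain inductions, with the
  iterated \<open>deriv\<close> in \<open>test_functions\<close>. The count is shifted:
  \<open>times_differentiable n\<close> says that the derivatives of orders 0 to n are all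
  differentiable.\<close>

lemma smooth_iff: "smooth f \<longleftrightarrow> (\<forall>n x. (deriv ^^ n) f differentiable (at x))"
proof -
  have "times_differentiable n f \<longleftrightarrow> (\<forall>k\<le>n. \<forall>x. (deriv ^^ k) f differentiable (at x))" for n
  proof (induction n arbitrary: f)
    case (Suc n)
    have "(\<forall>k\<le>Suc n. \<forall>x. (deriv ^^ k) f differentiable (at x)) \<longleftrightarrow>
      (\<forall>x. f differentiable (at x)) \<and> (\<forall>k\<le>n. \<forall>x. (deriv ^^ Suc k) f differentiable (at x))"
      by (metis (no_types, lifting) Suc_le_mono funpow_0 not0_implies_Suc zero_le)
    then show ?case by (simp add: Suc funpow_Suc_right del: funpow.simps)
  qed simp
  then show ?thesis unfolding smooth_def by blast
qed

lemma times_differentiable_const: "times_differentiable n (\<lambda>x. c)"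
proof (induction n arbitrary: c)
  case (Suc n)
  show ?case by (rule times_differentiable_SucI[where f'="\<lambda>x. 0"]) (use Suc in auto)
qed simp

lemma times_differentiable_add:
  "times_differentiable n f \<Longrightarrow> times_differentiable n g \<Longrightarrow> times_differentiable n (\<lambda>x. f x + g x)"
proof (induction n arbitrary: f g)
  case (Suc n)
  show ?case
  proof (rule times_differentiable_SucI)
    show "((\<lambda>x. f x + g x) has_real_derivative deriv f x + deriv g x) (at x)" for x
      using Suc.prems by (intro DERIV_add times_differentiable_DERIV)
    show "times_differentiable n (\<lambda>x. deriv f x + deriv g x)"
      using Suc.prems by (intro Suc.IH) auto
  qed
qed auto

lemma times_differentiable_mult:
  "times_differentiable n f \<Longrightarrow> times_differentiable n g \<Longrightarrow> times_differentiable n (\<lambda>x. f x * g x)"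
proof (induction n arbitrary: f g)
  case (Suc n)
  have "times_differentiable n f" "times_differentiable n g"
    using Suc.prems times_differentiable_SucD by blast+
  then show ?case
    by (intro times_differentiable_SucI[where f'="\<lambda>x. deriv f x * g x + deriv g x * f x"]
        DERIV_mult times_differentiable_DERIV times_differentiable_add Suc.IH)
      (use Suc.prems in auto)
qed auto

lemma times_differentiable_inverse:
  assumes "times_differentiable n f" "\<And>x. f x \<noteq> 0"
  shows "times_differentiable n (\<lambda>x. inverse (f x))"
  using assms
proof (induction n)
  case (Suc n)
  have n: "times_differentiable n f" using Suc.prems times_differentiable_SucD by blast
  \<comment> \<open>The derivative is written as a product of functions already known to be
    differentiable n times, including the inverse itself by induction.\<close>
  have "((\<lambda>x. inverse (f x)) has_real_derivative
      ((-1) * deriv f x) * (inverse (f x) * inverse (f x))) (at x)" for x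
    using DERIV_inverse_fun[OF times_differentiable_DERIV[OF n], of x] Suc.prems(2)
    by (simp add: mult.assoc)
  then show ?case
    by (rule times_differentiable_SucI)
      (intro times_differentiable_mult times_differentiable_const Suc.IH n,
        use Suc.prems in simp_all)
qed auto

lemma times_differentiable_affine:
  "times_differentiable n f \<Longrightarrow> times_differentiable n (\<lambda>x. f (c * x + d))"
proof (induction n arbitrary: f)
  case 0
  then have D: "(f has_real_derivative deriv f x) (at x)" for x
    by (rule times_differentiable_DERIV)
  have "((\<lambda>x. f (c * x + d)) has_real_derivative deriv f (c * x + d) * c) (at x)" for x
    by (rule DERIV_chain2[OF D]) (auto intro!: derivative_eq_intros)
  then show ?case by (auto simp: real_differentiable_def)
next
  case (Suc n)
  from Suc.prems have D: "(f has_real_derivative deriv f x) (at x)" for x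
    by (rule times_differentiable_DERIV)
  have "((\<lambda>x. f (c * x + d)) has_real_derivative deriv f (c * x + d) * c) (at x)" for x
    by (rule DERIV_chain2[OF D]) (auto intro!: derivative_eq_intros)
  then show ?case
    by (rule times_differentiable_SucI)
      (use Suc in \<open>auto intro!: times_differentiable_mult times_differentiable_const\<close>)
qed

lemma times_differentiable_ident: "times_differentiable n (\<lambda>x. x)"
proof (cases n)
  case (Suc m)
  show ?thesis unfolding Suc
    by (rule times_differentiable_SucI[where f'="\<lambda>x. 1"]) (auto intro: times_differentiable_const)
qed simp

lemma times_differentiable_real_polynomial_function:
  assumes "real_polynomial_function p"
  shows "times_differentiable n p"
  using assms
proof (induction p rule: real_polynomial_function.induct)
  case (linear f)
  then have "f = (\<lambda>x. f 1 * x + 0)"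
    by (metis (no_types, opaque_lifting) add.right_neutral linear_simps(5) mult.commute mult.right_neutral real_scaleR_def)
  then show ?case using times_differentiable_affine[OF times_differentiable_ident] by metis
qed (auto intro: times_differentiable_const times_differentiable_add times_differentiable_mult)

section \<open>Flat functions, smooth transitions and cutoffs\<close>

text \<open>
  Every derivative of \<open>flat p\<close> is again of this form, so these functions are smooth, also at 0.
\<close>

definition flat :: "real poly \<Rightarrow> real \<Rightarrow> real" where
  "flat p x = (if x > 0 then poly p (1 / x) * exp (- (1 / x)) else 0)"

lemma poly_mult_exp_tendsto_0: "((\<lambda>y. poly p y * exp (- y)) \<longlongrightarrow> (0::real)) at_top"
proof (induction p)
  case (pCons a p)
  have "((\<lambda>y. poly p y / exp y) \<longlongrightarrow> 0) at_top" for p :: "real poly"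
  proof -
    have "((\<lambda>y. \<Sum>i\<le>degree p. coeff p i * (y ^ i / exp y)) \<longlongrightarrow> (\<Sum>i\<le>degree p. coeff p i * 0)) at_top"
      by (intro tendsto_intros tendsto_power_div_exp_0)
    then show ?thesis by (simp add: poly_altdef sum_divide_distrib)
  qed
  from this[of "pCons a p"] show ?case by (simp add: exp_minus divide_inverse)
qed simp

text \<open>For positive x the chain rule produces \<open>p - pderiv p\<close> at 1/x, multiplied by
  the square of 1/x; this multiplication is the double \<open>pCons 0\<close>. At 0 the right
  difference quotient is again of the same form, so exponential decay makes it vanish.\<close>

lemma flat_has_derivative:
  "(flat p has_real_derivative flat (pCons 0 (pCons 0 (p - pderiv p))) x) (at x)"
proof -
  consider "x > 0" | "x < 0" | "x = 0" by linarith
  then show ?thesis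
  proof cases
    case 1
    have i: "((\<lambda>x. 1 / x) has_real_derivative - (1 / x * (1 / x))) (at x)"
      using 1 by (auto intro!: derivative_eq_intros)
    have "((\<lambda>x. poly p (1 / x) * exp (- (1 / x))) has_real_derivative
        poly (pderiv p) (1 / x) * (- (1 / x * (1 / x))) * exp (- (1 / x)) +
        exp (- (1 / x)) * - (- (1 / x * (1 / x))) * poly p (1 / x)) (at x)"
      by (intro DERIV_mult DERIV_chain2[OF poly_DERIV] DERIV_fun_exp DERIV_minus i)
    also have "poly (pderiv p) (1 / x) * (- (1 / x * (1 / x))) * exp (- (1 / x)) +
        exp (- (1 / x)) * - (- (1 / x * (1 / x))) * poly p (1 / x) =
        flat (pCons 0 (pCons 0 (p - pderiv p))) x"
      using 1 by (simp add: flat_def algebra_simps)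
    finally have *: "((\<lambda>x. poly p (1 / x) * exp (- (1 / x))) has_real_derivative
        flat (pCons 0 (pCons 0 (p - pderiv p))) x) (at x)" .
    show ?thesis
      by (rule DERIV_cong_ev[THEN iffD1, OF refl _ refl *])
        (use eventually_nhds_in_open[of "{0<..}" x] 1 in \<open>auto elim!: eventually_mono simp: flat_def\<close>)
  next
    case 2
    have *: "((\<lambda>x. 0) has_real_derivative flat (pCons 0 (pCons 0 (p - pderiv p))) x) (at x)"
      using 2 by (auto simp: flat_def)
    show ?thesis
      by (rule DERIV_cong_ev[THEN iffD1, OF refl _ refl *])
        (use eventually_nhds_in_open[of "{..<0}" x] 2 in \<open>auto elim!: eventually_mono simp: flat_def\<close>)
  next
    case 3
    have l: "((\<lambda>h. flat p h / h) \<longlongrightarrow> 0) (at_left 0)"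
      by (rule tendsto_eventually) (auto simp: flat_def eventually_at_filter)
    \<comment> \<open>Dividing by h multiplies the polynomial in 1/h by its variable; then 1/h tends
      to infinity.\<close>
    have "((\<lambda>h. poly (pCons 0 p) (inverse h) * exp (- (inverse h))) \<longlongrightarrow> 0) (at_right (0::real))"
      by (rule filterlim_compose[OF poly_mult_exp_tendsto_0 filterlim_inverse_at_top_right])
    moreover have "\<forall>\<^sub>F h in at_right 0. poly (pCons 0 p) (inverse h) * exp (- (inverse h)) = flat p h / h"
      by (auto simp: flat_def eventually_at_filter field_simps)
    ultimately have r: "((\<lambda>h. flat p h / h) \<longlongrightarrow> 0) (at_right 0)"
      by (rule Lim_transform_eventually)
    have "((\<lambda>h. flat p h / h) \<longlongrightarrow> 0) (at 0)"
      using filterlim_split_at[OF l r] .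
    then show ?thesis using 3 unfolding DERIV_def by (simp add: flat_def[of _ 0])
  qed
qed

lemma times_differentiable_flat: "times_differentiable n (flat p)"
proof (induction n arbitrary: p)
  case 0
  then show ?case using flat_has_derivative by (auto simp: real_differentiable_def)
next
  case (Suc n)
  then show ?case using times_differentiable_SucI[OF flat_has_derivative] by blast
qed

text \<open>The usual smooth transition from 0 to 1, built from exp (-1/x). Arguments such as
  \<open>- 1 * x + 1\<close> are spelled to match
  \<open>times_differentiable_affine\<close>.\<close>

definition step :: "real \<Rightarrow> real" where
  "step x = flat 1 x * inverse (flat 1 x + flat 1 (- 1 * x + 1))"

lemma flat_1_pos: "x > 0 \<Longrightarrow> flat 1 x > 0" and flat_1_nonneg: "flat 1 x \<ge> 0"
  by (auto simp: flat_def)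

lemma flat_sum_pos: "flat 1 x + flat 1 (- 1 * x + 1) > 0"
  using flat_1_pos[of x] flat_1_pos[of "1 - x"] flat_1_nonneg[of x] flat_1_nonneg[of "1 - x"]
  by (cases "x > 0") auto

lemma times_differentiable_step: "times_differentiable n step"
  unfolding step_def[abs_def]
  by (intro times_differentiable_mult times_differentiable_inverse times_differentiable_add
      times_differentiable_affine times_differentiable_flat less_imp_neq[OF flat_sum_pos, symmetric])

lemma step_eq_0: "x \<le> 0 \<Longrightarrow> step x = 0" and step_eq_1: "x \<ge> 1 \<Longrightarrow> step x = 1"
  using flat_1_pos[of x] by (auto simp: step_def flat_def)

lemma step_range: "0 \<le> step x" "step x \<le> 1"
  using flat_1_nonneg[of x] flat_1_nonneg[of "- 1 * x + 1"] flat_sum_pos[of x]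
  unfolding step_def divide_inverse[symmetric] by (simp_all add: divide_le_eq)

definition wide_cutoff :: "real \<Rightarrow> real \<Rightarrow> real" where
  "wide_cutoff n x = step (1 * x + (n + 1)) * step (- 1 * x + (n + 1))"

lemma times_differentiable_wide_cutoff: "times_differentiable m (wide_cutoff n)"
  unfolding wide_cutoff_def[abs_def]
  by (intro times_differentiable_mult times_differentiable_affine times_differentiable_step)

lemma wide_cutoff_eq_1: "\<bar>x\<bar> \<le> n \<Longrightarrow> wide_cutoff n x = 1"
  unfolding wide_cutoff_def by (simp add: step_eq_1 abs_le_iff)

lemma wide_cutoff_eq_0: "\<bar>x\<bar> \<ge> n + 1 \<Longrightarrow> wide_cutoff n x = 0"
  unfolding wide_cutoff_def by (cases "x \<ge> 0") (simp_all add: step_eq_0)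

lemma wide_cutoff_range: "0 \<le> wide_cutoff n x" "wide_cutoff n x \<le> 1"
  unfolding wide_cutoff_def by (intro mult_nonneg_nonneg mult_le_one step_range)+

text \<open>Besides truncating at infinity it cuts out a neighbourhood of 0, where the flow has its
  corner. The removed interval shrinks like 1/n, so nothing is lost in L2 in the limit.\<close>

definition cutoff :: "real \<Rightarrow> real \<Rightarrow> real" where
  "cutoff n x = (step (n * x + (-1)) + step ((- n) * x + (-1))) * wide_cutoff n x"

lemma times_differentiable_cutoff: "times_differentiable m (cutoff n)"
  unfolding cutoff_def[abs_def]
  by (intro times_differentiable_mult times_differentiable_add times_differentiable_affine
      times_differentiable_step times_differentiable_wide_cutoff)

lemma cutoff_eq_0_far: "\<bar>x\<bar> \<ge> n + 1 \<Longrightarrow> cutoff n x = 0"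
  by (simp add: cutoff_def wide_cutoff_eq_0)

lemma cutoff_eq_0_near: "n > 0 \<Longrightarrow> \<bar>x\<bar> \<le> 1 / n \<Longrightarrow> cutoff n x = 0"
proof -
  assume "n > 0" "\<bar>x\<bar> \<le> 1 / n"
  then have "n * \<bar>x\<bar> \<le> 1" by (simp add: field_simps)
  moreover have "n * x \<le> n * \<bar>x\<bar>" "n * (- x) \<le> n * \<bar>x\<bar>"
    using \<open>n > 0\<close> by (intro mult_left_mono; simp)+
  ultimately have "n * x \<le> 1" "- n * x \<le> 1" by auto
  then show ?thesis by (simp add: cutoff_def step_eq_0)
qed

lemma cutoff_eq_1: "n > 0 \<Longrightarrow> 2 / n \<le> \<bar>x\<bar> \<Longrightarrow> \<bar>x\<bar> \<le> n \<Longrightarrow> cutoff n x = 1"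
proof -
  assume *: "n > 0" "2 / n \<le> \<bar>x\<bar>" "\<bar>x\<bar> \<le> n"
  then have "2 \<le> n * \<bar>x\<bar>" by (simp add: field_simps)
  then have "n * x \<ge> 2 \<or> - n * x \<ge> 2" by (auto simp: abs_if split: if_splits)
  then show ?thesis using * by (auto simp: cutoff_def step_eq_0 step_eq_1 wide_cutoff_eq_1)
qed

lemma cutoff_range: "0 \<le> cutoff n x" "cutoff n x \<le> 1"
proof -
  \<comment> \<open>The sign of \<open>n * x\<close> decides which of the two transitions vanishes,
    so their sum never exceeds one of them.\<close>
  have "step (n * x + (-1)) + step ((- n) * x + (-1)) \<le> 1"
    using step_eq_0[of "n * x - 1"] step_eq_0[of "- n * x - 1"] step_range(2)[of "n * x - 1"]
      step_range(2)[of "- n * x - 1"]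
    by (cases "n * x \<le> 0") auto
  then show "0 \<le> cutoff n x" "cutoff n x \<le> 1"
    unfolding cutoff_def using wide_cutoff_range step_range by (auto intro!: mult_le_one)
qed

section \<open>Passage to and from the given class of test functions\<close>

lemma test_functionsI:
  assumes "\<And>n. times_differentiable n \<psi>" "\<And>x. \<bar>x\<bar> \<ge> R \<Longrightarrow> \<psi> x = 0"
  shows "\<psi> \<in> test_functions"
proof -
  have "\<bar>x\<bar> \<le> R" if "\<psi> x \<noteq> 0" for x using assms(2)[of x] that by linarith
  then have "{x. \<psi> x \<noteq> 0} \<subseteq> cball 0 R" by (auto simp: dist_real_def)
  then have "compact (closure {x. \<psi> x \<noteq> 0})"
    by (meson bounded_cball bounded_subset compact_closure)
  then show ?thesis using assms(1) smooth_iff[of \<psi>] by (simp add: test_functions_def smooth_def)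
qed

lemma test_functionsD:
  assumes "\<psi> \<in> test_functions"
  shows "times_differentiable n \<psi>" "\<exists>R. \<forall>x. \<bar>x\<bar> \<ge> R \<longrightarrow> \<psi> x = 0"
proof -
  show "times_differentiable n \<psi>" using assms smooth_iff[of \<psi>] by (simp add: test_functions_def smooth_def)
  have "bounded (closure {x. \<psi> x \<noteq> 0})"
    using assms by (auto simp: test_functions_def intro: compact_imp_bounded)
  then have "bounded {x. \<psi> x \<noteq> 0}"
    by (rule bounded_subset[OF _ closure_subset])
  then obtain R where R: "\<And>x. \<psi> x \<noteq> 0 \<Longrightarrow> \<bar>x\<bar> \<le> R" by (auto simp: bounded_real)
  \<comment> \<open>The bound on the support gives zeros only for \<open>\<bar>x\<bar> > R\<close>;
    the added 1 makes the inequality nonstrict.\<close>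
  have "\<bar>x\<bar> \<ge> R + 1 \<Longrightarrow> \<psi> x = 0" for x using R[of x] by fastforce
  then show "\<exists>R. \<forall>x. \<bar>x\<bar> \<ge> R \<longrightarrow> \<psi> x = 0" by blast
qed

section \<open>The space of square integrable functions\<close>

lemma L2_norm_eq: "L2_norm v = sqrt (\<integral>x. (cmod (v x))\<^sup>2 \<partial>lborel)"
  by (simp add: L2_norm_on_def set_lebesgue_integral_def)

lemma L2_norm_nonneg [simp]: "L2_norm v \<ge> 0"
  by (simp add: L2_norm_eq)

lemma L2_norm_power2: "(L2_norm v)\<^sup>2 = (\<integral>x. (cmod (v x))\<^sup>2 \<partial>lborel)"
  by (simp add: L2_norm_eq)

lemma L2_measurable: "v \<in> L2 \<Longrightarrow> v \<in> borel_measurable borel"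
  and L2_integrable: "v \<in> L2 \<Longrightarrow> integrable lborel (\<lambda>x. (cmod (v x))\<^sup>2)"
  by (auto simp: L2_def)

lemma L2_dominated:
  assumes "v \<in> L2" and [measurable]: "f \<in> borel_measurable borel"
    and le: "AE x in lborel. cmod (f x) \<le> C * cmod (v x)" and "C \<ge> 0"
  shows "f \<in> L2" "L2_norm f \<le> C * L2_norm v"
proof -
  note [measurable] = L2_measurable[OF \<open>v \<in> L2\<close>]
  have le2: "AE x in lborel. (cmod (f x))\<^sup>2 \<le> C\<^sup>2 * (cmod (v x))\<^sup>2"
    using le by eventually_elim (metis norm_ge_zero power_mono power_mult_distrib)
  have int: "integrable lborel (\<lambda>x. C\<^sup>2 * (cmod (v x))\<^sup>2)"
    using L2_integrable[OF \<open>v \<in> L2\<close>] by simp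
  have int_f: "integrable lborel (\<lambda>x. (cmod (f x))\<^sup>2)"
    by (rule Bochner_Integration.integrable_bound[OF int]) (use le2 in auto)
  then show "f \<in> L2" by (simp add: L2_def)
  have "(L2_norm f)\<^sup>2 \<le> (C * L2_norm v)\<^sup>2"
    using integral_mono_AE[OF int_f int le2] by (simp add: L2_norm_power2 power_mult_distrib)
  then show "L2_norm f \<le> C * L2_norm v"
    by (rule power2_le_imp_le) (use \<open>C \<ge> 0\<close> in simp)
qed

lemma L2_norm_cong_AE:
  assumes "f \<in> borel_measurable borel" "g \<in> borel_measurable borel" "AE x in lborel. f x = g x"
  shows "L2_norm f = L2_norm g"
proof -
  have "(\<integral>x. (cmod (f x))\<^sup>2 \<partial>lborel) = (\<integral>x. (cmod (g x))\<^sup>2 \<partial>lborel)"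
    using assms by (intro integral_cong_AE) auto
  then show ?thesis by (simp add: L2_norm_eq)
qed

lemma L2_scale: "v \<in> L2 \<Longrightarrow> (\<lambda>x. c * v x) \<in> L2"
  using L2_measurable[of v] by (rule_tac L2_dominated(1)[of v _ "cmod c"]) (simp_all add: norm_mult)

lemma L2_norm_scale: "L2_norm (\<lambda>x. c * v x) = cmod c * L2_norm v"
  by (simp add: L2_norm_eq norm_mult power_mult_distrib real_sqrt_mult)

lemma L2_add:
  assumes "f \<in> L2" "g \<in> L2"
  shows "(\<lambda>x. f x + g x) \<in> L2"
proof -
  note [measurable] = L2_measurable[OF assms(1)] L2_measurable[OF assms(2)]
  have le: "(cmod (f x + g x))\<^sup>2 \<le> 2 * (cmod (f x))\<^sup>2 + 2 * (cmod (g x))\<^sup>2" for x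
  proof -
    have "(cmod (f x + g x))\<^sup>2 \<le> (cmod (f x) + cmod (g x))\<^sup>2"
      by (intro power_mono norm_triangle_ineq) auto
    also have "\<dots> \<le> 2 * (cmod (f x))\<^sup>2 + 2 * (cmod (g x))\<^sup>2"
      using sum_squares_bound[of "cmod (f x)" "cmod (g x)"] by (simp add: power2_sum)
    finally show ?thesis .
  qed
  have int: "integrable lborel (\<lambda>x. 2 * (cmod (f x))\<^sup>2 + 2 * (cmod (g x))\<^sup>2)"
    using L2_integrable[OF assms(1)] L2_integrable[OF assms(2)] by simp
  have "integrable lborel (\<lambda>x. (cmod (f x + g x))\<^sup>2)"
    by (rule Bochner_Integration.integrable_bound[OF int]) (simp_all add: le)
  then show ?thesis by (simp add: L2_def)
qed

lemma L2_diff: "f \<in> L2 \<Longrightarrow> g \<in> L2 \<Longrightarrow> (\<lambda>x. f x - g x) \<in> L2"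
  using L2_add[OF _ L2_scale[of g "-1"], of f] by simp

section \<open>Cauchy-Schwarz and triangle inequalities\<close>

lemma integrable_mult_L2:
  assumes "f \<in> L2" "g \<in> L2"
  shows "integrable lborel (\<lambda>x. f x * g x)"
proof -
  note [measurable] = L2_measurable[OF assms(1)] L2_measurable[OF assms(2)]
  have int: "integrable lborel (\<lambda>x. (cmod (f x))\<^sup>2 + (cmod (g x))\<^sup>2)"
    using L2_integrable[OF assms(1)] L2_integrable[OF assms(2)] by simp
  have "cmod (f x) * cmod (g x) \<le> (cmod (f x))\<^sup>2 + (cmod (g x))\<^sup>2" for x
    using sum_squares_bound[of "cmod (f x)" "cmod (g x)"]
      mult_nonneg_nonneg[OF norm_ge_zero[of "f x"] norm_ge_zero[of "g x"]] by linarith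
  then show ?thesis
    by (intro Bochner_Integration.integrable_bound[OF int]) (simp_all add: norm_mult)
qed

text \<open>The integral of (|f| - t |g|)^2 is a nonnegative quadratic polynomial in t. Its minimum,
  at t = J / B, gives J^2 \<le> A B; if B = 0 it is affine and can stay nonnegative only when J =
  0.\<close>

lemma L2_Cauchy_Schwarz_abs:
  assumes "f \<in> L2" "g \<in> L2"
  shows "(\<integral>x. cmod (f x) * cmod (g x) \<partial>lborel) \<le> L2_norm f * L2_norm g"
proof -
  note [measurable] = L2_measurable[OF assms(1)] L2_measurable[OF assms(2)]
  define A B J where "A = (\<integral>x. (cmod (f x))\<^sup>2 \<partial>lborel)" "B = (\<integral>x. (cmod (g x))\<^sup>2 \<partial>lborel)"
    "J = (\<integral>x. cmod (f x) * cmod (g x) \<partial>lborel)"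
  have int: "integrable lborel (\<lambda>x. cmod (f x) * cmod (g x))"
    using integrable_norm[OF integrable_mult_L2[OF assms]] by (simp add: norm_mult)
  have q: "0 \<le> A - 2 * t * J + t\<^sup>2 * B" for t
  proof -
    have "0 \<le> (\<integral>x. (cmod (f x) - t * cmod (g x))\<^sup>2 \<partial>lborel)"
      by (intro integral_nonneg_AE) auto
    also have "\<dots> = (\<integral>x. (cmod (f x))\<^sup>2 - 2 * t * (cmod (f x) * cmod (g x)) + t\<^sup>2 * (cmod (g x))\<^sup>2 \<partial>lborel)"
      by (simp add: power2_diff power_mult_distrib algebra_simps)
    also have "\<dots> = A - 2 * t * J + t\<^sup>2 * B"
      using int L2_integrable[OF assms(1)] L2_integrable[OF assms(2)] by (simp add: A_B_J_def)
    finally show ?thesis .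
  qed
  have "A \<ge> 0" "B \<ge> 0" "J \<ge> 0" by (auto simp: A_B_J_def intro!: integral_nonneg_AE)
  have "J\<^sup>2 \<le> A * B"
  proof (cases "B = 0")
    case True
    have "J = 0"
    proof (rule ccontr)
      assume "J \<noteq> 0"
      \<comment> \<open>This t makes the affine function equal to -1.\<close>
      then show False using q[of "(A + 1) / (2 * J)"] True by simp
    qed
    then show ?thesis using True by simp
  next
    case False
    then have "0 \<le> A - J\<^sup>2 / B" using q[of "J / B"] by (simp add: field_simps power2_eq_square)
    then show ?thesis using False \<open>B \<ge> 0\<close> by (simp add: field_simps)
  qed
  then have "J\<^sup>2 \<le> (L2_norm f * L2_norm g)\<^sup>2"
    by (simp add: power_mult_distrib L2_norm_power2 A_B_J_def)
  then have "J \<le> L2_norm f * L2_norm g"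
    by (rule power2_le_imp_le) simp
  then show ?thesis by (simp add: A_B_J_def)
qed

lemma L2_Cauchy_Schwarz:
  assumes "f \<in> L2" "g \<in> L2"
  shows "cmod (\<integral>x. f x * g x \<partial>lborel) \<le> L2_norm f * L2_norm g"
  using integral_norm_bound[of lborel "\<lambda>x. f x * g x"] L2_Cauchy_Schwarz_abs[OF assms]
  by (simp add: norm_mult)

lemma L2_norm_triangle:
  assumes "f \<in> L2" "g \<in> L2"
  shows "L2_norm (\<lambda>x. f x + g x) \<le> L2_norm f + L2_norm g"
proof -
  have int: "integrable lborel (\<lambda>x. cmod (f x) * cmod (g x))"
    using integrable_norm[OF integrable_mult_L2[OF assms]] by (simp add: norm_mult)
  have "(L2_norm (\<lambda>x. f x + g x))\<^sup>2 \<le>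
      (\<integral>x. (cmod (f x))\<^sup>2 + 2 * (cmod (f x) * cmod (g x)) + (cmod (g x))\<^sup>2 \<partial>lborel)"
    unfolding L2_norm_power2
  proof (rule integral_mono)
    show "integrable lborel (\<lambda>x. (cmod (f x + g x))\<^sup>2)"
      by (rule L2_integrable[OF L2_add[OF assms]])
    show "integrable lborel (\<lambda>x. (cmod (f x))\<^sup>2 + 2 * (cmod (f x) * cmod (g x)) + (cmod (g x))\<^sup>2)"
      using int assms L2_integrable by auto
    show "(cmod (f x + g x))\<^sup>2 \<le> (cmod (f x))\<^sup>2 + 2 * (cmod (f x) * cmod (g x)) + (cmod (g x))\<^sup>2" for x
      using power_mono[OF norm_triangle_ineq[of "f x" "g x"], of 2] by (simp add: power2_sum mult_ac add_ac)
  qed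
  also have "\<dots> = (L2_norm f)\<^sup>2 + 2 * (\<integral>x. cmod (f x) * cmod (g x) \<partial>lborel) + (L2_norm g)\<^sup>2"
    using int assms L2_integrable by (simp add: L2_norm_power2)
  also have "\<dots> \<le> (L2_norm f + L2_norm g)\<^sup>2"
    using L2_Cauchy_Schwarz_abs[OF assms] by (simp add: power2_sum)
  finally show ?thesis by (rule power2_le_imp_le) simp
qed

lemma L2_norm_diff_commute: "L2_norm (\<lambda>x. f x - g x) = L2_norm (\<lambda>x. g x - f x)"
  by (simp add: L2_norm_eq norm_minus_commute)

lemma L2_norm_triangle_diff:
  assumes "f \<in> L2" "g \<in> L2" "h \<in> L2"
  shows "L2_norm (\<lambda>x. f x - h x) \<le> L2_norm (\<lambda>x. f x - g x) + L2_norm (\<lambda>x. g x - h x)"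
  using L2_norm_triangle[OF L2_diff[OF assms(1,2)] L2_diff[OF assms(2,3)]] by simp

lemma L2_norm_eq_0_AE:
  assumes "f \<in> L2" "L2_norm f = 0"
  shows "AE x in lborel. f x = 0"
proof -
  have "(\<integral>x. (cmod (f x))\<^sup>2 \<partial>lborel) = 0" using assms(2) L2_norm_power2[of f] by simp
  then have "AE x in lborel. (cmod (f x))\<^sup>2 = 0"
    using integral_nonneg_eq_0_iff_AE[OF L2_integrable[OF assms(1)]] by simp
  then show ?thesis by simp
qed

lemma L2_dominated_convergence:
  assumes "w \<in> L2" and [measurable]: "\<And>n. s n \<in> borel_measurable borel"
    and le: "\<And>n. AE x in lborel. cmod (s n x) \<le> cmod (w x)"
    and lim: "AE x in lborel. (\<lambda>n. s n x) \<longlonglongrightarrow> 0"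
  shows "(\<lambda>n. L2_norm (s n)) \<longlonglongrightarrow> 0"
proof -
  have "(\<lambda>n. \<integral>x. (cmod (s n x))\<^sup>2 \<partial>lborel) \<longlonglongrightarrow> integral\<^sup>L lborel (\<lambda>x::real. 0::real)"
  proof (rule integral_dominated_convergence[where w="\<lambda>x. (cmod (w x))\<^sup>2"])
    show "integrable lborel (\<lambda>x. (cmod (w x))\<^sup>2)" by (rule L2_integrable[OF assms(1)])
    show "AE x in lborel. (\<lambda>n. (cmod (s n x))\<^sup>2) \<longlonglongrightarrow> 0"
      using lim
    proof eventually_elim
      case (elim x)
      have "(\<lambda>n. (cmod (s n x))\<^sup>2) \<longlonglongrightarrow> (cmod 0)\<^sup>2" by (intro tendsto_intros elim)
      then show ?case by simp
    qed
    show "AE x in lborel. norm ((cmod (s n x))\<^sup>2) \<le> (cmod (w x))\<^sup>2" for n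
      using le[of n] by eventually_elim (auto intro: power_mono)
  qed auto
  then have "(\<lambda>n. sqrt (\<integral>x. (cmod (s n x))\<^sup>2 \<partial>lborel)) \<longlonglongrightarrow> sqrt 0"
    by (intro tendsto_intros) simp
  then show ?thesis by (simp add: L2_norm_eq)
qed

lemma indicator_L2: "(\<lambda>x. of_real (indicator {a..b} x)) \<in> L2"
proof -
  have "(\<lambda>x. (cmod (of_real (indicator {a..b} x)))\<^sup>2) = (indicator {a..b} :: real \<Rightarrow> real)"
    by (auto simp: indicator_def)
  moreover have "integrable lborel (indicator {a..b} :: real \<Rightarrow> real)"
    by (rule integrable_real_indicator) (auto simp: emeasure_lborel_Icc_eq)
  ultimately show ?thesis by (simp add: L2_def)
qed

text \<open>The norm of the indicator stays unevaluated: in the approximation arguments it only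
  matters that it depends on R alone, so that a small C makes the norm small.\<close>

lemma bounded_support_L2:
  assumes [measurable]: "f \<in> borel_measurable borel"
    and "\<And>x. cmod (f x) \<le> C" "\<And>x. \<bar>x\<bar> > R \<Longrightarrow> f x = 0"
  shows "f \<in> L2" "L2_norm f \<le> C * L2_norm (\<lambda>x. of_real (indicator {-R..R} x))"
proof -
  have le: "cmod (f x) \<le> C * cmod (of_real (indicator {-R..R} x))" for x
    using assms(2,3)[of x] by (cases "\<bar>x\<bar> > R") (auto simp: indicator_def abs_le_iff)
  have "C \<ge> 0" using assms(2)[of 0] norm_ge_zero order_trans by blast
  note * = L2_dominated[OF indicator_L2 assms(1) AE_I2[OF le] this]
  show "f \<in> L2" by (rule *(1))
  show "L2_norm f \<le> C * L2_norm (\<lambda>x. of_real (indicator {-R..R} x))" by (rule *(2))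
qed

section \<open>Density of the test functions\<close>

text \<open>The width of the gap around 0 may depend on the function. This makes the class dense in
  L2, and it allows the flow, which fixes 0, to shrink the gap without leaving the class.\<close>

definition test_functions_off_0 :: "(real \<Rightarrow> real) set" where
  "test_functions_off_0 = {\<psi> \<in> test_functions. \<exists>\<delta>>0. \<forall>x. \<bar>x\<bar> < \<delta> \<longrightarrow> \<psi> x = 0}"

lemma cutoff_mult_polynomial_test:
  assumes "real_polynomial_function p" "n > 0"
  shows "(\<lambda>x. cutoff n x * p x) \<in> test_functions_off_0"
proof -
  have "(\<lambda>x. cutoff n x * p x) \<in> test_functions"
    by (rule test_functionsI[where R="n + 1"])
      (auto intro: times_differentiable_mult times_differentiable_cutoff
        times_differentiable_real_polynomial_function assms simp: cutoff_eq_0_far)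
  then show ?thesis
    using assms(2) by (auto simp: test_functions_off_0_def cutoff_eq_0_near intro!: exI[of _ "1 / n"])
qed

lemma borel_measurable_test_function:
  "\<psi> \<in> test_functions \<Longrightarrow> \<psi> \<in> borel_measurable borel"
  by (intro borel_measurable_continuous_onI continuous_at_imp_continuous_on ballI
      DERIV_isCont[OF times_differentiable_DERIV[OF test_functionsD(1)]])

lemma borel_measurable_cutoff [measurable]: "cutoff n \<in> borel_measurable borel"
  by (intro borel_measurable_continuous_onI continuous_at_imp_continuous_on ballI
      DERIV_isCont[OF times_differentiable_DERIV[OF times_differentiable_cutoff]])

text \<open>Three approximations cost e/3 each: truncation in size and in space, passage to a
  continuous function, and a Weierstrass polynomial. Multiplying by \<open>cutoff m\<close> leaves
  the truncated function unchanged but turns the polynomial into a test function that vanishes near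
  0.\<close>

lemma L2_approx_test_function_real:
  fixes f :: "real \<Rightarrow> real"
  assumes f: "(\<lambda>x. of_real (f x)) \<in> L2" and "e > 0"
  shows "\<exists>\<psi>\<in>test_functions_off_0. L2_norm (\<lambda>x. of_real (f x - \<psi> x)) < e"
proof -
  have [measurable]: "f \<in> borel_measurable borel"
    using measurable_compose[OF L2_measurable[OF f] borel_measurable_Re] by simp
  \<comment> \<open>The region kept, 2/m \<le> |x| \<le> m, is one where \<open>cutoff m\<close>
    equals 1.\<close>
  define trunc where "trunc m x = (if \<bar>f x\<bar> \<le> m \<and> 2 / m \<le> \<bar>x\<bar> \<and> \<bar>x\<bar> \<le> m then f x else 0)" for m x
  have [measurable]: "trunc m \<in> borel_measurable borel" for m
    unfolding trunc_def by measurable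
  have "(\<lambda>n. L2_norm (\<lambda>x. of_real (f x - trunc (real n) x))) \<longlonglongrightarrow> 0"
  proof (rule L2_dominated_convergence[OF f])
    show "AE x in lborel. (\<lambda>n. complex_of_real (f x - trunc (real n) x)) \<longlonglongrightarrow> 0"
      using AE_lborel_singleton[of 0]
    proof eventually_elim
      case (elim x)
      have "\<forall>\<^sub>F n in sequentially. real n \<ge> \<bar>f x\<bar> + \<bar>x\<bar> + 2 / \<bar>x\<bar> + 1"
        using filterlim_real_sequentially by (auto simp: filterlim_at_top)
      then have "\<forall>\<^sub>F n in sequentially. complex_of_real (f x - trunc (real n) x) = 0"
      proof eventually_elim
        case (elim n)
        moreover have "2 / \<bar>x\<bar> \<ge> 0" by simp
        ultimately have "real n \<ge> 2 / \<bar>x\<bar>" "real n > 0" "real n \<ge> \<bar>f x\<bar>" "real n \<ge> \<bar>x\<bar>"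
          using abs_ge_zero[of x] abs_ge_zero[of "f x"] by linarith+
        moreover have "2 / real n \<le> \<bar>x\<bar>"
          using \<open>real n \<ge> 2 / \<bar>x\<bar>\<close> \<open>x \<noteq> 0\<close> \<open>real n > 0\<close> by (simp add: field_simps)
        ultimately show ?case by (simp add: trunc_def)
      qed
      then show ?case by (rule tendsto_eventually)
    qed
  qed (auto simp: trunc_def)
  then have "\<forall>\<^sub>F n in sequentially. L2_norm (\<lambda>x. of_real (f x - trunc (real n) x)) < e / 3"
    using \<open>e > 0\<close> by (auto dest!: order_tendstoD(2)[where a="e/3"])
  moreover have "\<forall>\<^sub>F n in sequentially. n \<ge> 1" by (rule eventually_ge_at_top)
  ultimately obtain N :: nat where N: "N \<ge> 1" "L2_norm (\<lambda>x. of_real (f x - trunc (real N) x)) < e / 3"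
    using eventually_happens'[OF sequentially_bot eventually_conj] by blast
  define m where "m = real N"
  define h where "h = trunc m"
  have m: "m > 0" using N by (simp add: m_def)
  have [measurable]: "h \<in> borel_measurable borel" by (simp add: h_def)
  have h_bd: "\<bar>h x\<bar> \<le> m" for x using m by (auto simp: h_def trunc_def)
  have h_cut: "cutoff m x * h x = h x" for x using m by (auto simp: h_def trunc_def cutoff_eq_1)
  have h_supp: "h x = 0" if "\<bar>x\<bar> > m + 1" for x using that by (auto simp: h_def trunc_def)

  \<comment> \<open>A measurable function is an almost everywhere limit of continuous functions.
    Clamping these to [-m, m] does not change the limit, since |h| \<le> m, and supplies the bound
    for dominated convergence.\<close>
  have "h measurable_on UNIV"
    by (intro lebesgue_measurable_imp_measurable_on_real measurable_completion) simp_all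
  then obtain Z g where Z: "negligible Z" and g: "\<And>n. continuous_on UNIV (g n)"
    and lim: "\<And>x. x \<notin> Z \<Longrightarrow> (\<lambda>n. g n x) \<longlonglongrightarrow> h x"
    by (auto simp: measurable_on_def)
  define g' where "g' n x = max (- m) (min m (g n x))" for n x
  have g'_cont: "continuous_on UNIV (g' n)" for n
    unfolding g'_def by (intro continuous_intros g)
  then have [measurable]: "g' n \<in> borel_measurable borel" for n
    by (rule borel_measurable_continuous_onI)
  have g'_bd: "\<bar>g' n x\<bar> \<le> m" for n x using m by (auto simp: g'_def)
  have wL2: "(\<lambda>x. of_real (2 * m * indicator {-(m+1)..m+1} x)) \<in> L2"
    using L2_scale[OF indicator_L2, of "of_real (2 * m)"] by simp
  have "(\<lambda>n. L2_norm (\<lambda>x. of_real (h x - cutoff m x * g' n x))) \<longlonglongrightarrow> 0"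
  proof (rule L2_dominated_convergence[OF wL2])
    show "AE x in lborel. cmod (of_real (h x - cutoff m x * g' n x))
        \<le> cmod (of_real (2 * m * indicator {-(m+1)..m+1} x))" for n
    proof (rule AE_I2)
      fix x
      show "cmod (of_real (h x - cutoff m x * g' n x)) \<le> cmod (of_real (2 * m * indicator {-(m+1)..m+1} x))"
      proof (cases "\<bar>x\<bar> > m + 1")
        case True then show ?thesis by (simp add: h_supp cutoff_eq_0_far)
      next
        case False
        have "\<bar>cutoff m x * g' n x\<bar> \<le> 1 * m"
          unfolding abs_mult using cutoff_range g'_bd by (intro mult_mono) auto
        then have "\<bar>h x - cutoff m x * g' n x\<bar> \<le> 2 * m" using h_bd[of x] by linarith
        then show ?thesis using False m
          by (simp only: norm_of_real) (simp add: indicator_def abs_le_iff not_less)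
      qed
    qed
    have "AE x in lebesgue. x \<notin> Z"
      using Z by (intro AE_not_in) (simp add: negligible_iff_null_sets)
    then have "AE x in lborel. x \<notin> Z"
      by (simp add: AE_completion_iff)
    then show "AE x in lborel. (\<lambda>n. complex_of_real (h x - cutoff m x * g' n x)) \<longlonglongrightarrow> 0"
    proof eventually_elim
      case (elim x)
      have "(\<lambda>n. complex_of_real (h x - cutoff m x * g' n x)) \<longlonglongrightarrow>
          complex_of_real (h x - cutoff m x * max (- m) (min m (h x)))"
        unfolding g'_def by (intro tendsto_intros lim elim)
      moreover have "max (- m) (min m (h x)) = h x" using h_bd[of x] by (auto simp: abs_le_iff)
      ultimately show ?case by (simp add: h_cut)
    qed
  qed auto
  then have "\<forall>\<^sub>F n in sequentially. L2_norm (\<lambda>x. of_real (h x - cutoff m x * g' n x)) < e / 3"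
    using \<open>e > 0\<close> by (auto dest!: order_tendstoD(2)[where a="e/3"])
  then obtain n where n: "L2_norm (\<lambda>x. of_real (h x - cutoff m x * g' n x)) < e / 3"
    using eventually_happens'[OF sequentially_bot] by blast

  \<comment> \<open>A uniform error d on the support costs d * I in norm; the 1 added to I keeps the
    quotient defining d meaningful even if I = 0.\<close>
  define I where "I = L2_norm (\<lambda>x. of_real (indicator {-(m+1)..m+1} x))"
  define d where "d = e / (3 * (I + 1))"
  have "I \<ge> 0" by (simp add: I_def)
  then have "d > 0" "d * I < e / 3" using \<open>e > 0\<close> by (auto simp: d_def field_simps)
  obtain p where p: "real_polynomial_function p" "\<And>x. x \<in> {-(m+1)..m+1} \<Longrightarrow> \<bar>g' n x - p x\<bar> < d"
    using Stone_Weierstrass_real_polynomial_function[of "{-(m+1)..m+1}" "g' n" d]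
      continuous_on_subset[OF g'_cont] \<open>d > 0\<close> by auto
  define \<psi> where "\<psi> x = cutoff m x * p x" for x
  have \<psi>: "\<psi> \<in> test_functions_off_0"
    unfolding \<psi>_def[abs_def] by (rule cutoff_mult_polynomial_test[OF p(1) m])
  have [measurable]: "\<psi> \<in> borel_measurable borel"
    using \<psi> by (auto simp: test_functions_off_0_def intro: borel_measurable_test_function)
  have bd: "cmod (of_real (cutoff m x * g' n x - \<psi> x)) \<le> d" for x
  proof (cases "\<bar>x\<bar> > m + 1")
    case True then show ?thesis using \<open>d > 0\<close> by (simp add: \<psi>_def cutoff_eq_0_far)
  next
    case False
    then have "x \<in> {-(m+1)..m+1}" by auto
    then have "\<bar>g' n x - p x\<bar> \<le> d" using p(2)[of x] by linarith
    then have "\<bar>cutoff m x * (g' n x - p x)\<bar> \<le> 1 * d"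
      unfolding abs_mult using cutoff_range by (intro mult_mono) auto
    then show ?thesis by (simp only: norm_of_real \<psi>_def) (simp add: right_diff_distrib)
  qed
  have supp: "of_real (cutoff m x * g' n x - \<psi> x) = (0::complex)" if "\<bar>x\<bar> > m + 1" for x
    using that by (simp add: \<psi>_def cutoff_eq_0_far)
  have 3: "(\<lambda>x. complex_of_real (cutoff m x * g' n x - \<psi> x)) \<in> L2"
    "L2_norm (\<lambda>x. of_real (cutoff m x * g' n x - \<psi> x)) \<le> d * I"
    using bounded_support_L2[of "\<lambda>x. complex_of_real (cutoff m x * g' n x - \<psi> x)" d "m + 1"] bd supp
    by (auto simp: I_def)
  have 1: "(\<lambda>x. complex_of_real (f x - h x)) \<in> L2"
    by (rule L2_dominated(1)[OF f, where C=1]) (auto simp: h_def trunc_def)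
  have 2: "(\<lambda>x. complex_of_real (h x - cutoff m x * g' n x)) \<in> L2"
  proof (rule bounded_support_L2(1)[where C="m + 1 * m" and R="m + 1"])
    show "cmod (of_real (h x - cutoff m x * g' n x)) \<le> m + 1 * m" for x
    proof -
      have "\<bar>cutoff m x * g' n x\<bar> \<le> 1 * m"
        unfolding abs_mult using cutoff_range g'_bd by (intro mult_mono) auto
      then show ?thesis using h_bd[of x] by (simp only: norm_of_real)
    qed
  qed (auto simp: h_supp cutoff_eq_0_far)
  have "L2_norm (\<lambda>x. of_real (f x - \<psi> x)) \<le> L2_norm (\<lambda>x. of_real (f x - h x)) +
      (L2_norm (\<lambda>x. of_real (h x - cutoff m x * g' n x)) + L2_norm (\<lambda>x. of_real (cutoff m x * g' n x - \<psi> x)))"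
    using L2_norm_triangle[OF 1 L2_add[OF 2 3(1)]] L2_norm_triangle[OF 2 3(1)]
    by (simp add: of_real_add[symmetric] del: of_real_add of_real_diff of_real_mult)
  also have "\<dots> < e" using N(2) n 3(2) \<open>d * I < e / 3\<close> by (simp add: h_def m_def)
  finally show ?thesis using \<psi> by blast
qed

lemma L2_Re: "f \<in> L2 \<Longrightarrow> (\<lambda>x. of_real (Re (f x))) \<in> L2"
  and L2_Im: "f \<in> L2 \<Longrightarrow> (\<lambda>x. of_real (Im (f x))) \<in> L2"
  using L2_measurable[of f]
  by (rule_tac L2_dominated(1)[of f _ 1]; simp add: abs_Re_le_cmod abs_Im_le_cmod)+

lemma test_function_L2:
  assumes "\<psi> \<in> test_functions"
  shows "(\<lambda>x. of_real (\<psi> x)) \<in> L2"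
proof -
  note [measurable] = borel_measurable_test_function[OF assms]
  obtain R where R: "\<And>x. \<bar>x\<bar> \<ge> R \<Longrightarrow> \<psi> x = 0" using test_functionsD(2)[OF assms] by blast
  have "continuous_on {-R..R} \<psi>"
    using times_differentiable_DERIV[OF test_functionsD(1)[OF assms]]
    by (intro continuous_at_imp_continuous_on ballI DERIV_isCont)
  then have "bounded (\<psi> ` {-R..R})" by (intro compact_imp_bounded compact_continuous_image) auto
  then obtain C where C: "\<And>x. x \<in> {-R..R} \<Longrightarrow> \<bar>\<psi> x\<bar> \<le> C" unfolding bounded_real by blast
  have "\<bar>\<psi> x\<bar> \<le> max C 0" for x
    using R[of x] C[of x] by (cases "\<bar>x\<bar> \<ge> R") (auto simp: not_le abs_less_iff)
  then show ?thesis
    by (intro bounded_support_L2(1)[where C="max C 0" and R=R]) (auto simp: R)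
qed

lemma test_functions_off_0_D: "\<psi> \<in> test_functions_off_0 \<Longrightarrow> \<psi> \<in> test_functions"
  by (simp add: test_functions_off_0_def)

lemma L2_approx_test_functions:
  assumes f: "f \<in> L2" and "e > 0"
  obtains \<psi>1 \<psi>2 where "\<psi>1 \<in> test_functions_off_0" "\<psi>2 \<in> test_functions_off_0"
    "L2_norm (\<lambda>x. f x - (of_real (\<psi>1 x) + \<i> * of_real (\<psi>2 x))) < e"
proof -
  have "e / 2 > 0" using \<open>e > 0\<close> by simp
  obtain \<psi>1 where 1: "\<psi>1 \<in> test_functions_off_0" "L2_norm (\<lambda>x. of_real (Re (f x) - \<psi>1 x)) < e / 2"
    using L2_approx_test_function_real[OF L2_Re[OF f] \<open>e / 2 > 0\<close>] by blast
  obtain \<psi>2 where 2: "\<psi>2 \<in> test_functions_off_0" "L2_norm (\<lambda>x. of_real (Im (f x) - \<psi>2 x)) < e / 2"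
    using L2_approx_test_function_real[OF L2_Im[OF f] \<open>e / 2 > 0\<close>] by blast
  note t = 1(1)[THEN test_functions_off_0_D, THEN test_function_L2]
    2(1)[THEN test_functions_off_0_D, THEN test_function_L2]
  have "(\<lambda>x. f x - (of_real (\<psi>1 x) + \<i> * of_real (\<psi>2 x))) =
      (\<lambda>x. of_real (Re (f x) - \<psi>1 x) + \<i> * of_real (Im (f x) - \<psi>2 x))"
    by (auto simp: complex_eq_iff)
  moreover have "L2_norm (\<lambda>x. of_real (Re (f x) - \<psi>1 x) + \<i> * of_real (Im (f x) - \<psi>2 x)) \<le>
      L2_norm (\<lambda>x. of_real (Re (f x) - \<psi>1 x)) + L2_norm (\<lambda>x. \<i> * of_real (Im (f x) - \<psi>2 x))"
    using L2_diff[OF L2_Re[OF f] t(1)] L2_diff[OF L2_Im[OF f] t(2)]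
    by (intro L2_norm_triangle L2_scale) auto
  ultimately show ?thesis using 1 2 that[of \<psi>1 \<psi>2] by (simp only: L2_norm_scale) simp
qed

text \<open>
  The factor 2 is the price for testing a complex function with real functions only.
\<close>

lemma L2_norm_le_dual:
  assumes f: "f \<in> L2" and "C \<ge> 0"
    and dual: "\<And>\<psi>. \<psi> \<in> test_functions_off_0 \<Longrightarrow>
      cmod (\<integral>x. f x * of_real (\<psi> x) \<partial>lborel) \<le> C * L2_norm (\<lambda>x. of_real (\<psi> x))"
  shows "L2_norm f \<le> 2 * C"
proof -
  define N where "N = L2_norm f"
  have "N \<ge> 0" by (simp add: N_def)
  have key: "N\<^sup>2 \<le> 2 * C * N + e" if "e > 0" for e
  proof -
    \<comment> \<open>Chosen so that the total error \<open>(2 * C + N) * e'\<close> collected below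
      is at most e.\<close>
    define e' where "e' = e / (2 * C + N + 1)"
    have "e' > 0" "(2 * C + N) * e' \<le> e"
      using that \<open>C \<ge> 0\<close> \<open>N \<ge> 0\<close> by (auto simp: e'_def field_simps)
    obtain \<psi>1 \<psi>2 where \<psi>: "\<psi>1 \<in> test_functions_off_0" "\<psi>2 \<in> test_functions_off_0"
      and le: "L2_norm (\<lambda>x. f x - (of_real (\<psi>1 x) + \<i> * of_real (\<psi>2 x))) < e'"
      by (rule L2_approx_test_functions[OF f \<open>e' > 0\<close>])
    define g where "g x = of_real (\<psi>1 x) + \<i> * of_real (\<psi>2 x)" for x
    note t = \<psi>(1)[THEN test_functions_off_0_D, THEN test_function_L2]
      \<psi>(2)[THEN test_functions_off_0_D, THEN test_function_L2]
    have g: "g \<in> L2" unfolding g_def by (intro L2_add L2_scale t)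
    have "(\<lambda>x. cnj (f x - g x)) \<in> borel_measurable borel"
      using L2_measurable[OF L2_diff[OF f g]]
      by (intro borel_measurable_continuous_on[OF continuous_on_cnj[OF continuous_on_id]])
    then have cfg: "(\<lambda>x. cnj (f x - g x)) \<in> L2"
      by (rule L2_dominated(1)[OF L2_diff[OF f g], of _ 1]) (simp_all del: complex_cnj_diff)
    have gN: "L2_norm g \<le> N + e'"
      using L2_norm_triangle[OF f L2_diff[OF g f]] le[folded g_def]
      by (simp add: L2_norm_diff_commute[of g f] N_def)
    have le1: "L2_norm (\<lambda>x. of_real (\<psi>1 x)) \<le> 1 * L2_norm g"
      by (rule L2_dominated(2)[OF g]) (use L2_measurable[OF t(1)] in
          \<open>auto simp: g_def cmod_def intro!: AE_I2 real_le_rsqrt\<close>)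
    have le2: "L2_norm (\<lambda>x. of_real (\<psi>2 x)) \<le> 1 * L2_norm g"
      by (rule L2_dominated(2)[OF g]) (use L2_measurable[OF t(2)] in
          \<open>auto simp: g_def cmod_def intro!: AE_I2 real_le_rsqrt\<close>)
    have "of_real (N\<^sup>2) = (\<integral>x. complex_of_real ((cmod (f x))\<^sup>2) \<partial>lborel)"
      by (simp add: N_def L2_norm_power2 del: of_real_power)
    \<comment> \<open>The squared modulus is f times its conjugate, and the conjugate is split as
      conj g + conj (f - g). The first part has real test functions as real and imaginary parts, so
      \<open>dual\<close> applies; the second is small in norm.\<close>
    also have "\<dots> = (\<integral>x. f x * of_real (\<psi>1 x) - \<i> * (f x * of_real (\<psi>2 x)) + f x * cnj (f x - g x) \<partial>lborel)"
      by (intro Bochner_Integration.integral_cong)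
        (auto simp: complex_norm_square[symmetric] g_def algebra_simps simp del: of_real_power)
    also have "\<dots> = (\<integral>x. f x * of_real (\<psi>1 x) \<partial>lborel) - \<i> * (\<integral>x. f x * of_real (\<psi>2 x) \<partial>lborel)
        + (\<integral>x. f x * cnj (f x - g x) \<partial>lborel)"
      using integrable_mult_L2[OF f t(1)] integrable_mult_L2[OF f t(2)] integrable_mult_L2[OF f cfg]
      by simp
    finally have "N\<^sup>2 = cmod \<dots>" by (metis abs_power2 norm_of_real)
    also have "\<dots> \<le> cmod (\<integral>x. f x * of_real (\<psi>1 x) \<partial>lborel) + cmod (\<integral>x. f x * of_real (\<psi>2 x) \<partial>lborel)
        + cmod (\<integral>x. f x * cnj (f x - g x) \<partial>lborel)"
      by (rule order_trans[OF norm_triangle_ineq add_right_mono, OF order_trans[OF norm_triangle_ineq4]])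
        (simp add: norm_mult)
    also have "\<dots> \<le> C * L2_norm g + C * L2_norm g + N * L2_norm (\<lambda>x. cnj (f x - g x))"
      using dual[OF \<psi>(1)] dual[OF \<psi>(2)] L2_Cauchy_Schwarz[OF f cfg]
        mult_left_mono[OF le1 \<open>C \<ge> 0\<close>] mult_left_mono[OF le2 \<open>C \<ge> 0\<close>]
      unfolding N_def by linarith
    also have "L2_norm (\<lambda>x. cnj (f x - g x)) = L2_norm (\<lambda>x. f x - g x)"
      unfolding L2_norm_eq complex_mod_cnj ..
    also have "C * L2_norm g + C * L2_norm g + N * L2_norm (\<lambda>x. f x - g x) \<le>
        C * (N + e') + C * (N + e') + N * e'"
      using gN le \<open>C \<ge> 0\<close> \<open>N \<ge> 0\<close> by (intro add_mono mult_left_mono) (auto simp: g_def)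
    also have "\<dots> = 2 * C * N + (2 * C + N) * e'" by (simp add: algebra_simps)
    finally show ?thesis using \<open>(2 * C + N) * e' \<le> e\<close> by linarith
  qed
  have "N\<^sup>2 \<le> 2 * C * N" by (rule field_le_epsilon[OF key])
  then have "N \<le> 2 * C"
    using \<open>N \<ge> 0\<close> \<open>C \<ge> 0\<close> by (cases "N = 0") (auto simp: power2_eq_square)
  then show ?thesis by (simp add: N_def)
qed

section \<open>The flow of the characteristics\<close>

text \<open>The value -1 at 0 matters. With \<open>sgn\<close> the closed formula for
  \<open>flow\<close> would send 0 to t; with -1 the logarithm cancels the drift and 0 stays
  fixed.\<close>

definition side :: "real \<Rightarrow> real" where
  "side x = (if x > 0 then 1 else - 1)"

text \<open>For nonzero x this is the ratio a(x) / a(X(t,x)) with a = 1 - phi^2, in a closed form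
  that also makes sense at 0, where the ratio is 0/0. It is a convex combination of 1 and
  \<open>exp (- 2 * side x * t)\<close>, which bounds it from both sides.\<close>

definition contraction :: "real \<Rightarrow> real \<Rightarrow> real" where
  "contraction t x = (1 - (phi x)\<^sup>2) + (phi x)\<^sup>2 * exp (- 2 * side x * t)"

text \<open>
  The flow of \<open>dX/dt = 1 - \<phi>(X)\<^sup>2\<close>; its spatial derivative is the reciprocal of \<open>contraction\<close>.
\<close>

definition flow :: "real \<Rightarrow> real \<Rightarrow> real" where
  "flow t x = x + t + side x / 2 * ln (contraction t x)"

lemma phi_power2: "(phi x)\<^sup>2 = exp (- 2 * \<bar>x\<bar>)"
  by (simp add: phi_def power2_eq_square exp_add[symmetric])

lemma phi_power2_bounds: "0 < (phi x)\<^sup>2" "(phi x)\<^sup>2 \<le> 1"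
  by (simp_all add: phi_power2)

lemma convex_comb_bounds:
  fixes p y :: real
  assumes "0 \<le> p" "p \<le> 1"
  shows "min 1 y \<le> (1 - p) + p * y" "(1 - p) + p * y \<le> max 1 y"
proof -
  have *: "(1 - p) + p * y = (1 - p) * 1 + p * y" by simp
  have "(1 - p) * min 1 y + p * min 1 y \<le> (1 - p) * 1 + p * y"
    using assms by (intro add_mono mult_left_mono) auto
  then show "min 1 y \<le> (1 - p) + p * y" by (simp add: algebra_simps)
  have "(1 - p) * 1 + p * y \<le> (1 - p) * max 1 y + p * max 1 y"
    using assms by (intro add_mono mult_left_mono) auto
  then show "(1 - p) + p * y \<le> max 1 y" by (simp add: algebra_simps)
qed

lemma contraction_bounds:
  "min 1 (exp (- 2 * side x * t)) \<le> contraction t x" "contraction t x \<le> max 1 (exp (- 2 * side x * t))"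
  unfolding contraction_def using convex_comb_bounds[of "(phi x)\<^sup>2"] phi_power2_bounds[of x] by auto

lemma contraction_pos [simp]: "contraction t x > 0"
  using contraction_bounds(1)[of x t] by (smt (verit) exp_gt_zero)

lemma contraction_nonzero [simp]: "contraction t x \<noteq> 0"
  using contraction_pos[of t x] by linarith

lemma contraction_lower: "exp (- 2 * \<bar>t\<bar>) \<le> contraction t x"
proof -
  have "- 2 * \<bar>t\<bar> \<le> - 2 * side x * t"
    by (cases "x > 0"; cases "t > 0"; simp add: side_def)
  then have "exp (- 2 * \<bar>t\<bar>) \<le> exp (- 2 * side x * t)" by (simp only: exp_le_cancel_iff)
  then have "exp (- 2 * \<bar>t\<bar>) \<le> min 1 (exp (- 2 * side x * t))" by simp
  then show ?thesis using contraction_bounds(1)[of x t] by linarith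
qed

lemma contraction_upper: "contraction t x \<le> exp (2 * \<bar>t\<bar>)"
proof -
  have "- 2 * side x * t \<le> 2 * \<bar>t\<bar>"
    by (cases "x > 0"; cases "t > 0"; simp add: side_def)
  then have "exp (- 2 * side x * t) \<le> exp (2 * \<bar>t\<bar>)" by (simp only: exp_le_cancel_iff)
  then have "max 1 (exp (- 2 * side x * t)) \<le> exp (2 * \<bar>t\<bar>)" by simp
  then show ?thesis using contraction_bounds(2)[of t x] by linarith
qed

lemma contraction_0 [simp]: "contraction 0 x = 1"
  by (simp add: contraction_def)

lemma flow_0 [simp]: "flow 0 x = x"
  by (simp add: flow_def)

text \<open>Solves the formula for \<open>flow\<close>, since \<open>side\<close> squares to 1.
  Multiplicative identities for \<open>contraction\<close> thereby become additive identities for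
  displacements.\<close>

lemma contraction_eq_exp: "contraction t x = exp (2 * side x * (flow t x - x - t))"
proof -
  have "2 * side x * (flow t x - x - t) = ln (contraction t x)"
    by (simp add: flow_def side_def)
  then show ?thesis by simp
qed

text \<open>Along a positive characteristic y = exp (2X) - 1 satisfies the linear equation y' = 2y,
  because X' = 1 - exp (-2X). In this coordinate the flow is a scaling, from which the group law,
  monotonicity and preservation of the half-line are immediate. On the negative side exp (-2X) - 1
  decays at the same rate.\<close>

lemma exp_flow_pos: "x > 0 \<Longrightarrow> exp (2 * flow t x) = 1 + (exp (2 * x) - 1) * exp (2 * t)"
proof -
  assume "x > 0"
  then have "exp (2 * flow t x) = exp (2 * x) * exp (2 * t) * contraction t x"
    unfolding flow_def side_def by (simp add: exp_add distrib_left)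
  also have "contraction t x = (1 - exp (- 2 * x)) + exp (- 2 * x) * exp (- 2 * t)"
    using \<open>x > 0\<close> by (simp add: contraction_def side_def phi_power2)
  also have "exp (2 * x) * exp (2 * t) * \<dots> =
      exp (2 * x) * exp (2 * t) - exp (2 * t) + 1"
    by (simp add: algebra_simps exp_minus)
  finally show ?thesis by (simp add: algebra_simps)
qed

lemma exp_flow_nonpos: "x \<le> 0 \<Longrightarrow> exp (- 2 * flow t x) = 1 + (exp (- 2 * x) - 1) * exp (- 2 * t)"
proof -
  assume "x \<le> 0"
  have "- 2 * flow t x = - 2 * x + - 2 * t + ln (contraction t x)"
    using \<open>x \<le> 0\<close> unfolding flow_def side_def by (simp add: distrib_left)
  then have "exp (- 2 * flow t x) = exp (- 2 * x) * exp (- 2 * t) * contraction t x"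
    by (simp only: exp_add exp_ln[OF contraction_pos])
  also have "contraction t x = (1 - exp (2 * x)) + exp (2 * x) * exp (2 * t)"
    using \<open>x \<le> 0\<close> by (simp add: contraction_def side_def phi_power2)
  also have "exp (- 2 * x) * exp (- 2 * t) * \<dots> =
      exp (- 2 * x) * exp (- 2 * t) - exp (- 2 * t) + 1"
    by (simp add: algebra_simps exp_minus)
  finally show ?thesis by (simp add: algebra_simps)
qed

lemma flow_pos: "x > 0 \<Longrightarrow> flow t x > 0"
proof -
  assume "x > 0"
  then have "exp (2 * flow t x) > 1" unfolding exp_flow_pos[OF \<open>x > 0\<close>] by simp
  then show ?thesis by simp
qed

lemma flow_neg: "x < 0 \<Longrightarrow> flow t x < 0"
proof -
  assume "x < 0"
  then have "exp (- 2 * flow t x) > 1" using exp_flow_nonpos[of x t] by simp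
  then show ?thesis by simp
qed

lemma flow_at_0 [simp]: "flow t 0 = 0"
  using exp_flow_nonpos[of 0 t] by simp

lemma flow_pos_iff [simp]: "flow t x > 0 \<longleftrightarrow> x > 0"
  and flow_neg_iff [simp]: "flow t x < 0 \<longleftrightarrow> x < 0"
  and flow_eq_0_iff [simp]: "flow t x = 0 \<longleftrightarrow> x = 0"
  using flow_pos[of x t] flow_neg[of x t] flow_at_0[of t] by (cases x "0::real" rule: linorder_cases; force)+

lemma side_flow [simp]: "side (flow t x) = side x"
  by (simp add: side_def)

lemma flow_flow [simp]: "flow s (flow t x) = flow (s + t) x"
proof (cases "x > 0")
  case True
  then have "exp (2 * flow s (flow t x)) = exp (2 * flow (s + t) x)"
    by (simp add: exp_flow_pos exp_add distrib_left)
  then show ?thesis by simp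
next
  case False
  then have "x \<le> 0" "flow t x \<le> 0" by (simp_all flip: not_less)
  have "exp (- 2 * (s + t)) = exp (- 2 * t) * exp (- 2 * s)"
    by (simp add: exp_add[symmetric] algebra_simps)
  then have "exp (- 2 * flow s (flow t x)) = exp (- 2 * flow (s + t) x)"
    unfolding exp_flow_nonpos[OF \<open>flow t x \<le> 0\<close>] exp_flow_nonpos[OF \<open>x \<le> 0\<close>] by simp
  then show ?thesis by simp
qed

lemma contraction_cocycle: "contraction (s + t) x = contraction s (flow t x) * contraction t x"
proof -
  have "contraction (s + t) x = exp (2 * side x * (flow (s + t) x - flow t x - s) + 2 * side x * (flow t x - x - t))"
    unfolding contraction_eq_exp[of "s + t"] by (simp add: algebra_simps)
  then show ?thesis unfolding contraction_eq_exp[of s] contraction_eq_exp[of t] exp_add by simp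
qed

lemma contraction_inverse: "contraction t (flow (- t) x) = 1 / contraction (- t) x"
  using contraction_cocycle[of t "- t" x] by (simp add: field_simps)

lemma coefficient_flow: "1 - (phi (flow t x))\<^sup>2 = (1 - (phi x)\<^sup>2) / contraction t x"
proof -
  \<comment> \<open>Here E and e stand for exp (2|X|) and exp (2|x|), T is the scaling factor of the
    linear coordinate, and q is \<open>contraction t x\<close>. Both half-lines reduce to this
    identity.\<close>
  have *: "1 - inverse E = (1 - inverse e) / q" if "E = e * T * q" "E - 1 = (e - 1) * T" "e > 0" "T > 0" "q > 0"
    for E e T q :: real
  proof -
    have "1 - inverse E = (E - 1) / E" using that by (simp add: field_simps)
    also have "\<dots> = (e - 1) * T / (e * T * q)" by (simp only: that(1,2)[symmetric])
    also have "\<dots> = (1 - inverse e) / q" using that by (simp add: field_simps)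
    finally show ?thesis .
  qed
  show ?thesis
  proof (cases "x > 0")
    case True
    have "exp (2 * flow t x) = exp (2 * x) * exp (2 * t) * contraction t x"
      unfolding contraction_eq_exp using True by (simp add: side_def exp_add[symmetric] algebra_simps)
    from *[OF this] show ?thesis
      using True exp_flow_pos[OF True] by (simp add: phi_power2 exp_minus abs_of_pos)
  next
    case False
    then have "x \<le> 0" "flow t x \<le> 0" by (simp_all flip: not_less)
    have "exp (- 2 * flow t x) = exp (- 2 * x) * exp (- 2 * t) * contraction t x"
      unfolding contraction_eq_exp using False by (simp add: side_def exp_add[symmetric] algebra_simps)
    from *[OF this] show ?thesis
      using \<open>x \<le> 0\<close> \<open>flow t x \<le> 0\<close> exp_flow_nonpos[OF \<open>x \<le> 0\<close>, of t]
      by (simp add: phi_power2 exp_minus abs_of_nonpos)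
  qed
qed

lemma flow_strict_mono:
  assumes "x < y"
  shows "flow t x < flow t y"
proof -
  consider "x \<le> 0" "y > 0" | "x > 0" "y > 0" | "x \<le> 0" "y \<le> 0" using assms by linarith
  then show ?thesis
  proof cases
    case 1
    then have "flow t x \<le> 0" "flow t y > 0" by (simp_all flip: not_less)
    then show ?thesis by linarith
  next
    case 2
    have "exp (2 * flow t x) < exp (2 * flow t y)" using 2 assms by (simp add: exp_flow_pos)
    then show ?thesis by simp
  next
    case 3
    have "exp (- 2 * flow t x) > exp (- 2 * flow t y)"
      using 3 assms exp_flow_nonpos[of x t] exp_flow_nonpos[of y t] by simp
    then show ?thesis by simp
  qed
qed

lemma flow_less_iff: "flow t x < y \<longleftrightarrow> x < flow (- t) y"
proof
  assume "flow t x < y"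
  from flow_strict_mono[OF this, of "- t"] show "x < flow (- t) y" by simp
next
  assume "x < flow (- t) y"
  from flow_strict_mono[OF this, of t] show "flow t x < y" by simp
qed

lemma less_flow_iff: "y < flow t x \<longleftrightarrow> flow (- t) y < x"
  using flow_less_iff[of "- t" y x] by simp

lemma flow_eq_pos: "x \<ge> 0 \<Longrightarrow> flow t x = ln (1 + (exp (2 * x) - 1) * exp (2 * t)) / 2"
  using arg_cong[OF exp_flow_pos[of x t], of ln] by (cases "x = 0") auto

lemma flow_eq_neg: "x \<le> 0 \<Longrightarrow> flow t x = - ln (1 + (exp (- 2 * x) - 1) * exp (- 2 * t)) / 2"
  using arg_cong[OF exp_flow_nonpos[of x t], of ln] by auto

text \<open>For nonzero t both \<open>side\<close> and \<open>contraction t\<close> jump at 0, so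
  continuity is not visible in the definition. The logarithmic formulas are continuous on the closed
  half-lines, and the two pieces are glued at 0.\<close>

lemma continuous_on_flow: "continuous_on UNIV (flow t)"
proof -
  have "continuous_on {0..} (\<lambda>x. ln (1 + (exp (2 * x) - 1) * exp (2 * t)) / 2)"
    by (intro continuous_intros) (auto intro!: add_pos_nonneg less_imp_neq[symmetric])
  then have 1: "continuous_on {0..} (flow t)"
    by (rule continuous_on_cong[THEN iffD1, OF refl, rotated]) (simp add: flow_eq_pos)
  have "continuous_on {..0} (\<lambda>x. - ln (1 + (exp (- 2 * x) - 1) * exp (- 2 * t)) / 2)"
    by (intro continuous_intros) (auto intro!: add_pos_nonneg less_imp_neq[symmetric])
  then have 2: "continuous_on {..0} (flow t)"
    by (rule continuous_on_cong[THEN iffD1, OF refl, rotated]) (simp add: flow_eq_neg)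
  have "UNIV = {0..} \<union> {..0::real}" by auto
  then show ?thesis using continuous_on_closed_Un[OF _ _ 1 2] by simp
qed

lemma borel_measurable_flow [measurable]: "flow t \<in> borel_measurable borel"
  by (rule borel_measurable_continuous_onI[OF continuous_on_flow])

lemma borel_measurable_contraction [measurable]: "contraction t \<in> borel_measurable borel"
  unfolding contraction_def[abs_def] phi_def side_def by measurable

section \<open>Derivatives of the flow and change of variables\<close>

definition contraction_dx :: "real \<Rightarrow> real \<Rightarrow> real" where
  "contraction_dx t x = 2 * side x * (phi x)\<^sup>2 * (1 - exp (- 2 * side x * t))"

definition contraction_dt :: "real \<Rightarrow> real \<Rightarrow> real" where
  "contraction_dt t x = - 2 * side x * (phi x)\<^sup>2 * exp (- 2 * side x * t)"

lemma DERIV_phi_power2: "x \<noteq> 0 \<Longrightarrow> ((\<lambda>x. (phi x)\<^sup>2) has_real_derivative - 2 * side x * (phi x)\<^sup>2) (at x)"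
proof -
  assume "x \<noteq> 0"
  have 1: "((\<lambda>y. exp (- 2 * (side x * y))) has_real_derivative - 2 * side x * (phi x)\<^sup>2) (at x)"
    using \<open>x \<noteq> 0\<close> by (auto intro!: derivative_eq_intros simp: phi_power2 side_def)
  have "\<forall>\<^sub>F y in nhds x. side x * y > 0"
    using eventually_nhds_in_open[of "{0<..}" x] eventually_nhds_in_open[of "{..<0}" x] \<open>x \<noteq> 0\<close>
    by (cases "x > 0") (auto simp: side_def)
  then have "\<forall>\<^sub>F y in nhds x. exp (- 2 * (side x * y)) = (phi y)\<^sup>2"
    by eventually_elim (auto simp: phi_power2 side_def split: if_splits)
  from DERIV_cong_ev[THEN iffD1, OF refl this refl 1] show ?thesis .
qed

lemma eventually_side: "x \<noteq> 0 \<Longrightarrow> \<forall>\<^sub>F y in nhds x. side y = side x"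
  using eventually_nhds_in_open[of "{0<..}" x] eventually_nhds_in_open[of "{..<0}" x]
  by (cases "x > 0") (auto simp: side_def elim!: eventually_mono)

lemma DERIV_contraction_x:
  assumes "x \<noteq> 0"
  shows "(contraction t has_real_derivative contraction_dx t x) (at x)"
proof -
  have "((\<lambda>y. (1 - (phi y)\<^sup>2) + (phi y)\<^sup>2 * exp (- 2 * side x * t)) has_real_derivative contraction_dx t x) (at x)"
    using DERIV_add[OF DERIV_diff[OF DERIV_const[of 1] DERIV_phi_power2[OF assms]]
        DERIV_cmult_right[OF DERIV_phi_power2[OF assms], of "exp (- 2 * side x * t)"]]
    by (simp add: contraction_dx_def algebra_simps)
  moreover have "\<forall>\<^sub>F y in nhds x. (1 - (phi y)\<^sup>2) + (phi y)\<^sup>2 * exp (- 2 * side x * t) = contraction t y"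
    using eventually_side[OF assms] by eventually_elim (simp add: contraction_def)
  ultimately show ?thesis by (rule DERIV_cong_ev[THEN iffD1, OF refl _ refl, rotated])
qed

lemma DERIV_contraction_t:
  "((\<lambda>t. contraction t x) has_real_derivative contraction_dt t x) (at t)"
  unfolding contraction_def contraction_dt_def
  by (auto intro!: derivative_eq_intros)

lemma DERIV_flow_x:
  assumes "x \<noteq> 0"
  shows "(flow t has_real_derivative 1 / contraction t x) (at x)"
proof -
  have "((\<lambda>y. y + t + side x / 2 * ln (contraction t y)) has_real_derivative
      1 + side x / 2 * (contraction_dx t x / contraction t x)) (at x)"
    using DERIV_contraction_x[OF assms, of t] by (auto intro!: derivative_eq_intros)
  moreover have "1 + side x / 2 * (contraction_dx t x / contraction t x) = 1 / contraction t x"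
  proof -
    have "contraction t x + side x / 2 * contraction_dx t x = 1"
      by (simp add: contraction_def contraction_dx_def side_def algebra_simps)
    moreover have "1 + side x / 2 * (contraction_dx t x / contraction t x) =
        (contraction t x + side x / 2 * contraction_dx t x) / contraction t x"
      by (simp add: add_divide_distrib)
    ultimately show ?thesis by simp
  qed
  moreover have "\<forall>\<^sub>F y in nhds x. y + t + side x / 2 * ln (contraction t y) = flow t y"
    using eventually_side[OF assms] by eventually_elim (simp add: flow_def)
  ultimately show ?thesis using DERIV_cong_ev[OF refl _ refl] by metis
qed

lemma DERIV_flow_t:
  "((\<lambda>t. flow t x) has_real_derivative (1 - (phi x)\<^sup>2) / contraction t x) (at t)"
proof -
  have "((\<lambda>t. flow t x) has_real_derivative 1 + side x / 2 * (contraction_dt t x / contraction t x)) (at t)"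
    unfolding flow_def using DERIV_contraction_t[of x t] by (auto intro!: derivative_eq_intros)
  moreover have "1 + side x / 2 * (contraction_dt t x / contraction t x) = (1 - (phi x)\<^sup>2) / contraction t x"
  proof -
    have "contraction t x + side x / 2 * contraction_dt t x = 1 - (phi x)\<^sup>2"
      by (simp add: contraction_def contraction_dt_def side_def algebra_simps)
    moreover have "1 + side x / 2 * (contraction_dt t x / contraction t x) =
        (contraction t x + side x / 2 * contraction_dt t x) / contraction t x"
      by (simp add: add_divide_distrib)
    ultimately show ?thesis by simp
  qed
  ultimately show ?thesis by simp
qed

text \<open>Substitution y = X(t,x) as an equality of measures, checked on intervals. The
  fundamental theorem of calculus is used in a form that tolerates the exceptional point 0, where
  the flow is only continuous.\<close>

lemma lborel_eq_distr_flow: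
  "lborel = distr (density lborel (\<lambda>x. ennreal (1 / contraction t x))) borel (flow t)"
proof (rule lborel_eqI)
  fix l u :: real
  assume "\<And>b. b \<in> Basis \<Longrightarrow> l \<bullet> b \<le> u \<bullet> b"
  then have "l \<le> u" by simp
  define l' u' where "l' = flow (- t) l" and "u' = flow (- t) u"
  have "l' \<le> u'"
    using \<open>l \<le> u\<close> flow_strict_mono[of l u "- t"] by (cases "l = u") (auto simp: l'_def u'_def)
  have pre: "flow t -` {l<..<u} = {l'<..<u'}"
    by (auto simp: l'_def u'_def flow_less_iff[of t] less_flow_iff[of _ t])
  have "((\<lambda>x. 1 / contraction t x) has_integral (flow t u' - flow t l')) {l'..u'}"
  proof (rule fundamental_theorem_of_calculus_interior_strong[of "{0}"])
    show "(flow t has_vector_derivative 1 / contraction t x) (at x)" if "x \<in> {l'<..<u'} - {0}" for x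
      using that DERIV_flow_x has_real_derivative_iff_has_vector_derivative by blast
    show "continuous_on {l'..u'} (flow t)" by (rule continuous_on_subset[OF continuous_on_flow]) auto
  qed (use \<open>l' \<le> u'\<close> in auto)
  then have "((\<lambda>x. 1 / contraction t x) has_integral (u - l)) {l'<..<u'}"
    by (simp add: has_integral_Icc_iff_Ioo l'_def u'_def)
  then have "(\<integral>\<^sup>+x. ennreal (1 / contraction t x) * indicator {l'<..<u'} x \<partial>lborel) = ennreal (u - l)"
    by (intro nn_integral_has_integral_lebesgue') (simp_all add: less_imp_le)
  then show "emeasure (distr (density lborel (\<lambda>x. ennreal (1 / contraction t x))) borel (flow t)) (box l u) =
      ennreal (\<Prod>b\<in>Basis. (u - l) \<bullet> b)"
    by (simp add: emeasure_distr emeasure_density pre)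
qed simp

lemma integrable_flow_iff:
  fixes f :: "real \<Rightarrow> 'a :: {banach, second_countable_topology}"
  assumes [measurable]: "f \<in> borel_measurable borel"
  shows "integrable lborel (\<lambda>x. (1 / contraction t x) *\<^sub>R f (flow t x)) \<longleftrightarrow> integrable lborel f"
proof -
  have "integrable lborel f \<longleftrightarrow>
      integrable (distr (density lborel (\<lambda>x. ennreal (1 / contraction t x))) borel (flow t)) f"
    by (subst lborel_eq_distr_flow[of t]) simp
  also have "\<dots> \<longleftrightarrow> integrable lborel (\<lambda>x. (1 / contraction t x) *\<^sub>R f (flow t x))"
    by (subst integrable_distr_eq) (auto simp: integrable_density less_imp_le)
  finally show ?thesis by simp
qed

lemma integral_flow:
  fixes f :: "real \<Rightarrow> 'a :: {banach, second_countable_topology}"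
  assumes [measurable]: "f \<in> borel_measurable borel"
  shows "(\<integral>x. (1 / contraction t x) *\<^sub>R f (flow t x) \<partial>lborel) = (\<integral>x. f x \<partial>lborel)"
proof -
  have "(\<integral>x. f x \<partial>lborel) =
      (\<integral>x. f x \<partial>distr (density lborel (\<lambda>x. ennreal (1 / contraction t x))) borel (flow t))"
    by (subst lborel_eq_distr_flow[of t]) simp
  also have "\<dots> = (\<integral>x. (1 / contraction t x) *\<^sub>R f (flow t x) \<partial>lborel)"
    by (subst integral_distr) (auto simp: integral_density less_imp_le)
  finally show ?thesis by simp
qed

section \<open>The group and its dual\<close>

text \<open>
  With \<open>a = 1 - \<phi>\<^sup>2\<close> the equation reads \<open>v\<^sub>t = a v' - (a'/2) v\<close>, that is \<open>u\<^sub>t = a u'\<close> for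
  \<open>u = v / sqrt a\<close>.  So \<open>u\<close> is transported along the flow, which gives the factor
  \<open>sqrt (a(x) / a(X(x))) = sqrt (contraction t x)\<close>.
\<close>

definition propagator :: "real \<Rightarrow> (real \<Rightarrow> complex) \<Rightarrow> real \<Rightarrow> complex" where
  "propagator t v x = of_real (sqrt (contraction t x)) * v (flow t x)"

text \<open>The adjoint for the bilinear pairing given by the integral of
  \<open>v x * \<psi> x\<close>. After substituting X(-t,x) the Jacobian contributes the exponent -1
  and the weight of \<open>propagator\<close> contributes -1/2.\<close>

definition dual_propagator :: "real \<Rightarrow> (real \<Rightarrow> real) \<Rightarrow> real \<Rightarrow> real" where
  "dual_propagator t \<psi> x = contraction (- t) x powr (- 3 / 2) * \<psi> (flow (- t) x)"

text \<open>The formal transpose of L, namely - (a psi)' - (a'/2) psi with a = 1 - phi^2. As a' =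
  \<open>2 * side x * (phi x)\<^sup>2\<close>, the two multiples of a' psi add up to the factor
  3.\<close>

definition dual_generator :: "(real \<Rightarrow> real) \<Rightarrow> (real \<Rightarrow> real) \<Rightarrow> real \<Rightarrow> real" where
  "dual_generator \<psi> \<psi>' x = - ((1 - (phi x)\<^sup>2) * \<psi>' x + 3 * side x * (phi x)\<^sup>2 * \<psi> x)"

lemma borel_measurable_propagator:
  "v \<in> borel_measurable borel \<Longrightarrow> propagator t v \<in> borel_measurable borel"
  unfolding propagator_def[abs_def]
  by (intro borel_measurable_times measurable_compose[OF borel_measurable_flow]) measurable

lemma propagator_0 [simp]: "propagator 0 v = v"
  by (simp add: propagator_def[abs_def])

lemma propagator_propagator: "propagator s (propagator t v) = propagator (s + t) v"
proof
  fix x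
  have "contraction (s + t) x = contraction s x * contraction t (flow s x)"
    using contraction_cocycle[of t s x] by (simp add: ac_simps)
  then show "propagator s (propagator t v) x = propagator (s + t) v x"
    by (simp add: propagator_def real_sqrt_mult add.commute)
qed

lemma propagator_diff: "propagator t (\<lambda>x. f x - g x) = (\<lambda>x. propagator t f x - propagator t g x)"
  and propagator_divide: "propagator t (\<lambda>x. f x / c) = (\<lambda>x. propagator t f x / c)"
  by (auto simp: propagator_def algebra_simps)

text \<open>The squared weight contributes one factor \<open>contraction t x\<close>, the Jacobian
  another. The squared norm therefore grows by at most M^2, and the norm by M rather than its square
  root. Invariance of A under the flow localises the estimate to half-lines.\<close>

lemma propagator_norm_on_le:
  assumes v: "v \<in> L2" and [measurable]: "A \<in> sets borel"
    and inv: "\<And>x. flow t x \<in> A \<longleftrightarrow> x \<in> A"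
    and M: "\<And>x. x \<in> A \<Longrightarrow> contraction t x \<le> M" "M \<ge> 0"
  shows "integrable lborel (\<lambda>x. indicator A x * (cmod (propagator t v x))\<^sup>2)"
    and "L2_norm_on A (propagator t v) \<le> M * L2_norm_on A v"
proof -
  note [measurable] = L2_measurable[OF v] borel_measurable_propagator[OF L2_measurable[OF v]]
  define F where "F x = indicator A x * (cmod (v x))\<^sup>2" for x
  have [measurable]: "F \<in> borel_measurable borel" unfolding F_def by measurable
  have "integrable lborel F"
    unfolding F_def using integrable_mult_indicator[OF _ L2_integrable[OF v], of A] by simp
  then have int: "integrable lborel (\<lambda>x. M\<^sup>2 * ((1 / contraction t x) *\<^sub>R F (flow t x)))"
    by (intro integrable_mult_right integrable_flow_iff[THEN iffD2]) measurable
  have le: "indicator A x * (cmod (propagator t v x))\<^sup>2 \<le> M\<^sup>2 * ((1 / contraction t x) *\<^sub>R F (flow t x))" for x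
  proof (cases "x \<in> A")
    case True
    have "(contraction t x)\<^sup>2 \<le> M\<^sup>2" using M(1)[OF True] by (intro power_mono) (auto intro: less_imp_le)
    then have "contraction t x \<le> M\<^sup>2 / contraction t x" by (simp add: field_simps power2_eq_square)
    then have "contraction t x * (cmod (v (flow t x)))\<^sup>2 \<le> M\<^sup>2 / contraction t x * (cmod (v (flow t x)))\<^sup>2"
      by (rule mult_right_mono) simp
    then show ?thesis using True
      by (simp add: F_def inv propagator_def norm_mult power_mult_distrib less_imp_le)
  qed (simp add: F_def inv)
  show int1: "integrable lborel (\<lambda>x. indicator A x * (cmod (propagator t v x))\<^sup>2)"
  proof (rule Bochner_Integration.integrable_bound[OF int])
    show "AE x in lborel. norm (indicator A x * (cmod (propagator t v x))\<^sup>2) \<le>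
        norm (M\<^sup>2 * ((1 / contraction t x) *\<^sub>R F (flow t x)))"
    proof (rule AE_I2)
      fix x
      have "0 \<le> indicator A x * (cmod (propagator t v x))\<^sup>2" by simp
      then show "norm (indicator A x * (cmod (propagator t v x))\<^sup>2) \<le>
          norm (M\<^sup>2 * ((1 / contraction t x) *\<^sub>R F (flow t x)))"
        unfolding real_norm_def using le[of x] by linarith
    qed
  qed measurable
  note integral_mono[OF int1 int le]
  also have "(\<integral>x. M\<^sup>2 * ((1 / contraction t x) *\<^sub>R F (flow t x)) \<partial>lborel) =
      M\<^sup>2 * (\<integral>x. (1 / contraction t x) *\<^sub>R F (flow t x) \<partial>lborel)"
    by (rule integral_mult_right_zero)
  also have "(\<integral>x. (1 / contraction t x) *\<^sub>R F (flow t x) \<partial>lborel) = (\<integral>x. F x \<partial>lborel)"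
    by (rule integral_flow) measurable
  finally have "(\<integral>x. indicator A x * (cmod (propagator t v x))\<^sup>2 \<partial>lborel) \<le> M\<^sup>2 * (\<integral>x. F x \<partial>lborel)" .
  then have "sqrt (\<integral>x. indicator A x * (cmod (propagator t v x))\<^sup>2 \<partial>lborel) \<le> sqrt (M\<^sup>2 * (\<integral>x. F x \<partial>lborel))"
    by simp
  then show "L2_norm_on A (propagator t v) \<le> M * L2_norm_on A v"
    using M(2) by (simp add: L2_norm_on_def set_lebesgue_integral_def F_def real_sqrt_mult)
qed

section \<open>Boundedness and strong continuity of the group\<close>

lemma propagator_L2: "v \<in> L2 \<Longrightarrow> propagator t v \<in> L2"
  and propagator_norm_le: "v \<in> L2 \<Longrightarrow> L2_norm (propagator t v) \<le> exp (2 * \<bar>t\<bar>) * L2_norm v"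
  using propagator_norm_on_le[of v UNIV t "exp (2 * \<bar>t\<bar>)"] contraction_upper
    borel_measurable_propagator[OF L2_measurable] by (auto simp: L2_def)

text \<open>Finite speed: compact supports stay in a common bounded set for bounded times. The crude
  constant adds |t| from the drift and |t| from half the logarithm.\<close>

lemma flow_displacement: "\<bar>flow t x - x\<bar> \<le> 2 * \<bar>t\<bar>"
proof -
  have "ln (contraction t x) \<le> ln (exp (2 * \<bar>t\<bar>))" "ln (exp (- 2 * \<bar>t\<bar>)) \<le> ln (contraction t x)"
    using contraction_upper[of t x] contraction_lower[of t x]
    by (simp_all only: ln_le_cancel_iff contraction_pos exp_gt_zero)
  then show ?thesis by (auto simp: flow_def side_def abs_le_iff)
qed

lemma L2_tendsto_0_at:
  assumes "w \<in> L2" and meas: "\<And>h. s h \<in> borel_measurable borel"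
    and le: "\<And>h x. \<bar>h\<bar> \<le> 1 \<Longrightarrow> h \<noteq> 0 \<Longrightarrow> cmod (s h x) \<le> cmod (w x)"
    and lim: "\<And>x. x \<noteq> 0 \<Longrightarrow> ((\<lambda>h. s h x) \<longlongrightarrow> 0) (at 0)"
  shows "((\<lambda>h. L2_norm (s h)) \<longlongrightarrow> 0) (at (0::real))"
proof -
  have ev: "\<forall>\<^sub>F h in at (0::real). \<bar>h\<bar> \<le> 1 \<and> h \<noteq> 0"
    by (auto simp: eventually_at intro!: exI[of _ 1])
  \<comment> \<open>A sequence tending to 0 may start outside the range where the domination holds;
    cutting off there makes it valid for all indices without changing the limit.\<close>
  define s' where "s' h = (if \<bar>h\<bar> \<le> 1 \<and> h \<noteq> 0 then s h else (\<lambda>x. 0))" for h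
  have "((\<lambda>h. L2_norm (s' h)) \<longlongrightarrow> 0) (at 0)"
    unfolding LIMSEQ_SEQ_conv[symmetric]
  proof (intro allI impI)
    fix S :: "nat \<Rightarrow> real" assume S: "(\<forall>n. S n \<noteq> 0) \<and> S \<longlonglongrightarrow> 0"
    show "(\<lambda>n. L2_norm (s' (S n))) \<longlonglongrightarrow> 0"
    proof (rule L2_dominated_convergence[OF assms(1)])
      show "s' (S n) \<in> borel_measurable borel" for n by (simp add: s'_def meas)
      show "AE x in lborel. cmod (s' (S n) x) \<le> cmod (w x)" for n
        using le by (auto simp: s'_def)
      show "AE x in lborel. (\<lambda>n. s' (S n) x) \<longlonglongrightarrow> 0"
        using AE_lborel_singleton[of 0]
      proof eventually_elim
        case (elim x)
        have "\<forall>\<^sub>F h in at 0. s h x = s' h x" using ev by eventually_elim (simp add: s'_def)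
        with lim[OF elim] have "((\<lambda>h. s' h x) \<longlongrightarrow> 0) (at 0)" by (rule Lim_transform_eventually)
        from LIMSEQ_SEQ_conv[THEN iffD2, OF this] S show ?case by blast
      qed
    qed
  qed
  moreover have "\<forall>\<^sub>F h in at 0. L2_norm (s' h) = L2_norm (s h)"
    using ev by eventually_elim (simp add: s'_def)
  ultimately show ?thesis by (rule Lim_transform_eventually)
qed

lemma tendsto_flow_t: "((\<lambda>t. flow t x) \<longlongrightarrow> flow t0 x) (at t0)"
  using DERIV_isCont[OF DERIV_flow_t[of x t0]] by (simp add: isCont_def)

lemma tendsto_contraction_t: "((\<lambda>t. contraction t x) \<longlongrightarrow> contraction t0 x) (at t0)"
  using DERIV_isCont[OF DERIV_contraction_t[of x t0]] by (simp add: isCont_def)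

lemma propagator_tendsto_compact_support:
  assumes cont: "continuous_on UNIV g" and supp: "\<And>x. \<bar>x\<bar> \<ge> R \<Longrightarrow> g x = 0"
  shows "((\<lambda>h. L2_norm (\<lambda>x. propagator h g x - g x)) \<longlongrightarrow> 0) (at 0)"
proof -
  have [measurable]: "g \<in> borel_measurable borel" by (rule borel_measurable_continuous_onI[OF cont])
  have "bounded (g ` {-R..R})"
    by (intro compact_imp_bounded compact_continuous_image continuous_on_subset[OF cont]) auto
  then obtain C where C: "\<And>x. x \<in> {-R..R} \<Longrightarrow> cmod (g x) \<le> C" unfolding bounded_iff by blast
  have bd: "cmod (g x) \<le> \<bar>C\<bar>" for x
    using C[of x] supp[of x] by (cases "\<bar>x\<bar> \<ge> R") (auto simp: not_le abs_less_iff)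
  \<comment> \<open>For |h| \<le> 1 the weight of the propagator is at most e, which gives the first
    summand; the second bounds g itself. The radius R + 2 below comes from
    \<open>flow_displacement\<close>.\<close>
  define K where "K = exp 1 * \<bar>C\<bar> + \<bar>C\<bar>"
  define w where "w x = complex_of_real (K * indicator {-(R+2)..R+2} x)" for x
  have "K \<ge> 0" by (simp add: K_def)
  show ?thesis
  proof (rule L2_tendsto_0_at[of w])
    show "w \<in> L2" using L2_scale[OF indicator_L2, of "of_real K"] by (simp add: w_def[abs_def])
    show "(\<lambda>x. propagator h g x - g x) \<in> borel_measurable borel" for h
      by (intro borel_measurable_diff borel_measurable_propagator) auto
    show "cmod (propagator h g x - g x) \<le> cmod (w x)" if "\<bar>h\<bar> \<le> 1" for h x
    proof (cases "\<bar>x\<bar> > R + 2")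
      case True
      then have "\<bar>flow h x\<bar> \<ge> R" using flow_displacement[of h x] that by linarith
      then show ?thesis using True by (simp add: propagator_def supp)
    next
      case False
      have "contraction h x \<le> (exp 1)\<^sup>2"
        using contraction_upper[of h x] that
        by (auto simp: exp_double[symmetric] intro: order_trans)
      then have "sqrt (contraction h x) \<le> sqrt ((exp 1)\<^sup>2)" by (rule real_sqrt_le_mono)
      then have "sqrt (contraction h x) \<le> exp 1" by simp
      then have "cmod (propagator h g x) \<le> exp 1 * \<bar>C\<bar>"
        unfolding propagator_def norm_mult using bd by (intro mult_mono) (auto simp: less_imp_le)
      then have "cmod (propagator h g x - g x) \<le> K"
        using norm_triangle_ineq4[of "propagator h g x" "g x"] bd[of x] by (simp add: K_def)
      then show ?thesis using False \<open>K \<ge> 0\<close>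
        by (simp only: w_def norm_of_real) (simp add: indicator_def abs_le_iff not_less)
    qed
    show "((\<lambda>h. propagator h g x - g x) \<longlongrightarrow> 0) (at 0)" for x
    proof -
      have "((\<lambda>h. g (flow h x)) \<longlongrightarrow> g x) (at 0)"
        using isCont_tendsto_compose[OF _ tendsto_flow_t[of x 0], of g] cont
        by (simp add: continuous_on_eq_continuous_at)
      then have "((\<lambda>h. propagator h g x - g x) \<longlongrightarrow> of_real (sqrt (contraction 0 x)) * g x - g x) (at 0)"
        unfolding propagator_def by (intro tendsto_intros tendsto_contraction_t)
      then show ?thesis by simp
    qed
  qed
qed

lemma test_function_continuous: "\<psi> \<in> test_functions \<Longrightarrow> continuous_on UNIV \<psi>"
  by (intro continuous_at_imp_continuous_on ballI
      DERIV_isCont[OF times_differentiable_DERIV[OF test_functionsD(1)]])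

lemma propagator_tendsto_0:
  assumes v: "v \<in> L2"
  shows "((\<lambda>h. L2_norm (\<lambda>x. propagator h v x - v x)) \<longlongrightarrow> 0) (at 0)"
proof (rule tendstoI)
  fix e :: real assume "e > 0"
  \<comment> \<open>The error of replacing v by g enters once through the propagator, with norm at
    most \<open>exp 2\<close> for |h| \<le> 1, and once directly.\<close>
  define c where "c = exp 2 + (1::real)"
  define e' where "e' = e / (2 * c)"
  have "c > 0" by (simp add: c_def add_pos_pos)
  then have "e' > 0" "c * e' = e / 2" using \<open>e > 0\<close> by (simp_all add: e'_def)
  obtain \<psi>1 \<psi>2 where \<psi>: "\<psi>1 \<in> test_functions_off_0" "\<psi>2 \<in> test_functions_off_0"
    and le: "L2_norm (\<lambda>x. v x - (of_real (\<psi>1 x) + \<i> * of_real (\<psi>2 x))) < e'"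
    by (rule L2_approx_test_functions[OF v \<open>e' > 0\<close>])
  define g where "g x = of_real (\<psi>1 x) + \<i> * of_real (\<psi>2 x)" for x
  note t = \<psi>[THEN test_functions_off_0_D]
  have g: "g \<in> L2" unfolding g_def[abs_def] by (intro L2_add L2_scale test_function_L2 t)
  have cont: "continuous_on UNIV g"
    unfolding g_def by (intro continuous_intros test_function_continuous t)
  obtain R1 R2 where "\<And>x. \<bar>x\<bar> \<ge> R1 \<Longrightarrow> \<psi>1 x = 0" "\<And>x. \<bar>x\<bar> \<ge> R2 \<Longrightarrow> \<psi>2 x = 0"
    using test_functionsD(2)[OF t(1)] test_functionsD(2)[OF t(2)] by blast
  then have "\<bar>x\<bar> \<ge> max R1 R2 \<Longrightarrow> g x = 0" for x by (simp add: g_def)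
  from propagator_tendsto_compact_support[OF cont this]
  have "((\<lambda>h. L2_norm (\<lambda>x. propagator h g x - g x)) \<longlongrightarrow> 0) (at 0)" .
  then have "\<forall>\<^sub>F h in at 0. L2_norm (\<lambda>x. propagator h g x - g x) < e / 2"
    using \<open>e > 0\<close> by (auto dest: order_tendstoD(2)[where a="e/2"])
  moreover have "\<forall>\<^sub>F h in at (0::real). \<bar>h\<bar> \<le> 1" by (auto simp: eventually_at intro!: exI[of _ 1])
  ultimately show "\<forall>\<^sub>F h in at 0. dist (L2_norm (\<lambda>x. propagator h v x - v x)) 0 < e"
  proof eventually_elim
    case (elim h)
    have d: "(\<lambda>x. v x - g x) \<in> L2" by (rule L2_diff[OF v g])
    have "L2_norm (propagator h (\<lambda>x. v x - g x)) \<le> exp (2 * \<bar>h\<bar>) * L2_norm (\<lambda>x. v x - g x)"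
      by (rule propagator_norm_le[OF d])
    also have "\<dots> \<le> exp 2 * e'"
      using elim(2) le by (intro mult_mono) (auto simp: g_def)
    finally have 1: "L2_norm (\<lambda>x. propagator h v x - propagator h g x) \<le> exp 2 * e'"
      by (simp add: propagator_diff)
    have "L2_norm (\<lambda>x. propagator h v x - v x) \<le> L2_norm (\<lambda>x. propagator h v x - propagator h g x) +
        (L2_norm (\<lambda>x. propagator h g x - g x) + L2_norm (\<lambda>x. g x - v x))"
      using L2_norm_triangle_diff[OF propagator_L2[OF v] propagator_L2[OF g] v, of h h]
        L2_norm_triangle_diff[OF propagator_L2[OF g] g v, of h] by linarith
    also have "L2_norm (\<lambda>x. g x - v x) < e'"
      using le by (subst L2_norm_diff_commute) (simp add: g_def)
    finally show ?case using 1 elim(1) \<open>c * e' = e / 2\<close> by (simp add: c_def algebra_simps)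
  qed
qed

lemma propagator_tendsto:
  assumes v: "v \<in> L2"
  shows "((\<lambda>s. L2_norm (\<lambda>x. propagator s v x - propagator t v x)) \<longlongrightarrow> 0) (at t)"
proof -
  have "((\<lambda>s. L2_norm (\<lambda>x. propagator (s - t) v x - v x)) \<longlongrightarrow> 0) (at t)"
    using propagator_tendsto_0[OF v] by (simp add: LIM_offset_zero_iff[of t] del: LIM_offset_zero_iff)
  then have lim: "((\<lambda>s. exp (2 * \<bar>t\<bar>) * L2_norm (\<lambda>x. propagator (s - t) v x - v x)) \<longlongrightarrow> 0) (at t)"
    by (rule tendsto_mult_right_zero)
  have "L2_norm (\<lambda>x. propagator s v x - propagator t v x) \<le>
      exp (2 * \<bar>t\<bar>) * L2_norm (\<lambda>x. propagator (s - t) v x - v x)" for s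
    using propagator_norm_le[OF L2_diff[OF propagator_L2[OF v] v], of t "s - t"]
    by (simp add: propagator_diff propagator_propagator)
  then show ?thesis
    by (intro tendsto_sandwich[OF _ _ tendsto_const lim]) auto
qed

section \<open>The dual group on compactly supported C^1 functions\<close>

lemma propagator_dual:
  assumes [measurable]: "v \<in> borel_measurable borel" "\<psi> \<in> borel_measurable borel"
  shows "(\<integral>x. propagator t v x * of_real (\<psi> x) \<partial>lborel) =
    (\<integral>x. v x * of_real (dual_propagator t \<psi> x) \<partial>lborel)"
proof -
  have [measurable]: "propagator t v \<in> borel_measurable borel"
    by (rule borel_measurable_propagator) measurable
  have *: "(1 / q) * sqrt (1 / q) = q powr (- 3 / 2)" if "q > 0" for q :: real
  proof -
    have "q powr (- 3 / 2) = inverse (q powr (1 + 1 / 2))"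
      using powr_minus[of q "1 + 1 / 2"] by simp
    also have "\<dots> = (1 / q) * sqrt (1 / q)"
      unfolding powr_add using that by (simp add: powr_half_sqrt real_sqrt_divide field_simps)
    finally show ?thesis ..
  qed
  have "(\<integral>x. propagator t v x * of_real (\<psi> x) \<partial>lborel) =
      (\<integral>x. (1 / contraction (- t) x) *\<^sub>R (propagator t v (flow (- t) x) * of_real (\<psi> (flow (- t) x))) \<partial>lborel)"
    by (rule integral_flow[symmetric]) measurable
  also have "(\<lambda>x. (1 / contraction (- t) x) *\<^sub>R (propagator t v (flow (- t) x) * of_real (\<psi> (flow (- t) x)))) =
      (\<lambda>x. v x * of_real (dual_propagator t \<psi> x))"
  proof
    fix x
    have "(1 / contraction (- t) x) *\<^sub>R (propagator t v (flow (- t) x) * of_real (\<psi> (flow (- t) x))) =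
        of_real ((1 / contraction (- t) x) * sqrt (1 / contraction (- t) x)) * (v x * of_real (\<psi> (flow (- t) x)))"
      by (simp add: propagator_def contraction_inverse scaleR_conv_of_real mult_ac)
    then show "(1 / contraction (- t) x) *\<^sub>R (propagator t v (flow (- t) x) * of_real (\<psi> (flow (- t) x))) =
        v x * of_real (dual_propagator t \<psi> x)"
      unfolding *[OF contraction_pos] by (simp add: dual_propagator_def mult_ac)
  qed
  finally show ?thesis .
qed

lemma dual_propagator_0 [simp]: "dual_propagator 0 \<psi> = \<psi>"
  by (simp add: dual_propagator_def[abs_def])

lemma dual_propagator_add: "dual_propagator (s + t) \<psi> = dual_propagator s (dual_propagator t \<psi>)"
proof
  fix x
  have "contraction (- (s + t)) x = contraction (- t) (flow (- s) x) * contraction (- s) x"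
    using contraction_cocycle[of "- t" "- s" x] by (simp add: algebra_simps)
  then show "dual_propagator (s + t) \<psi> x = dual_propagator s (dual_propagator t \<psi>) x"
    by (simp add: dual_propagator_def powr_mult less_imp_le mult_ac add.commute)
qed

text \<open>Wide enough to contain the images under the dual group of test functions that vanish
  near 0. The derivative is carried as a second argument because \<open>dual_generator\<close>
  refers to it.\<close>

definition C1_compact :: "(real \<Rightarrow> real) \<Rightarrow> (real \<Rightarrow> real) \<Rightarrow> bool" where
  "C1_compact \<psi> \<psi>' \<longleftrightarrow> (\<forall>x. (\<psi> has_real_derivative \<psi>' x) (at x)) \<and> continuous_on UNIV \<psi>' \<and>
     (\<exists>R. \<forall>x. \<bar>x\<bar> \<ge> R \<longrightarrow> \<psi> x = 0)"

lemma C1_compactE: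
  assumes "C1_compact \<psi> \<psi>'"
  obtains R M where "R > 0" "M \<ge> 0" "\<forall>x. \<bar>x\<bar> \<ge> R \<longrightarrow> \<psi> x = 0" "\<forall>x. \<bar>x\<bar> \<ge> R \<longrightarrow> \<psi>' x = 0"
    "\<forall>x. \<bar>\<psi> x\<bar> \<le> M" "\<forall>x. \<bar>\<psi>' x\<bar> \<le> M"
proof -
  obtain R0 where R0: "\<And>x. \<bar>x\<bar> \<ge> R0 \<Longrightarrow> \<psi> x = 0" using assms by (auto simp: C1_compact_def)
  \<comment> \<open>The enlarged radius gives each point with |x| \<ge> R a neighbourhood on which
    \<open>\<psi>\<close> vanishes, so that \<open>\<psi>'\<close> vanishes there too.\<close>
  define R where "R = \<bar>R0\<bar> + 1"
  have D: "(\<psi> has_real_derivative \<psi>' x) (at x)" for x using assms by (simp add: C1_compact_def)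
  have z: "\<psi> x = 0" if "\<bar>x\<bar> \<ge> R" for x using R0[of x] that by (auto simp: R_def)
  have z': "\<psi>' x = 0" if "\<bar>x\<bar> \<ge> R" for x
  proof -
    have "open {y. \<bar>y\<bar> > \<bar>R0\<bar>}" by (intro open_Collect_less continuous_intros)
    then have "\<forall>\<^sub>F y in nhds x. \<psi> y = 0"
      using eventually_nhds_in_open[of "{y. \<bar>y\<bar> > \<bar>R0\<bar>}" x] that
      by (auto simp: R_def elim!: eventually_mono intro!: R0)
    from DERIV_cong_ev[THEN iffD1, OF refl this refl D] show ?thesis
      using DERIV_unique DERIV_const by blast
  qed
  have "continuous_on {-R..R} \<psi>" using D by (intro continuous_at_imp_continuous_on ballI DERIV_isCont)
  then have "bounded (\<psi> ` {-R..R})" by (intro compact_imp_bounded compact_continuous_image) auto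
  then obtain M1 where M1: "\<forall>x\<in>{-R..R}. \<bar>\<psi> x\<bar> \<le> M1" unfolding bounded_real by blast
  have "continuous_on {-R..R} \<psi>'" using assms continuous_on_subset by (auto simp: C1_compact_def)
  then have "bounded (\<psi>' ` {-R..R})" by (intro compact_imp_bounded compact_continuous_image) auto
  then obtain M2 where M2: "\<forall>x\<in>{-R..R}. \<bar>\<psi>' x\<bar> \<le> M2" unfolding bounded_real by blast
  have "\<bar>\<psi> x\<bar> \<le> \<bar>M1\<bar> + \<bar>M2\<bar> \<and> \<bar>\<psi>' x\<bar> \<le> \<bar>M1\<bar> + \<bar>M2\<bar>" for x
  proof (cases "\<bar>x\<bar> \<ge> R")
    case True
    then show ?thesis by (simp add: z z')
  next
    case False
    then have "x \<in> {-R..R}" by auto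
    then have "\<bar>\<psi> x\<bar> \<le> M1" "\<bar>\<psi>' x\<bar> \<le> M2" using M1 M2 by blast+
    then show ?thesis by linarith
  qed
  moreover have "R > 0" by (simp add: R_def)
  ultimately show ?thesis using that[of R "\<bar>M1\<bar> + \<bar>M2\<bar>"] z z' by simp
qed

lemma test_function_C1_compact: "\<psi> \<in> test_functions \<Longrightarrow> C1_compact \<psi> (deriv \<psi>)"
proof -
  assume *: "\<psi> \<in> test_functions"
  have "times_differentiable 0 (deriv \<psi>)" using test_functionsD(1)[OF *, of "Suc 0"] by simp
  then have "continuous_on UNIV (deriv \<psi>)"
    by (intro continuous_at_imp_continuous_on ballI DERIV_isCont[OF times_differentiable_DERIV])
  then show ?thesis
    using test_functionsD[OF *] times_differentiable_DERIV by (auto simp: C1_compact_def)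
qed

lemma DERIV_dual_propagator_t:
  assumes "\<And>x. (\<psi> has_real_derivative \<psi>' x) (at x)"
  shows "((\<lambda>h. dual_propagator h \<psi> x) has_real_derivative
    (- 3 / 2 * contraction (- h) x powr (- 5 / 2)) * (- contraction_dt (- h) x) * \<psi> (flow (- h) x) +
    \<psi>' (flow (- h) x) * (- ((1 - (phi x)\<^sup>2) / contraction (- h) x)) * contraction (- h) x powr (- 3 / 2)) (at h)"
proof -
  have neg: "((\<lambda>h. - h) has_real_derivative - 1) (at h)" by (auto intro!: derivative_eq_intros)
  have c: "((\<lambda>h. contraction (- h) x) has_real_derivative - contraction_dt (- h) x) (at h)"
    using DERIV_chain2[OF DERIV_contraction_t neg] by simp
  have f: "((\<lambda>h. flow (- h) x) has_real_derivative - ((1 - (phi x)\<^sup>2) / contraction (- h) x)) (at h)"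
    using DERIV_chain2[OF DERIV_flow_t neg] by simp
  have p: "((\<lambda>h. contraction (- h) x powr (- 3 / 2)) has_real_derivative
      (- 3 / 2 * contraction (- h) x powr (- 5 / 2)) * (- contraction_dt (- h) x)) (at h)"
    by (rule DERIV_chain2[OF _ c]) (auto intro!: derivative_eq_intros simp: less_imp_le)
  show ?thesis
    unfolding dual_propagator_def using DERIV_mult[OF p DERIV_chain2[OF assms f]] by simp
qed

text \<open>The corner at 0 concerns the space variable only: for fixed x the dependence on h is
  differentiable. The mean value inequality bounds the difference quotients uniformly, finite speed
  bounds their supports, and dominated convergence applies.\<close>

lemma dual_propagator_has_L2_derivative:
  assumes \<psi>: "C1_compact \<psi> \<psi>'"
  shows "((\<lambda>h. L2_norm (\<lambda>x. of_real ((dual_propagator h \<psi> x - \<psi> x) / h - dual_generator \<psi> \<psi>' x))) \<longlongrightarrow> 0) (at 0)"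
proof -
  obtain R M where "R > 0" "M \<ge> 0" "\<forall>x. \<bar>x\<bar> \<ge> R \<longrightarrow> \<psi> x = 0" "\<forall>x. \<bar>x\<bar> \<ge> R \<longrightarrow> \<psi>' x = 0"
    "\<forall>x. \<bar>\<psi> x\<bar> \<le> M" "\<forall>x. \<bar>\<psi>' x\<bar> \<le> M" by (rule C1_compactE[OF \<psi>])
  note RM = this(1,2) this(3-6)[rule_format]
  have D: "(\<psi> has_real_derivative \<psi>' x) (at x)" for x using \<psi> by (simp add: C1_compact_def)
  have [measurable]: "\<psi> \<in> borel_measurable borel"
    by (intro borel_measurable_continuous_onI continuous_at_imp_continuous_on ballI DERIV_isCont[OF D])
  have [measurable]: "\<psi>' \<in> borel_measurable borel"
    using \<psi> by (intro borel_measurable_continuous_onI) (simp add: C1_compact_def)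
  define q where "q h x = (- 3 / 2 * contraction (- h) x powr (- 5 / 2)) * (- contraction_dt (- h) x) * \<psi> (flow (- h) x) +
    \<psi>' (flow (- h) x) * (- ((1 - (phi x)\<^sup>2) / contraction (- h) x)) * contraction (- h) x powr (- 3 / 2)" for h x
  have Dq: "((\<lambda>h. dual_propagator h \<psi> x) has_real_derivative q h x) (at h)" for h x
    unfolding q_def by (rule DERIV_dual_propagator_t[OF D])
  have q0: "q 0 x = dual_generator \<psi> \<psi>' x" for x
    by (simp add: q_def dual_generator_def contraction_dt_def algebra_simps)
  \<comment> \<open>The two terms of q are bounded separately for |h| \<le> 1:
    \<open>contraction\<close> is at least \<open>exp (- 2)\<close>, so its powers -5/2, -3/2 and -1
    are at most \<open>exp 5\<close>, \<open>exp 3\<close> and \<open>exp 2\<close>, while its time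
    derivative is at most \<open>2 * exp 2\<close>.\<close>
  define K where "K = 3 / 2 * exp 5 * (2 * exp 2) * M + M * exp 2 * exp 3"
  have "K \<ge> 0" using RM by (simp add: K_def)
  have q_bd: "\<bar>q h x\<bar> \<le> K" if "\<bar>h\<bar> \<le> 1" for h x
  proof -
    have lo: "exp (- 2) \<le> contraction (- h) x"
      using contraction_lower[of "- h" x] that by (auto intro: order_trans[rotated])
    have p5: "contraction (- h) x powr (- 5 / 2) \<le> exp 5"
      using powr_mono2'[OF _ _ lo, of "- 5 / 2"] by (simp add: powr_def)
    have p3: "contraction (- h) x powr (- 3 / 2) \<le> exp 3"
      using powr_mono2'[OF _ _ lo, of "- 3 / 2"] by (simp add: powr_def)
    have "\<bar>(1 - (phi x)\<^sup>2) / contraction (- h) x\<bar> \<le> 1 / exp (- 2)"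
      unfolding abs_divide using phi_power2_bounds[of x] lo by (intro frac_le) auto
    moreover have "1 / exp (- 2) = (exp 2 :: real)" by (simp add: exp_minus divide_inverse)
    ultimately have a: "\<bar>(1 - (phi x)\<^sup>2) / contraction (- h) x\<bar> \<le> exp 2" by metis
    have "2 * side x * h \<le> 2" using that by (auto simp: side_def abs_le_iff)
    then have "(phi x)\<^sup>2 * exp (2 * side x * h) \<le> 1 * exp 2"
      using phi_power2_bounds[of x] by (intro mult_mono) auto
    then have dt: "\<bar>contraction_dt (- h) x\<bar> \<le> 2 * exp 2"
      by (auto simp: contraction_dt_def abs_mult side_def)
    have "\<bar>q h x\<bar> \<le> (3 / 2 * contraction (- h) x powr (- 5 / 2)) * \<bar>contraction_dt (- h) x\<bar> * \<bar>\<psi> (flow (- h) x)\<bar> +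
        \<bar>\<psi>' (flow (- h) x)\<bar> * \<bar>(1 - (phi x)\<^sup>2) / contraction (- h) x\<bar> * contraction (- h) x powr (- 3 / 2)"
      unfolding q_def by (rule order_trans[OF abs_triangle_ineq]) (simp add: abs_mult)
    also have "\<dots> \<le> K"
      unfolding K_def using RM p5 p3 a dt by (intro add_mono mult_mono mult_nonneg_nonneg) auto
    finally show ?thesis .
  qed
  have far: "dual_propagator h \<psi> x = 0" if "\<bar>h\<bar> \<le> 1" "\<bar>x\<bar> > R + 2" for h x
  proof -
    have "\<bar>flow (- h) x\<bar> \<ge> R" using flow_displacement[of "- h" x] that by linarith
    then show ?thesis by (simp add: dual_propagator_def RM)
  qed
  define w where "w x = complex_of_real ((2 * K) * indicator {-(R+2)..R+2} x)" for x
  show ?thesis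
  proof (rule L2_tendsto_0_at[of w])
    show "w \<in> L2" using L2_scale[OF indicator_L2, of "of_real (2 * K)"] by (simp add: w_def[abs_def])
    show "(\<lambda>x. complex_of_real ((dual_propagator h \<psi> x - \<psi> x) / h - dual_generator \<psi> \<psi>' x)) \<in> borel_measurable borel" for h
      unfolding dual_propagator_def dual_generator_def phi_def side_def by measurable
    show "cmod (of_real ((dual_propagator h \<psi> x - \<psi> x) / h - dual_generator \<psi> \<psi>' x)) \<le> cmod (w x)"
      if h: "\<bar>h\<bar> \<le> 1" "h \<noteq> 0" for h x
    proof (cases "\<bar>x\<bar> > R + 2")
      case True
      then have "\<bar>x\<bar> \<ge> R" by simp
      then show ?thesis using True far[OF h(1) True] by (simp add: RM dual_generator_def)
    next
      case False
      have "norm (dual_propagator h \<psi> x - dual_propagator 0 \<psi> x) \<le> K * norm (h - 0)"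
      proof (rule field_differentiable_bound[of "{-1..1}"])
        show "((\<lambda>h. dual_propagator h \<psi> x) has_real_derivative q z x) (at z within {-1..1})" for z
          by (rule has_field_derivative_at_within[OF Dq])
      qed (use q_bd h in \<open>auto simp: abs_le_iff\<close>)
      then have "\<bar>(dual_propagator h \<psi> x - \<psi> x) / h\<bar> \<le> K"
        using h by (simp add: abs_divide divide_le_eq)
      moreover have "\<bar>dual_generator \<psi> \<psi>' x\<bar> \<le> K" using q_bd[of 0 x] by (simp add: q0)
      ultimately have "\<bar>(dual_propagator h \<psi> x - \<psi> x) / h - dual_generator \<psi> \<psi>' x\<bar> \<le> 2 * K" by linarith
      then show ?thesis using False \<open>K \<ge> 0\<close>
        by (simp only: w_def norm_of_real) (simp add: indicator_def abs_le_iff not_less)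
    qed
    show "((\<lambda>h. complex_of_real ((dual_propagator h \<psi> x - \<psi> x) / h - dual_generator \<psi> \<psi>' x)) \<longlongrightarrow> 0) (at 0)" for x
    proof -
      have "((\<lambda>h. (dual_propagator h \<psi> x - \<psi> x) / h) \<longlongrightarrow> q 0 x) (at 0)"
        using Dq[of x 0] by (simp add: DERIV_def)
      then have "((\<lambda>h. complex_of_real ((dual_propagator h \<psi> x - \<psi> x) / h - dual_generator \<psi> \<psi>' x)) \<longlongrightarrow>
          complex_of_real (q 0 x - dual_generator \<psi> \<psi>' x)) (at 0)"
        by (intro tendsto_intros)
      then show ?thesis by (simp add: q0)
    qed
  qed
qed

definition C1_off_0 :: "(real \<Rightarrow> real) \<Rightarrow> (real \<Rightarrow> real) \<Rightarrow> bool" where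
  "C1_off_0 \<psi> \<psi>' \<longleftrightarrow> C1_compact \<psi> \<psi>' \<and> (\<exists>\<delta>>0. \<forall>x. \<bar>x\<bar> < \<delta> \<longrightarrow> \<psi> x = 0)"

lemma C1_compact_DERIV: "C1_compact \<psi> \<psi>' \<Longrightarrow> (\<psi> has_real_derivative \<psi>' x) (at x)"
  by (simp add: C1_compact_def)

lemma C1_compact_measurable:
  assumes "C1_compact \<psi> \<psi>'"
  shows "\<psi> \<in> borel_measurable borel" "\<psi>' \<in> borel_measurable borel"
  using assms by (auto simp: C1_compact_def intro!: borel_measurable_continuous_onI
      intro: continuous_at_imp_continuous_on DERIV_isCont)

lemma C1_compact_L2:
  assumes "C1_compact \<psi> \<psi>'"
  shows "(\<lambda>x. of_real (\<psi> x)) \<in> L2"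
proof -
  note [measurable] = C1_compact_measurable[OF assms]
  obtain R M where "R > 0" "M \<ge> 0" "\<forall>x. \<bar>x\<bar> \<ge> R \<longrightarrow> \<psi> x = 0" "\<forall>x. \<bar>x\<bar> \<ge> R \<longrightarrow> \<psi>' x = 0"
    "\<forall>x. \<bar>\<psi> x\<bar> \<le> M" "\<forall>x. \<bar>\<psi>' x\<bar> \<le> M" by (rule C1_compactE[OF assms])
  then show ?thesis by (intro bounded_support_L2(1)[of _ M R]) auto
qed

lemma dual_generator_L2:
  assumes "C1_compact \<psi> \<psi>'"
  shows "(\<lambda>x. of_real (dual_generator \<psi> \<psi>' x)) \<in> L2"
proof -
  note [measurable] = C1_compact_measurable[OF assms]
  obtain R M where "R > 0" "M \<ge> 0" "\<forall>x. \<bar>x\<bar> \<ge> R \<longrightarrow> \<psi> x = 0" "\<forall>x. \<bar>x\<bar> \<ge> R \<longrightarrow> \<psi>' x = 0"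
    "\<forall>x. \<bar>\<psi> x\<bar> \<le> M" "\<forall>x. \<bar>\<psi>' x\<bar> \<le> M" by (rule C1_compactE[OF assms])
  note RM = this(1,2) this(3-6)[rule_format]
  have le: "\<bar>dual_generator \<psi> \<psi>' x\<bar> \<le> 1 * M + 3 * 1 * M" for x
  proof -
    have "\<bar>dual_generator \<psi> \<psi>' x\<bar> \<le> \<bar>1 - (phi x)\<^sup>2\<bar> * \<bar>\<psi>' x\<bar> + 3 * (phi x)\<^sup>2 * \<bar>\<psi> x\<bar>"
      unfolding dual_generator_def abs_minus_cancel
      by (rule order_trans[OF abs_triangle_ineq]) (simp add: abs_mult side_def)
    also have "\<dots> \<le> 1 * M + 3 * 1 * M"
      using RM(2,5,6) phi_power2_bounds[of x] by (intro add_mono mult_mono) auto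
    finally show ?thesis .
  qed
  show ?thesis
  proof (rule bounded_support_L2(1)[of _ "1 * M + 3 * 1 * M" R])
    show "(\<lambda>x. complex_of_real (dual_generator \<psi> \<psi>' x)) \<in> borel_measurable borel"
      unfolding dual_generator_def phi_def side_def by measurable
    show "cmod (of_real (dual_generator \<psi> \<psi>' x)) \<le> 1 * M + 3 * 1 * M" for x
      using le[of x] by (simp only: norm_of_real)
    show "complex_of_real (dual_generator \<psi> \<psi>' x) = 0" if "\<bar>x\<bar> > R" for x
      using RM that by (simp add: dual_generator_def)
  qed
qed

lemma borel_measurable_dual_propagator:
  "\<psi> \<in> borel_measurable borel \<Longrightarrow> dual_propagator t \<psi> \<in> borel_measurable borel"
  unfolding dual_propagator_def[abs_def]
  by (intro borel_measurable_times measurable_compose[OF borel_measurable_flow]) measurable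

lemma dual_propagator_L2:
  assumes "C1_compact \<psi> \<psi>'"
  shows "(\<lambda>x. of_real (dual_propagator t \<psi> x)) \<in> L2"
proof -
  note [measurable] = borel_measurable_dual_propagator[OF C1_compact_measurable(1)[OF assms]]
  obtain R M where "R > 0" "M \<ge> 0" "\<forall>x. \<bar>x\<bar> \<ge> R \<longrightarrow> \<psi> x = 0" "\<forall>x. \<bar>x\<bar> \<ge> R \<longrightarrow> \<psi>' x = 0"
    "\<forall>x. \<bar>\<psi> x\<bar> \<le> M" "\<forall>x. \<bar>\<psi>' x\<bar> \<le> M" by (rule C1_compactE[OF assms])
  note RM = this(1,2) this(3-6)[rule_format]
  have le: "\<bar>dual_propagator t \<psi> x\<bar> \<le> exp (- 2 * \<bar>t\<bar>) powr (- 3 / 2) * M" for x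
  proof -
    have "contraction (- t) x powr (- 3 / 2) \<le> exp (- 2 * \<bar>t\<bar>) powr (- 3 / 2)"
      using contraction_lower[of "- t" x] by (intro powr_mono2') auto
    then show ?thesis unfolding dual_propagator_def abs_mult using RM(2,5) by (intro mult_mono) auto
  qed
  show ?thesis
  proof (rule bounded_support_L2(1)[of _ "exp (- 2 * \<bar>t\<bar>) powr (- 3 / 2) * M" "R + 2 * \<bar>t\<bar>"])
    show "complex_of_real (dual_propagator t \<psi> x) = 0" if "\<bar>x\<bar> > R + 2 * \<bar>t\<bar>" for x
    proof -
      have "\<bar>flow (- t) x\<bar> \<ge> R" using flow_displacement[of "- t" x] that by linarith
      then show ?thesis using RM by (simp add: dual_propagator_def)
    qed
    show "cmod (of_real (dual_propagator t \<psi> x)) \<le> exp (- 2 * \<bar>t\<bar>) powr (- 3 / 2) * M" for x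
      using le[of x] by (simp only: norm_of_real)
  qed measurable
qed

lemma isCont_contraction_dx: "x \<noteq> 0 \<Longrightarrow> isCont (contraction_dx t) x"
proof -
  assume "x \<noteq> 0"
  have "isCont (\<lambda>y. 2 * side x * (phi y)\<^sup>2 * (1 - exp (- 2 * side x * t))) x"
    by (intro isCont_mult DERIV_isCont[OF DERIV_phi_power2[OF \<open>x \<noteq> 0\<close>]] continuous_const)
  moreover have "\<forall>\<^sub>F y in nhds x. contraction_dx t y = 2 * side x * (phi y)\<^sup>2 * (1 - exp (- 2 * side x * t))"
    using eventually_side[OF \<open>x \<noteq> 0\<close>] by eventually_elim (simp add: contraction_dx_def)
  ultimately show ?thesis using isCont_cong by fast
qed

text \<open>By continuity and since 0 is fixed, a whole neighbourhood of 0 flows into the set where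
  \<open>\<psi>\<close> vanishes, so the corner of the flow is multiplied by zero. Elsewhere flow
  and contraction are C^1 in x.\<close>

lemma dual_propagator_C1_off_0:
  assumes "C1_off_0 \<psi> \<psi>'"
  shows "\<exists>\<theta>'. C1_off_0 (dual_propagator t \<psi>) \<theta>'"
proof -
  have \<psi>: "C1_compact \<psi> \<psi>'" using assms by (simp add: C1_off_0_def)
  note D = C1_compact_DERIV[OF \<psi>]
  obtain \<delta> where \<delta>: "\<delta> > 0" "\<And>x. \<bar>x\<bar> < \<delta> \<Longrightarrow> \<psi> x = 0" using assms by (auto simp: C1_off_0_def)
  have \<psi>'0: "\<psi>' x = 0" if "\<bar>x\<bar> < \<delta>" for x
  proof -
    have "x \<in> {- \<delta><..<\<delta>}" using that by auto
    then have "\<forall>\<^sub>F y in nhds x. y \<in> {- \<delta><..<\<delta>}" by (intro eventually_nhds_in_open) auto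
    then have "\<forall>\<^sub>F y in nhds x. \<psi> y = 0" by eventually_elim (auto intro: \<delta>(2))
    from DERIV_cong_ev[THEN iffD1, OF refl this refl D] show ?thesis
      using DERIV_unique DERIV_const by blast
  qed
  have "isCont (flow (- t)) 0"
    using continuous_on_flow[of "- t"] by (simp add: continuous_on_eq_continuous_at)
  then obtain d where d: "d > 0" "\<And>x. \<bar>x\<bar> < d \<Longrightarrow> \<bar>flow (- t) x\<bar> < \<delta>"
    using \<delta>(1) by (auto simp: continuous_at_eps_delta dist_real_def)
  define F where "F x = (- 3 / 2 * contraction (- t) x powr (- 5 / 2)) * contraction_dx (- t) x * \<psi> (flow (- t) x) +
    \<psi>' (flow (- t) x) * (1 / contraction (- t) x) * contraction (- t) x powr (- 3 / 2)" for x
  have zero: "dual_propagator t \<psi> x = 0" "F x = 0" if "\<bar>x\<bar> < d" for x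
    using d(2)[OF that] \<delta>(2) \<psi>'0 by (auto simp: dual_propagator_def F_def)
  have near: "\<forall>\<^sub>F y in nhds x. \<bar>y\<bar> < d" if "\<bar>x\<bar> < d" for x
  proof -
    have "\<forall>\<^sub>F y in nhds x. y \<in> {- d<..<d}" using that by (intro eventually_nhds_in_open) auto
    then show ?thesis by eventually_elim auto
  qed
  have "(dual_propagator t \<psi> has_real_derivative F x) (at x)" for x
  proof (cases "\<bar>x\<bar> < d")
    case True
    have "\<forall>\<^sub>F y in nhds x. 0 = dual_propagator t \<psi> y"
      using near[OF True] by eventually_elim (simp add: zero)
    moreover have "((\<lambda>y. 0) has_real_derivative F x) (at x)" using zero[OF True] by simp
    ultimately show ?thesis by (rule DERIV_cong_ev[THEN iffD1, OF refl _ refl])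
  next
    case False
    then have "x \<noteq> 0" using d(1) by auto
    have "((\<lambda>x. contraction (- t) x powr (- 3 / 2)) has_real_derivative
        (- 3 / 2 * contraction (- t) x powr (- 3 / 2 - 1)) * contraction_dx (- t) x) (at x)"
      by (rule DERIV_chain2[OF has_real_derivative_powr[OF contraction_pos] DERIV_contraction_x[OF \<open>x \<noteq> 0\<close>]])
    then have p: "((\<lambda>x. contraction (- t) x powr (- 3 / 2)) has_real_derivative
        (- 3 / 2 * contraction (- t) x powr (- 5 / 2)) * contraction_dx (- t) x) (at x)"
      by simp
    show ?thesis
      unfolding dual_propagator_def[abs_def] F_def
      using DERIV_mult[OF p DERIV_chain2[OF D DERIV_flow_x[OF \<open>x \<noteq> 0\<close>]]] by simp
  qed
  moreover have "continuous_on UNIV F"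
  proof (intro continuous_at_imp_continuous_on ballI)
    fix x
    show "isCont F x"
    proof (cases "\<bar>x\<bar> < d")
      case True
      have "\<forall>\<^sub>F y in nhds x. F y = 0"
        using near[OF True] by eventually_elim (simp add: zero)
      then show ?thesis using isCont_cong[of F "\<lambda>y. 0" x] by simp
    next
      case False
      then have "x \<noteq> 0" using d(1) by auto
      note c = DERIV_isCont[OF DERIV_contraction_x[OF \<open>x \<noteq> 0\<close>, of "- t"]]
      note f = DERIV_isCont[OF DERIV_flow_x[OF \<open>x \<noteq> 0\<close>, of "- t"]]
      have "isCont \<psi>' (flow (- t) x)"
        using \<psi> by (simp add: C1_compact_def continuous_on_eq_continuous_at)
      then have "isCont (\<lambda>x. \<psi>' (flow (- t) x)) x" by (rule isCont_o2[OF f])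
      moreover have "isCont (\<lambda>x. \<psi> (flow (- t) x)) x" by (rule isCont_o2[OF f DERIV_isCont[OF D]])
      moreover have "isCont (\<lambda>x. contraction (- t) x powr c) x" for c
        using c unfolding isCont_def by (intro tendsto_intros) auto
      ultimately show ?thesis
        unfolding F_def using c isCont_contraction_dx[OF \<open>x \<noteq> 0\<close>, of "- t"]
        by (intro isCont_add isCont_mult isCont_divide continuous_const) auto
    qed
  qed
  moreover obtain R where R: "\<And>x. \<bar>x\<bar> \<ge> R \<Longrightarrow> \<psi> x = 0" using \<psi> by (auto simp: C1_compact_def)
  have "dual_propagator t \<psi> x = 0" if "\<bar>x\<bar> \<ge> R + 2 * \<bar>t\<bar>" for x
  proof -
    have "\<bar>flow (- t) x\<bar> \<ge> R" using flow_displacement[of "- t" x] that by linarith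
    then show ?thesis by (simp add: dual_propagator_def R)
  qed
  ultimately have "C1_compact (dual_propagator t \<psi>) F" by (auto simp: C1_compact_def)
  then show ?thesis using zero(1) d(1) by (auto simp: C1_off_0_def)
qed

section \<open>Approximation of C^1 functions by test functions\<close>

lemma real_polynomial_function_antiderivative:
  assumes "real_polynomial_function (p :: real \<Rightarrow> real)"
  shows "\<exists>P. real_polynomial_function P \<and> (\<forall>x. (P has_real_derivative p x) (at x))"
proof -
  obtain a n where p: "p = (\<lambda>x. \<Sum>i\<le>n. a i * x ^ i)"
    using real_polynomial_function_imp_sum[OF assms] by auto
  define P where "P x = (\<Sum>i\<le>n. a i / real (Suc i) * x ^ Suc i)" for x :: real
  have id: "real_polynomial_function (\<lambda>x::real. x)"
    by (rule real_polynomial_function.intros(1)) (rule bounded_linear_ident)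
  have "real_polynomial_function P"
    unfolding P_def[abs_def]
    by (intro real_polynomial_function_sum real_polynomial_function.intros(2,4)
        real_polynomial_function_power id finite_atMost)
  moreover have "(P has_real_derivative p x) (at x)" for x
    unfolding P_def[abs_def] p
  proof (rule DERIV_sum)
    show "((\<lambda>x. a i / real (Suc i) * x ^ Suc i) has_real_derivative a i * x ^ i) (at x)" for i
      using DERIV_cmult[OF DERIV_pow[of "Suc i" x UNIV], of "a i / real (Suc i)"]
      by (simp del: of_nat_Suc)
  qed
  ultimately show ?thesis by blast
qed

text \<open>Weierstrass approximation is applied to the derivative and then integrated, which
  controls a function and its derivative together. A wide cutoff, equal to 1 on the support of
  \<open>\<psi>\<close>, restores compact support. The radius S is the same for all e, so uniform
  errors give L2 errors.\<close>

lemma C1_compact_approx_test_function: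
  assumes "C1_compact \<psi> \<psi>'"
  obtains S where "S > 0" "\<forall>e>0. \<exists>\<theta>\<in>test_functions. \<forall>x. \<bar>\<psi> x - \<theta> x\<bar> \<le> e \<and> \<bar>\<psi>' x - deriv \<theta> x\<bar> \<le> e \<and>
    (\<bar>x\<bar> > S \<longrightarrow> \<psi> x = 0 \<and> \<psi>' x = 0 \<and> \<theta> x = 0 \<and> deriv \<theta> x = 0)"
proof -
  note D = C1_compact_DERIV[OF assms]
  obtain R M where "R > 0" "M \<ge> 0" "\<forall>x. \<bar>x\<bar> \<ge> R \<longrightarrow> \<psi> x = 0" "\<forall>x. \<bar>x\<bar> \<ge> R \<longrightarrow> \<psi>' x = 0"
    "\<forall>x. \<bar>\<psi> x\<bar> \<le> M" "\<forall>x. \<bar>\<psi>' x\<bar> \<le> M" by (rule C1_compactE[OF assms])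
  note RM = this(1,2) this(3-6)[rule_format]
  define \<eta> where "\<eta> = wide_cutoff R"
  define S where "S = R + 1"
  have "\<eta> \<in> test_functions"
    unfolding \<eta>_def by (rule test_functionsI[of _ "R + 1"])
      (auto intro: times_differentiable_wide_cutoff simp: wide_cutoff_eq_0)
  then have \<eta>: "C1_compact \<eta> (deriv \<eta>)" by (rule test_function_C1_compact)
  note D\<eta> = C1_compact_DERIV[OF \<eta>]
  obtain N where N: "N \<ge> 0" "\<And>x. \<bar>deriv \<eta> x\<bar> \<le> N" using C1_compactE[OF \<eta>] by metis
  have \<eta>_range: "0 \<le> \<eta> x" "\<eta> x \<le> 1" for x by (simp_all add: \<eta>_def wide_cutoff_range)
  have \<eta>0: "\<eta> x = 0" if "\<bar>x\<bar> > S" for x using that by (simp add: \<eta>_def S_def wide_cutoff_eq_0)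
  have \<eta>'0: "deriv \<eta> x = 0" if "\<bar>x\<bar> > S" for x
  proof -
    have "open {y. \<bar>y\<bar> > S}" by (intro open_Collect_less continuous_intros)
    then have "\<forall>\<^sub>F y in nhds x. y \<in> {y. \<bar>y\<bar> > S}" using that by (intro eventually_nhds_in_open) auto
    then have "\<forall>\<^sub>F y in nhds x. \<eta> y = 0" by eventually_elim (simp add: \<eta>0)
    from DERIV_cong_ev[THEN iffD1, OF refl this refl D\<eta>] show ?thesis
      using DERIV_unique DERIV_const by blast
  qed
  have \<psi>_eq: "\<psi> x = \<eta> x * \<psi> x" for x
    using RM(3)[of x] wide_cutoff_eq_1[of x R] by (cases "\<bar>x\<bar> \<ge> R") (auto simp: \<eta>_def)
  have \<psi>'_eq: "\<psi>' x = deriv \<eta> x * \<psi> x + \<psi>' x * \<eta> x" for x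
  proof -
    have "((\<lambda>x. \<eta> x * \<psi> x) has_real_derivative deriv \<eta> x * \<psi> x + \<psi>' x * \<eta> x) (at x)"
      by (rule DERIV_mult[OF D\<eta> D])
    moreover have "(\<lambda>x. \<eta> x * \<psi> x) = \<psi>" by (intro ext, rule \<psi>_eq[symmetric])
    ultimately have "(\<psi> has_real_derivative deriv \<eta> x * \<psi> x + \<psi>' x * \<eta> x) (at x)" by metis
    then show ?thesis using DERIV_unique D by blast
  qed
  have "\<exists>\<theta>\<in>test_functions. \<forall>x. \<bar>\<psi> x - \<theta> x\<bar> \<le> e \<and> \<bar>\<psi>' x - deriv \<theta> x\<bar> \<le> e \<and>
    (\<bar>x\<bar> > S \<longrightarrow> \<psi> x = 0 \<and> \<psi>' x = 0 \<and> \<theta> x = 0 \<and> deriv \<theta> x = 0)" if "e > 0" for e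
  proof -
    \<comment> \<open>Large enough for both errors in units of d: at most 2 S for the function, and
      2 S N + 1 for the derivative, where N bounds the derivative of the cutoff.\<close>
    define c where "c = 2 * S * (N + 1) + 1"
    define d where "d = e / c"
    have "S > 0" using RM by (simp add: S_def)
    then have "2 * S * (N + 1) \<ge> 0" using N by simp
    then have "c > 0" by (simp add: c_def)
    then have "d > 0" "d * c = e" using \<open>e > 0\<close> by (simp_all add: d_def)
    have "continuous_on {-S..S} \<psi>'"
      by (rule continuous_on_subset[of UNIV]) (use assms in \<open>simp_all add: C1_compact_def\<close>)
    from Stone_Weierstrass_real_polynomial_function[OF compact_Icc this \<open>d > 0\<close>]
    obtain p where p: "real_polynomial_function p" "\<And>x. x \<in> {-S..S} \<Longrightarrow> \<bar>\<psi>' x - p x\<bar> < d"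
      by blast
    obtain P0 where P0: "real_polynomial_function P0" "\<And>x. (P0 has_real_derivative p x) (at x)"
      using real_polynomial_function_antiderivative[OF p(1)] by blast
    \<comment> \<open>Normalised to vanish at -S, as \<open>\<psi>\<close> does, so the mean value
      estimate starts from zero error.\<close>
    define P where "P x = P0 x + (- P0 (- S))" for x
    have P: "real_polynomial_function P"
      unfolding P_def[abs_def] by (intro real_polynomial_function.intros(2,3) P0)
    have DP: "(P has_real_derivative p x) (at x)" for x
      unfolding P_def[abs_def] using P0(2)[of x] by (auto intro!: derivative_eq_intros)
    have close: "\<bar>\<psi> x - P x\<bar> \<le> d * (2 * S)" if "x \<in> {-S..S}" for x
    proof -
      have "norm ((\<psi> x - P x) - (\<psi> (- S) - P (- S))) \<le> d * norm (x - (- S))"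
      proof (rule field_differentiable_bound[of "{-S..S}"])
        show "((\<lambda>x. \<psi> x - P x) has_real_derivative \<psi>' z - p z) (at z within {-S..S})" for z
          by (intro has_field_derivative_at_within[OF DERIV_diff[OF D DP]])
        show "norm (\<psi>' z - p z) \<le> d" if "z \<in> {-S..S}" for z using p(2)[OF that] by simp
      qed (use that \<open>S > 0\<close> in auto)
      moreover have "\<psi> (- S) = 0" using RM by (simp add: S_def)
      moreover have "d * norm (x - (- S)) \<le> d * (2 * S)"
        using that \<open>d > 0\<close> by (intro mult_left_mono) auto
      ultimately show ?thesis by (simp add: P_def)
    qed
    define \<theta> where "\<theta> x = \<eta> x * P x" for x
    have \<theta>: "\<theta> \<in> test_functions"
      unfolding \<theta>_def[abs_def] \<eta>_def
      by (rule test_functionsI[of _ "R + 1"])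
        (auto intro: times_differentiable_mult times_differentiable_wide_cutoff
          times_differentiable_real_polynomial_function P simp: wide_cutoff_eq_0)
    have "(\<theta> has_real_derivative deriv \<eta> x * P x + p x * \<eta> x) (at x)" for x
      unfolding \<theta>_def[abs_def] by (rule DERIV_mult[OF D\<eta> DP])
    then have \<theta>': "deriv \<theta> x = deriv \<eta> x * P x + p x * \<eta> x" for x by (rule DERIV_imp_deriv)
    have "\<bar>\<psi> x - \<theta> x\<bar> \<le> e \<and> \<bar>\<psi>' x - deriv \<theta> x\<bar> \<le> e \<and>
      (\<bar>x\<bar> > S \<longrightarrow> \<psi> x = 0 \<and> \<psi>' x = 0 \<and> \<theta> x = 0 \<and> deriv \<theta> x = 0)" for x
    proof (cases "\<bar>x\<bar> > S")
      case True
      then have "\<bar>x\<bar> \<ge> R" by (simp add: S_def)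
      then show ?thesis using True \<open>e > 0\<close> by (simp add: RM \<theta>' \<theta>_def \<eta>0 \<eta>'0)
    next
      case False
      then have x: "x \<in> {-S..S}" by auto
      have "\<psi> x - \<theta> x = \<eta> x * (\<psi> x - P x)"
        by (subst \<psi>_eq) (simp add: \<theta>_def right_diff_distrib)
      then have "\<bar>\<psi> x - \<theta> x\<bar> = \<eta> x * \<bar>\<psi> x - P x\<bar>"
        using \<eta>_range[of x] by (simp add: abs_mult)
      also have "\<dots> \<le> 1 * (d * (2 * S))"
        using \<eta>_range close[OF x] by (intro mult_mono) auto
      also have "\<dots> \<le> d * c"
        using \<open>d > 0\<close> \<open>S > 0\<close> N(1) by (simp add: c_def algebra_simps)
      finally have 1: "\<bar>\<psi> x - \<theta> x\<bar> \<le> e" by (simp add: \<open>d * c = e\<close>)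
      have "\<psi>' x - deriv \<theta> x = deriv \<eta> x * (\<psi> x - P x) + \<eta> x * (\<psi>' x - p x)"
        by (subst \<psi>'_eq) (simp add: \<theta>' algebra_simps)
      then have "\<bar>\<psi>' x - deriv \<theta> x\<bar> \<le> \<bar>deriv \<eta> x\<bar> * \<bar>\<psi> x - P x\<bar> + \<bar>\<eta> x\<bar> * \<bar>\<psi>' x - p x\<bar>"
        by (metis abs_mult abs_triangle_ineq)
      also have "\<dots> \<le> N * (d * (2 * S)) + 1 * d"
        using N \<eta>_range close[OF x] p(2)[OF x] by (intro add_mono mult_mono) auto
      also have "\<dots> \<le> d * c"
        using \<open>d > 0\<close> \<open>S > 0\<close> N(1) by (simp add: c_def algebra_simps)
      finally have 2: "\<bar>\<psi>' x - deriv \<theta> x\<bar> \<le> e" by (simp add: \<open>d * c = e\<close>)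
      show ?thesis using 1 2 False by simp
    qed
    then show ?thesis using \<theta> by blast
  qed
  moreover have "S > 0" using RM by (simp add: S_def)
  ultimately show ?thesis using that by blast
qed

section \<open>The generator of the group\<close>

lemma tendsto_if_norm_diff_le:
  fixes f :: "real \<Rightarrow> complex"
  assumes "\<And>h. cmod (f h - l) \<le> g h" "(g \<longlongrightarrow> 0) F"
  shows "(f \<longlongrightarrow> l) F"
  by (rule LIM_zero_cancel, rule Lim_null_comparison[OF _ assms(2)]) (simp add: assms(1))

lemma pairing_dual_propagator_derivative:
  assumes f: "f \<in> L2" and \<psi>: "C1_compact \<psi> \<psi>'"
  shows "((\<lambda>h. ((\<integral>x. f x * of_real (dual_propagator h \<psi> x) \<partial>lborel) - (\<integral>x. f x * of_real (\<psi> x) \<partial>lborel)) / of_real h)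
    \<longlongrightarrow> (\<integral>x. f x * of_real (dual_generator \<psi> \<psi>' x) \<partial>lborel)) (at 0)"
proof (rule tendsto_if_norm_diff_le)
  fix h :: real
  define d where "d x = complex_of_real ((dual_propagator h \<psi> x - \<psi> x) / h - dual_generator \<psi> \<psi>' x)" for x
  have dq: "(\<lambda>x. of_real (1 / h) * (of_real (dual_propagator h \<psi> x) - of_real (\<psi> x))) \<in> L2"
    by (intro L2_scale L2_diff dual_propagator_L2[OF \<psi>] C1_compact_L2[OF \<psi>])
  have "d \<in> L2"
    using L2_diff[OF dq dual_generator_L2[OF \<psi>]] by (simp add: d_def[abs_def])
  have int: "integrable lborel (\<lambda>x. f x * of_real (dual_propagator h \<psi> x))"
    "integrable lborel (\<lambda>x. f x * of_real (\<psi> x))"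
    "integrable lborel (\<lambda>x. f x * of_real (dual_generator \<psi> \<psi>' x))"
    by (intro integrable_mult_L2 f dual_propagator_L2[OF \<psi>] C1_compact_L2[OF \<psi>] dual_generator_L2[OF \<psi>])+
  have "((\<integral>x. f x * of_real (dual_propagator h \<psi> x) \<partial>lborel) - (\<integral>x. f x * of_real (\<psi> x) \<partial>lborel)) / of_real h
      - (\<integral>x. f x * of_real (dual_generator \<psi> \<psi>' x) \<partial>lborel) =
      (\<integral>x. (f x * of_real (dual_propagator h \<psi> x) - f x * of_real (\<psi> x)) / of_real h
        - f x * of_real (dual_generator \<psi> \<psi>' x) \<partial>lborel)"
    using int by simp
  also have "\<dots> = (\<integral>x. f x * d x \<partial>lborel)"
    by (intro Bochner_Integration.integral_cong) (simp_all add: d_def right_diff_distrib)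
  finally show "cmod (((\<integral>x. f x * of_real (dual_propagator h \<psi> x) \<partial>lborel) - (\<integral>x. f x * of_real (\<psi> x) \<partial>lborel)) / of_real h
      - (\<integral>x. f x * of_real (dual_generator \<psi> \<psi>' x) \<partial>lborel)) \<le>
      L2_norm f * L2_norm (\<lambda>x. complex_of_real ((dual_propagator h \<psi> x - \<psi> x) / h - dual_generator \<psi> \<psi>' x))"
    using L2_Cauchy_Schwarz[OF f \<open>d \<in> L2\<close>] by (simp only: d_def[abs_def])
next
  show "((\<lambda>h. L2_norm f * L2_norm (\<lambda>x. complex_of_real ((dual_propagator h \<psi> x - \<psi> x) / h - dual_generator \<psi> \<psi>' x))) \<longlongrightarrow> 0) (at 0)"
    by (rule tendsto_mult_right_zero[OF dual_propagator_has_L2_derivative[OF \<psi>]])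
qed

definition generates :: "(real \<Rightarrow> complex) \<Rightarrow> (real \<Rightarrow> complex) \<Rightarrow> bool" where
  "generates f z \<longleftrightarrow> f \<in> L2 \<and> z \<in> L2 \<and>
     ((\<lambda>h. L2_norm (\<lambda>x. (propagator h f x - f x) / of_real h - z x)) \<longlongrightarrow> 0) (at 0)"

lemma L2_divide: "f \<in> L2 \<Longrightarrow> (\<lambda>x. f x / c) \<in> L2"
  using L2_scale[of f "1 / c"] by simp

text \<open>Duality makes the difference quotient of the pairing with S(h) f equal to that of f with
  the dual group. One form converges because f generates z, the other because \<open>\<psi>\<close>
  is C^1; the limits must agree.\<close>

lemma generates_weak:
  assumes gen: "generates f z" and \<psi>: "C1_compact \<psi> \<psi>'"
  shows "(\<integral>x. z x * of_real (\<psi> x) \<partial>lborel) = (\<integral>x. f x * of_real (dual_generator \<psi> \<psi>' x) \<partial>lborel)"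
proof -
  have f: "f \<in> L2" and z: "z \<in> L2"
    and lim: "((\<lambda>h. L2_norm (\<lambda>x. (propagator h f x - f x) / of_real h - z x)) \<longlongrightarrow> 0) (at 0)"
    using gen by (auto simp: generates_def)
  note \<psi>2 = C1_compact_L2[OF \<psi>]
  have "((\<lambda>h. ((\<integral>x. f x * of_real (dual_propagator h \<psi> x) \<partial>lborel) - (\<integral>x. f x * of_real (\<psi> x) \<partial>lborel)) / of_real h)
    \<longlongrightarrow> (\<integral>x. z x * of_real (\<psi> x) \<partial>lborel)) (at 0)"
  proof (rule tendsto_if_norm_diff_le)
    fix h :: real
    have d: "(\<lambda>x. (propagator h f x - f x) / of_real h - z x) \<in> L2"
      by (intro L2_diff L2_divide propagator_L2 f z)
    have int: "integrable lborel (\<lambda>x. propagator h f x * of_real (\<psi> x))"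
      "integrable lborel (\<lambda>x. f x * of_real (\<psi> x))" "integrable lborel (\<lambda>x. z x * of_real (\<psi> x))"
      by (intro integrable_mult_L2 f z propagator_L2 \<psi>2)+
    have "((\<integral>x. f x * of_real (dual_propagator h \<psi> x) \<partial>lborel) - (\<integral>x. f x * of_real (\<psi> x) \<partial>lborel)) / of_real h
        - (\<integral>x. z x * of_real (\<psi> x) \<partial>lborel) =
        (\<integral>x. (propagator h f x * of_real (\<psi> x) - f x * of_real (\<psi> x)) / of_real h - z x * of_real (\<psi> x) \<partial>lborel)"
      using int propagator_dual[OF L2_measurable[OF f] C1_compact_measurable(1)[OF \<psi>], of h] by simp
    also have "\<dots> = (\<integral>x. ((propagator h f x - f x) / of_real h - z x) * of_real (\<psi> x) \<partial>lborel)"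
      by (intro Bochner_Integration.integral_cong) (simp_all add: left_diff_distrib diff_divide_distrib)
    finally show "cmod (((\<integral>x. f x * of_real (dual_propagator h \<psi> x) \<partial>lborel) - (\<integral>x. f x * of_real (\<psi> x) \<partial>lborel)) / of_real h
        - (\<integral>x. z x * of_real (\<psi> x) \<partial>lborel)) \<le>
        L2_norm (\<lambda>x. (propagator h f x - f x) / of_real h - z x) * L2_norm (\<lambda>x. of_real (\<psi> x))"
      using L2_Cauchy_Schwarz[OF d \<psi>2] by simp
  next
    show "((\<lambda>h. L2_norm (\<lambda>x. (propagator h f x - f x) / of_real h - z x) * L2_norm (\<lambda>x. of_real (\<psi> x))) \<longlongrightarrow> 0) (at 0)"
      by (rule tendsto_mult_left_zero[OF lim])
  qed
  then show ?thesis
    by (rule tendsto_unique[OF trivial_limit_at _ pairing_dual_propagator_derivative[OF f \<psi>]])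
qed

text \<open>The case C = 0 of the dual norm bound, applied to f - g.\<close>

lemma L2_weak_unique:
  assumes "f \<in> L2" "g \<in> L2"
    and eq: "\<And>\<psi>. \<psi> \<in> test_functions \<Longrightarrow>
      (\<integral>x. f x * of_real (\<psi> x) \<partial>lborel) = (\<integral>x. g x * of_real (\<psi> x) \<partial>lborel)"
  shows "AE x in lborel. f x = g x"
proof -
  have d: "(\<lambda>x. f x - g x) \<in> L2" by (rule L2_diff[OF assms(1,2)])
  have "cmod (\<integral>x. (f x - g x) * of_real (\<psi> x) \<partial>lborel) \<le> 0 * L2_norm (\<lambda>x. of_real (\<psi> x))"
    if "\<psi> \<in> test_functions_off_0" for \<psi>
    using integrable_mult_L2[OF assms(1) test_function_L2] integrable_mult_L2[OF assms(2) test_function_L2]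
      eq test_functions_off_0_D[OF that] by (simp add: left_diff_distrib)
  from L2_norm_le_dual[OF d _ this] have "L2_norm (\<lambda>x. f x - g x) = 0"
    using L2_norm_nonneg[of "\<lambda>x. f x - g x"] by simp
  from L2_norm_eq_0_AE[OF d this] show ?thesis by simp
qed

section \<open>Weak form of the operator on its distributional domain\<close>

lemma DERIV_coefficient_mult:
  assumes "(\<psi> has_real_derivative d) (at x)" "x \<noteq> 0"
  shows "deriv (\<lambda>\<eta>. (1 - (phi \<eta>)\<^sup>2) * \<psi> \<eta>) x = (1 - (phi x)\<^sup>2) * d + 2 * side x * (phi x)\<^sup>2 * \<psi> x"
proof -
  have "((\<lambda>\<eta>. 1 - (phi \<eta>)\<^sup>2) has_real_derivative 0 - (- 2 * side x * (phi x)\<^sup>2)) (at x)"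
    by (rule DERIV_diff[OF DERIV_const DERIV_phi_power2[OF assms(2)]])
  from DERIV_imp_deriv[OF DERIV_mult[OF this assms(1)]] show ?thesis by (simp add: algebra_simps)
qed

lemma mult_distr_deriv_eq:
  assumes v: "v \<in> L2" and \<psi>: "C1_compact \<psi> \<psi>'"
  shows "mult_distr_deriv (\<lambda>\<xi>. 1 - (phi \<xi>)\<^sup>2) v \<psi> =
    - (\<integral>x. v x * of_real ((1 - (phi x)\<^sup>2) * \<psi>' x + 2 * side x * (phi x)\<^sup>2 * \<psi> x) \<partial>lborel)"
proof -
  note [measurable] = L2_measurable[OF v] C1_compact_measurable[OF \<psi>]
  define D where "D = deriv (\<lambda>\<eta>. (1 - (phi \<eta>)\<^sup>2) * \<psi> \<eta>)"
  \<comment> \<open>At 0 the product may fail to be differentiable, so \<open>deriv\<close> may be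
    an arbitrary value there. It is kept as the constant D 0; measurability and the integral are
    unaffected.\<close>
  have D_eq: "D = (\<lambda>x. if x = 0 then D 0 else (1 - (phi x)\<^sup>2) * \<psi>' x + 2 * side x * (phi x)\<^sup>2 * \<psi> x)"
  proof
    fix x
    show "D x = (if x = 0 then D 0 else (1 - (phi x)\<^sup>2) * \<psi>' x + 2 * side x * (phi x)\<^sup>2 * \<psi> x)"
      using DERIV_coefficient_mult[OF C1_compact_DERIV[OF \<psi>, of x]] by (simp add: D_def)
  qed
  have [measurable]: "D \<in> borel_measurable borel"
    by (subst D_eq) (unfold phi_def side_def, measurable)
  have "(\<integral>x. v x * of_real (D x) \<partial>lborel) =
      (\<integral>x. v x * of_real ((1 - (phi x)\<^sup>2) * \<psi>' x + 2 * side x * (phi x)\<^sup>2 * \<psi> x) \<partial>lborel)"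
  proof (rule integral_cong_AE)
    show "(\<lambda>x. v x * complex_of_real ((1 - (phi x)\<^sup>2) * \<psi>' x + 2 * side x * (phi x)\<^sup>2 * \<psi> x)) \<in> borel_measurable lborel"
      unfolding phi_def side_def by measurable
    show "AE x in lborel. v x * of_real (D x) =
        v x * of_real ((1 - (phi x)\<^sup>2) * \<psi>' x + 2 * side x * (phi x)\<^sup>2 * \<psi> x)"
      using AE_lborel_singleton[of 0] by eventually_elim (subst D_eq, simp)
  qed measurable
  then show ?thesis by (simp add: mult_distr_deriv_def D_def)
qed

lemma transport_L2:
  assumes "C1_compact \<psi> \<psi>'"
  shows "(\<lambda>x. of_real ((1 - (phi x)\<^sup>2) * \<psi>' x + 2 * side x * (phi x)\<^sup>2 * \<psi> x)) \<in> L2"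
proof -
  note [measurable] = C1_compact_measurable[OF assms]
  \<comment> \<open>Subtracting \<open>dual_generator\<close> from this zero-order term leaves
    exactly the function in question.\<close>
  have "(\<lambda>x. of_real (- side x * (phi x)\<^sup>2 * \<psi> x)) \<in> L2"
  proof (rule L2_dominated(1)[OF C1_compact_L2[OF assms], of _ 1])
    show "(\<lambda>x. complex_of_real (- side x * (phi x)\<^sup>2 * \<psi> x)) \<in> borel_measurable borel"
      unfolding phi_def side_def by measurable
    show "AE x in lborel. cmod (of_real (- side x * (phi x)\<^sup>2 * \<psi> x)) \<le> 1 * cmod (of_real (\<psi> x))"
    proof (rule AE_I2)
      fix x
      have "(phi x)\<^sup>2 * \<bar>\<psi> x\<bar> \<le> 1 * \<bar>\<psi> x\<bar>" using phi_power2_bounds[of x] by (intro mult_right_mono) auto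
      then show "cmod (of_real (- side x * (phi x)\<^sup>2 * \<psi> x)) \<le> 1 * cmod (of_real (\<psi> x))"
        by (simp only: norm_of_real) (simp add: abs_mult side_def)
    qed
  qed simp
  from L2_diff[OF this dual_generator_L2[OF assms]] show ?thesis
    by (simp add: dual_generator_def algebra_simps)
qed

text \<open>Both sides depend continuously on \<open>\<psi>\<close> and \<open>\<psi>'\<close> under
  uniform convergence with supports in a fixed interval, so the identity passes from test functions
  to C^1 functions.\<close>

lemma represents_distr_C1_compact:
  assumes v: "v \<in> L2" and w: "w \<in> L2"
    and rep: "represents_distr w (mult_distr_deriv (\<lambda>\<xi>. 1 - (phi \<xi>)\<^sup>2) v)"
    and \<psi>: "C1_compact \<psi> \<psi>'"
  shows "(\<integral>x. w x * of_real (\<psi> x) \<partial>lborel) =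
    - (\<integral>x. v x * of_real ((1 - (phi x)\<^sup>2) * \<psi>' x + 2 * side x * (phi x)\<^sup>2 * \<psi> x) \<partial>lborel)"
proof -
  define T where "T \<psi> \<psi>' x = (1 - (phi x)\<^sup>2) * \<psi>' x + 2 * side x * (phi x)\<^sup>2 * \<psi> x" for \<psi> \<psi>' x
  obtain S where S: "S > 0" "\<forall>e>0. \<exists>\<theta>\<in>test_functions. \<forall>x. \<bar>\<psi> x - \<theta> x\<bar> \<le> e \<and> \<bar>\<psi>' x - deriv \<theta> x\<bar> \<le> e \<and>
    (\<bar>x\<bar> > S \<longrightarrow> \<psi> x = 0 \<and> \<psi>' x = 0 \<and> \<theta> x = 0 \<and> deriv \<theta> x = 0)"
    by (rule C1_compact_approx_test_function[OF \<psi>])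
  define I where "I = L2_norm (\<lambda>x. of_real (indicator {-S..S} x))"
  \<comment> \<open>A uniform error e in \<open>\<psi>\<close> and \<open>\<psi>'\<close> changes T
    by at most e + 2 e, whence the 3.\<close>
  define K where "K = (L2_norm w + 3 * L2_norm v) * I"
  have "K \<ge> 0" by (simp add: K_def I_def)
  define A B where "A = (\<integral>x. w x * of_real (\<psi> x) \<partial>lborel)" and "B = (\<integral>x. v x * of_real (T \<psi> \<psi>' x) \<partial>lborel)"
  have key: "cmod (A + B) \<le> e * K" if e: "e > 0" for e
  proof -
    obtain \<theta> where "\<theta> \<in> test_functions" "\<forall>x. \<bar>\<psi> x - \<theta> x\<bar> \<le> e \<and> \<bar>\<psi>' x - deriv \<theta> x\<bar> \<le> e \<and>
      (\<bar>x\<bar> > S \<longrightarrow> \<psi> x = 0 \<and> \<psi>' x = 0 \<and> \<theta> x = 0 \<and> deriv \<theta> x = 0)"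
      using S(2) e by blast
    then have \<theta>: "\<theta> \<in> test_functions" "\<And>x. \<bar>\<psi> x - \<theta> x\<bar> \<le> e" "\<And>x. \<bar>\<psi>' x - deriv \<theta> x\<bar> \<le> e"
      "\<And>x. \<bar>x\<bar> > S \<Longrightarrow> \<psi> x = 0 \<and> \<psi>' x = 0 \<and> \<theta> x = 0 \<and> deriv \<theta> x = 0"
      by blast+
    note \<theta>C = test_function_C1_compact[OF \<theta>(1)]
    have rep\<theta>: "(\<integral>x. w x * of_real (\<theta> x) \<partial>lborel) = - (\<integral>x. v x * of_real (T \<theta> (deriv \<theta>) x) \<partial>lborel)"
      using rep \<theta>(1) mult_distr_deriv_eq[OF v \<theta>C] by (simp add: represents_distr_def T_def)
    note L2s = C1_compact_L2[OF \<psi>] C1_compact_L2[OF \<theta>C]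
      transport_L2[OF \<psi>, folded T_def] transport_L2[OF \<theta>C, folded T_def]
    define d1 d2 where "d1 x = complex_of_real (\<psi> x) - of_real (\<theta> x)"
      and "d2 x = complex_of_real (T \<psi> \<psi>' x) - of_real (T \<theta> (deriv \<theta>) x)" for x
    have d: "d1 \<in> L2" "d2 \<in> L2"
      unfolding d1_def[abs_def] d2_def[abs_def] by (intro L2_diff L2s)+
    have "L2_norm d1 \<le> e * I"
      unfolding I_def
    proof (rule bounded_support_L2(2))
      show "d1 \<in> borel_measurable borel" by (rule L2_measurable[OF d(1)])
      show "cmod (d1 x) \<le> e" for x
        using \<theta>(2)[of x] unfolding d1_def of_real_diff[symmetric] norm_of_real .
      show "d1 x = 0" if "\<bar>x\<bar> > S" for x using \<theta>(4)[OF that] by (simp add: d1_def)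
    qed
    have "L2_norm d2 \<le> (3 * e) * I"
      unfolding I_def
    proof (rule bounded_support_L2(2))
      show "d2 \<in> borel_measurable borel" by (rule L2_measurable[OF d(2)])
      show "d2 x = 0" if "\<bar>x\<bar> > S" for x using \<theta>(4)[OF that] by (simp add: d2_def T_def)
      show "cmod (d2 x) \<le> 3 * e" for x
      proof -
        have "T \<psi> \<psi>' x - T \<theta> (deriv \<theta>) x =
            (1 - (phi x)\<^sup>2) * (\<psi>' x - deriv \<theta> x) + (2 * side x * (phi x)\<^sup>2) * (\<psi> x - \<theta> x)"
          by (simp add: T_def algebra_simps)
        then have "\<bar>T \<psi> \<psi>' x - T \<theta> (deriv \<theta>) x\<bar> \<le>
            \<bar>1 - (phi x)\<^sup>2\<bar> * \<bar>\<psi>' x - deriv \<theta> x\<bar> + \<bar>2 * side x * (phi x)\<^sup>2\<bar> * \<bar>\<psi> x - \<theta> x\<bar>"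
          by (metis abs_mult abs_triangle_ineq)
        also have "\<dots> \<le> 1 * e + 2 * e"
          using \<theta>(2)[of x] \<theta>(3)[of x] phi_power2_bounds[of x]
          by (intro add_mono mult_mono) (auto simp: side_def)
        finally have "\<bar>T \<psi> \<psi>' x - T \<theta> (deriv \<theta>) x\<bar> \<le> 3 * e" by simp
        then show ?thesis unfolding d2_def of_real_diff[symmetric] norm_of_real .
      qed
    qed
    have "A + B = (\<integral>x. w x * d1 x \<partial>lborel) + (\<integral>x. v x * d2 x \<partial>lborel)"
      using integrable_mult_L2[OF w L2s(1)] integrable_mult_L2[OF w L2s(2)]
        integrable_mult_L2[OF v L2s(3)] integrable_mult_L2[OF v L2s(4)] rep\<theta>
      by (simp add: A_def B_def d1_def d2_def right_diff_distrib)
    then have "cmod (A + B) \<le> cmod (\<integral>x. w x * d1 x \<partial>lborel) + cmod (\<integral>x. v x * d2 x \<partial>lborel)"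
      by (metis norm_triangle_ineq)
    also have "\<dots> \<le> L2_norm w * L2_norm d1 + L2_norm v * L2_norm d2"
      by (intro add_mono L2_Cauchy_Schwarz v w d)
    also have "\<dots> \<le> L2_norm w * (e * I) + L2_norm v * ((3 * e) * I)"
      using \<open>L2_norm d1 \<le> e * I\<close> \<open>L2_norm d2 \<le> (3 * e) * I\<close> by (intro add_mono mult_left_mono) auto
    also have "\<dots> = e * K" by (simp add: K_def algebra_simps)
    finally show ?thesis .
  qed
  have "cmod (A + B) \<le> 0"
  proof (rule field_le_epsilon)
    fix e :: real assume "e > 0"
    have "cmod (A + B) \<le> (e / (K + 1)) * K" using \<open>K \<ge> 0\<close> \<open>e > 0\<close> by (intro key) simp
    also have "\<dots> \<le> e" using \<open>K \<ge> 0\<close> \<open>e > 0\<close> by (simp add: field_simps)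
    finally show "cmod (A + B) \<le> 0 + e" by simp
  qed
  then have "A + B = 0" by simp
  then show ?thesis by (simp add: A_def B_def T_def add_eq_0_iff2)
qed

lemma transport_term_Dom_L:
  assumes "f \<in> Dom_L"
  shows "transport_term f \<in> L2"
    "represents_distr (transport_term f) (mult_distr_deriv (\<lambda>\<xi>. 1 - (phi \<xi>)\<^sup>2) f)"
  using someI_ex[of "\<lambda>w. w \<in> L2 \<and> represents_distr w (mult_distr_deriv (\<lambda>\<xi>. 1 - (phi \<xi>)\<^sup>2) f)"] assms
  by (auto simp: Dom_L_def transport_term_def)

text \<open>At 0 the two sides are 0 and 1, as \<open>phi'\<close> uses \<open>sgn\<close> while
  \<open>side\<close> is -1 there; the integrals below see this only on a null set.\<close>

lemma phi_mult_phi': "x \<noteq> 0 \<Longrightarrow> phi x * phi' x = - side x * (phi x)\<^sup>2"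
  by (auto simp: phi_def phi'_def side_def power2_eq_square sgn_if)

lemma Dom_L_L2: "f \<in> Dom_L \<Longrightarrow> f \<in> L2"
  by (simp add: Dom_L_def)

lemma zero_order_term:
  assumes f: "f \<in> L2"
  shows "(\<lambda>x. of_real (phi x * phi' x) * f x) \<in> L2"
    and "C1_compact \<psi> \<psi>' \<Longrightarrow> (\<integral>x. of_real (phi x * phi' x) * f x * of_real (\<psi> x) \<partial>lborel) =
      (\<integral>x. f x * of_real (- side x * (phi x)\<^sup>2 * \<psi> x) \<partial>lborel)"
proof -
  note [measurable] = L2_measurable[OF f]
  have [measurable]: "phi' \<in> borel_measurable borel" "phi \<in> borel_measurable borel" "side \<in> borel_measurable borel"
    unfolding phi_def[abs_def] phi'_def[abs_def] side_def[abs_def] sgn_if by measurable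
  have "\<bar>phi x * phi' x\<bar> \<le> 1" for x
    using phi_mult_phi'[of x] phi_power2_bounds[of x]
    by (cases "x = 0") (auto simp: abs_mult side_def phi'_def)
  then show "(\<lambda>x. of_real (phi x * phi' x) * f x) \<in> L2"
    by (intro L2_dominated(1)[OF f, of _ 1])
      (auto simp: norm_mult simp del: of_real_mult intro!: AE_I2 mult_left_le_one_le)
  assume \<psi>: "C1_compact \<psi> \<psi>'"
  note [measurable] = C1_compact_measurable[OF \<psi>]
  show "(\<integral>x. of_real (phi x * phi' x) * f x * of_real (\<psi> x) \<partial>lborel) =
      (\<integral>x. f x * of_real (- side x * (phi x)\<^sup>2 * \<psi> x) \<partial>lborel)"
  proof (rule integral_cong_AE)
    show "AE x in lborel. of_real (phi x * phi' x) * f x * of_real (\<psi> x) =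
        f x * of_real (- side x * (phi x)\<^sup>2 * \<psi> x)"
      using AE_lborel_singleton[of 0]
      by eventually_elim (simp add: phi_mult_phi' del: of_real_mult mult_minus_left, simp)
  qed measurable
qed

lemma L_op_L2: "f \<in> Dom_L \<Longrightarrow> L_op f \<in> L2"
  unfolding L_op_def[abs_def] by (intro L2_add zero_order_term(1) transport_term_Dom_L(1) Dom_L_L2)

text \<open>The right-hand side vanishes when w represents (1 - phi^2) f', the left-hand side when w
  plus the zero-order term is L f in weak form. The identity thus converts each condition into the
  other; both directions are used.\<close>

lemma weak_form_split:
  assumes f: "f \<in> L2" and w: "w \<in> L2" and \<psi>: "C1_compact \<psi> \<psi>'"
  shows "(\<integral>x. (w x + of_real (phi x * phi' x) * f x) * of_real (\<psi> x) \<partial>lborel) -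
      (\<integral>x. f x * of_real (dual_generator \<psi> \<psi>' x) \<partial>lborel) =
    (\<integral>x. w x * of_real (\<psi> x) \<partial>lborel) +
      (\<integral>x. f x * of_real ((1 - (phi x)\<^sup>2) * \<psi>' x + 2 * side x * (phi x)\<^sup>2 * \<psi> x) \<partial>lborel)"
proof -
  note \<psi>2 = C1_compact_L2[OF \<psi>]
  have 1: "(\<integral>x. (w x + of_real (phi x * phi' x) * f x) * of_real (\<psi> x) \<partial>lborel) =
      (\<integral>x. w x * of_real (\<psi> x) \<partial>lborel) + (\<integral>x. of_real (phi x * phi' x) * f x * of_real (\<psi> x) \<partial>lborel)"
    using integrable_mult_L2[OF w \<psi>2] integrable_mult_L2[OF zero_order_term(1)[OF f] \<psi>2]
    by (simp add: distrib_right del: of_real_mult)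
  have "(\<lambda>x. f x * of_real (dual_generator \<psi> \<psi>' x)) =
      (\<lambda>x. f x * of_real (- side x * (phi x)\<^sup>2 * \<psi> x) -
        f x * of_real ((1 - (phi x)\<^sup>2) * \<psi>' x + 2 * side x * (phi x)\<^sup>2 * \<psi> x))"
    by (auto simp: dual_generator_def algebra_simps)
  moreover have t: "integrable lborel (\<lambda>x. f x * of_real ((1 - (phi x)\<^sup>2) * \<psi>' x + 2 * side x * (phi x)\<^sup>2 * \<psi> x))"
    by (rule integrable_mult_L2[OF f transport_L2[OF \<psi>]])
  moreover have "(\<lambda>x. f x * of_real (- side x * (phi x)\<^sup>2 * \<psi> x)) =
      (\<lambda>x. f x * of_real (dual_generator \<psi> \<psi>' x) +
        f x * of_real ((1 - (phi x)\<^sup>2) * \<psi>' x + 2 * side x * (phi x)\<^sup>2 * \<psi> x))"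
    by (auto simp: dual_generator_def algebra_simps)
  then have "integrable lborel (\<lambda>x. f x * of_real (- side x * (phi x)\<^sup>2 * \<psi> x))"
    using integrable_mult_L2[OF f dual_generator_L2[OF \<psi>]] t by simp
  ultimately have 2: "(\<integral>x. f x * of_real (dual_generator \<psi> \<psi>' x) \<partial>lborel) =
      (\<integral>x. f x * of_real (- side x * (phi x)\<^sup>2 * \<psi> x) \<partial>lborel) -
      (\<integral>x. f x * of_real ((1 - (phi x)\<^sup>2) * \<psi>' x + 2 * side x * (phi x)\<^sup>2 * \<psi> x) \<partial>lborel)"
    by (simp only: Bochner_Integration.integral_diff)
  show ?thesis unfolding 1 2 zero_order_term(2)[OF f \<psi>] by simp
qed

lemma L_op_weak:
  assumes f: "f \<in> Dom_L" and \<psi>: "C1_compact \<psi> \<psi>'"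
  shows "(\<integral>x. L_op f x * of_real (\<psi> x) \<partial>lborel) = (\<integral>x. f x * of_real (dual_generator \<psi> \<psi>' x) \<partial>lborel)"
  using weak_form_split[OF Dom_L_L2[OF f] transport_term_Dom_L(1)[OF f] \<psi>]
    represents_distr_C1_compact[OF Dom_L_L2[OF f] transport_term_Dom_L[OF f] \<psi>]
  by (simp add: L_op_def)

text \<open>Removing the zero-order term from z leaves a function that represents (1 - phi^2) f'.
  Then z and \<open>L_op f\<close> have the same pairings with test functions; equality holds only
  almost everywhere because \<open>transport_term\<close> is a choice.\<close>

lemma generates_imp_Dom_L:
  assumes gen: "generates f z"
  shows "f \<in> Dom_L" "AE x in lborel. L_op f x = z x"
proof -
  have f: "f \<in> L2" and z: "z \<in> L2" using gen by (auto simp: generates_def)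
  define w where "w x = z x - of_real (phi x * phi' x) * f x" for x
  have w: "w \<in> L2" unfolding w_def[abs_def] by (intro L2_diff z zero_order_term(1) f)
  have "(\<integral>x. w x * of_real (\<psi> x) \<partial>lborel) = mult_distr_deriv (\<lambda>\<xi>. 1 - (phi \<xi>)\<^sup>2) f \<psi>"
    if "\<psi> \<in> test_functions" for \<psi>
  proof -
    note \<psi> = test_function_C1_compact[OF that]
    define W V where "W = (\<integral>x. w x * of_real (\<psi> x) \<partial>lborel)"
      and "V = (\<integral>x. f x * of_real ((1 - (phi x)\<^sup>2) * deriv \<psi> x + 2 * side x * (phi x)\<^sup>2 * \<psi> x) \<partial>lborel)"
    have "(\<integral>x. (w x + of_real (phi x * phi' x) * f x) * of_real (\<psi> x) \<partial>lborel) =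
        (\<integral>x. f x * of_real (dual_generator \<psi> (deriv \<psi>) x) \<partial>lborel)"
      unfolding generates_weak[OF gen \<psi>, symmetric] by (simp only: w_def diff_add_cancel)
    then have "W + V = 0"
      using weak_form_split[OF f w \<psi>, folded W_def V_def] by (metis diff_self)
    then show ?thesis
      unfolding mult_distr_deriv_eq[OF f \<psi>, folded V_def] W_def[symmetric] by (simp add: eq_neg_iff_add_eq_0)
  qed
  then show "f \<in> Dom_L" using f w by (auto simp: Dom_L_def represents_distr_def)
  then show "AE x in lborel. L_op f x = z x"
    using L_op_weak generates_weak[OF gen] test_function_C1_compact
    by (intro L2_weak_unique L_op_L2 z) metis+
qed

text \<open>
  For a test function \<open>\<psi>\<close> vanishing near 0 the dual group stays in \<open>C\<^sup>1\<close> functions with compact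
  support, against which \<open>L f\<close> may be tested.  Hence \<open>G(s) = \<integral> S(s) f \<psi>\<close> has derivative
  \<open>\<integral> S(s) L f \<psi>\<close>, and the mean value theorem bounds the error of the difference quotient of \<open>G\<close> by
  \<open>\<parallel>S(s) L f - L f\<parallel> \<parallel>\<psi>\<parallel>\<close>, uniformly in \<open>\<psi>\<close>.
\<close>

lemma Dom_L_imp_generates:
  assumes f: "f \<in> Dom_L"
  shows "generates f (L_op f)"
proof -
  define z where "z = L_op f"
  have f2: "f \<in> L2" and z: "z \<in> L2" using Dom_L_L2[OF f] L_op_L2[OF f] by (simp_all add: z_def)
  have bound: "L2_norm (\<lambda>x. (propagator h f x - f x) / of_real h - z x) \<le> 2 * C"
    if h: "h \<noteq> 0" and C: "\<And>s. \<bar>s\<bar> \<le> \<bar>h\<bar> \<Longrightarrow> L2_norm (\<lambda>x. propagator s z x - z x) \<le> C" for h C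
  proof (rule L2_norm_le_dual)
    show "C \<ge> 0" using order_trans[OF L2_norm_nonneg C[of 0]] by simp
    show "(\<lambda>x. (propagator h f x - f x) / of_real h - z x) \<in> L2"
      by (intro L2_diff L2_divide propagator_L2 f2 z)
    fix \<psi> assume \<psi>0: "\<psi> \<in> test_functions_off_0"
    then have \<psi>: "C1_off_0 \<psi> (deriv \<psi>)"
      by (auto simp: C1_off_0_def test_functions_off_0_def intro: test_function_C1_compact)
    then have \<psi>C: "C1_compact \<psi> (deriv \<psi>)" by (simp add: C1_off_0_def)
    note \<psi>2 = C1_compact_L2[OF \<psi>C]
    note [measurable] = L2_measurable[OF f2] L2_measurable[OF z] C1_compact_measurable(1)[OF \<psi>C]
    define G where "G s = (\<integral>x. propagator s f x * of_real (\<psi> x) \<partial>lborel)" for s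
    define g where "g s = (\<integral>x. propagator s z x * of_real (\<psi> x) \<partial>lborel)" for s
    have DG: "(G has_vector_derivative g s) (at s)" for s
    proof -
      obtain \<theta>' where "C1_off_0 (dual_propagator s \<psi>) \<theta>'" using dual_propagator_C1_off_0[OF \<psi>] by blast
      then have \<theta>: "C1_compact (dual_propagator s \<psi>) \<theta>'" by (simp add: C1_off_0_def)
      \<comment> \<open>The time s is moved onto the test function, so that differentiability of G
        at s becomes differentiability at 0 for the transported C^1 function.\<close>
      have G_eq: "G (s + h) = (\<integral>x. f x * of_real (dual_propagator h (dual_propagator s \<psi>) x) \<partial>lborel)" for h
        unfolding G_def by (subst propagator_dual) (simp_all add: dual_propagator_add[symmetric] add.commute)
      have g_eq: "g s = (\<integral>x. f x * of_real (dual_generator (dual_propagator s \<psi>) \<theta>' x) \<partial>lborel)"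
        unfolding g_def using L_op_weak[OF f \<theta>] by (subst propagator_dual) (simp_all add: z_def[symmetric])
      have "((\<lambda>h. (G (s + h) - G s) / of_real h) \<longlongrightarrow> g s) (at 0)"
        using pairing_dual_propagator_derivative[OF f2 \<theta>] G_eq[of 0]
        by (simp add: G_eq g_eq)
      then have "((\<lambda>h. norm ((G (s + h) - G s) / of_real h - g s)) \<longlongrightarrow> 0) (at 0)"
        by (intro tendsto_norm_zero LIM_zero)
      moreover have "\<forall>\<^sub>F h in at (0::real). norm ((G (s + h) - G s) / of_real h - g s) =
          norm (G (s + h) - G s - h *\<^sub>R g s) / norm h"
        unfolding eventually_at_filter
      proof (rule always_eventually, intro allI impI)
        fix h :: real assume "h \<noteq> 0"
        then have "(G (s + h) - G s) / of_real h - g s = (G (s + h) - G s - h *\<^sub>R g s) / of_real h"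
          by (simp add: diff_divide_distrib scaleR_conv_of_real)
        then show "norm ((G (s + h) - G s) / of_real h - g s) = norm (G (s + h) - G s - h *\<^sub>R g s) / norm h"
          by (simp only: norm_divide norm_of_real real_norm_def)
      qed
      ultimately have "((\<lambda>h. norm (G (s + h) - G s - h *\<^sub>R g s) / norm h) \<longlongrightarrow> 0) (at 0)"
        by (rule Lim_transform_eventually)
      then show ?thesis
        by (simp add: has_vector_derivative_def has_derivative_at bounded_linear_scaleR_left)
    qed
    \<comment> \<open>Subtracting the linear function leaves the derivative g s - g 0, which
      Cauchy-Schwarz bounds by C times the norm of \<open>\<psi>\<close>.\<close>
    have "norm ((G h - h *\<^sub>R g 0) - (G 0 - 0 *\<^sub>R g 0)) \<le> (C * L2_norm (\<lambda>x. of_real (\<psi> x))) * norm (h - 0)"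
    proof (rule differentiable_bound[of "{- \<bar>h\<bar>..\<bar>h\<bar>}" "\<lambda>s. G s - s *\<^sub>R g 0" "\<lambda>s y. y *\<^sub>R (g s - g 0)"])
      fix s assume s: "s \<in> {- \<bar>h\<bar>..\<bar>h\<bar>}"
      have "((\<lambda>s. G s - s *\<^sub>R g 0) has_vector_derivative g s - 1 *\<^sub>R g 0) (at s within {- \<bar>h\<bar>..\<bar>h\<bar>})"
        by (intro has_vector_derivative_diff has_vector_derivative_at_within[OF DG])
          (auto intro!: derivative_eq_intros)
      then show "((\<lambda>s. G s - s *\<^sub>R g 0) has_derivative (\<lambda>y. y *\<^sub>R (g s - g 0))) (at s within {- \<bar>h\<bar>..\<bar>h\<bar>})"
        by (simp add: has_vector_derivative_def)
      have d: "(\<lambda>x. propagator s z x - z x) \<in> L2" by (intro L2_diff propagator_L2 z)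
      have "g s - g 0 = (\<integral>x. (propagator s z x - z x) * of_real (\<psi> x) \<partial>lborel)"
        using integrable_mult_L2[OF propagator_L2[OF z] \<psi>2, of s] integrable_mult_L2[OF z \<psi>2]
        by (simp add: g_def left_diff_distrib)
      also have "cmod \<dots> \<le> L2_norm (\<lambda>x. propagator s z x - z x) * L2_norm (\<lambda>x. of_real (\<psi> x))"
        by (rule L2_Cauchy_Schwarz[OF d \<psi>2])
      also have "\<dots> \<le> C * L2_norm (\<lambda>x. of_real (\<psi> x))"
        using s by (intro mult_right_mono C) auto
      finally have le: "norm (g s - g 0) \<le> C * L2_norm (\<lambda>x. of_real (\<psi> x))" .
      show "onorm (\<lambda>y. y *\<^sub>R (g s - g 0)) \<le> C * L2_norm (\<lambda>x. of_real (\<psi> x))"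
      proof (rule onorm_bound)
        show "0 \<le> C * L2_norm (\<lambda>x. of_real (\<psi> x))" using \<open>C \<ge> 0\<close> by simp
        show "norm (y *\<^sub>R (g s - g 0)) \<le> C * L2_norm (\<lambda>x. of_real (\<psi> x)) * norm y" for y :: real
          using mult_right_mono[OF le abs_ge_zero[of y]] by (simp add: mult.commute)
      qed
    qed auto
    then have *: "norm (G h - G 0 - h *\<^sub>R g 0) \<le> C * L2_norm (\<lambda>x. of_real (\<psi> x)) * \<bar>h\<bar>"
      by (simp add: algebra_simps)
    have "(\<integral>x. ((propagator h f x - f x) / of_real h - z x) * of_real (\<psi> x) \<partial>lborel) =
        (\<integral>x. (propagator h f x * of_real (\<psi> x) - f x * of_real (\<psi> x)) / of_real h - z x * of_real (\<psi> x) \<partial>lborel)"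
      by (intro Bochner_Integration.integral_cong) (simp_all add: left_diff_distrib diff_divide_distrib)
    also have "\<dots> = (G h - G 0) / of_real h - g 0"
      using integrable_mult_L2[OF propagator_L2[OF f2] \<psi>2, of h] integrable_mult_L2[OF f2 \<psi>2]
        integrable_mult_L2[OF z \<psi>2] by (simp add: G_def g_def)
    also have "\<dots> = (G h - G 0 - h *\<^sub>R g 0) / of_real h"
      using h by (simp add: diff_divide_distrib scaleR_conv_of_real)
    also have "cmod \<dots> = norm (G h - G 0 - h *\<^sub>R g 0) / \<bar>h\<bar>" by (simp add: norm_divide)
    also have "\<dots> \<le> C * L2_norm (\<lambda>x. of_real (\<psi> x))" using * h by (simp add: divide_le_eq)
    finally show "cmod (\<integral>x. ((propagator h f x - f x) / of_real h - z x) * of_real (\<psi> x) \<partial>lborel) \<le>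
        C * L2_norm (\<lambda>x. of_real (\<psi> x))" .
  qed
  have "((\<lambda>h. L2_norm (\<lambda>x. (propagator h f x - f x) / of_real h - z x)) \<longlongrightarrow> 0) (at 0)"
  proof (rule tendstoI)
    fix e :: real assume "e > 0"
    then have "\<forall>\<^sub>F s in at 0. L2_norm (\<lambda>x. propagator s z x - z x) < e / 3"
      using order_tendstoD(2)[OF propagator_tendsto_0[OF z], of "e / 3"] by simp
    then obtain d where d: "d > 0" "\<And>s. s \<noteq> 0 \<Longrightarrow> \<bar>s\<bar> < d \<Longrightarrow> L2_norm (\<lambda>x. propagator s z x - z x) < e / 3"
      by (auto simp: eventually_at dist_real_def)
    have small: "L2_norm (\<lambda>x. propagator s z x - z x) \<le> e / 3" if "\<bar>s\<bar> < d" for s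
      using d(2)[OF _ that] \<open>e > 0\<close> by (cases "s = 0") (auto simp: L2_norm_eq)
    have "dist (L2_norm (\<lambda>x. (propagator h f x - f x) / of_real h - z x)) 0 < e"
      if "h \<noteq> 0" "\<bar>h\<bar> < d" for h
    proof -
      have "L2_norm (\<lambda>x. (propagator h f x - f x) / of_real h - z x) \<le> 2 * (e / 3)"
        using that by (intro bound small) auto
      also have "\<dots> < e" using \<open>e > 0\<close> by simp
      finally show ?thesis by simp
    qed
    then show "\<forall>\<^sub>F h in at 0. dist (L2_norm (\<lambda>x. (propagator h f x - f x) / of_real h - z x)) 0 < e"
      unfolding eventually_at using d(1) by (auto simp: dist_real_def)
  qed
  then show ?thesis using f2 z by (simp add: generates_def z_def)
qed

section \<open>Global solutions\<close>

lemma generates_diff: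
  assumes "generates f y" "generates g z"
  shows "generates (\<lambda>x. f x - g x) (\<lambda>x. y x - z x)"
proof -
  have L2: "f \<in> L2" "y \<in> L2" "g \<in> L2" "z \<in> L2"
    and lim: "((\<lambda>h. L2_norm (\<lambda>x. (propagator h f x - f x) / of_real h - y x)) \<longlongrightarrow> 0) (at 0)"
      "((\<lambda>h. L2_norm (\<lambda>x. (propagator h g x - g x) / of_real h - z x)) \<longlongrightarrow> 0) (at 0)"
    using assms by (auto simp: generates_def)
  have "((\<lambda>h. L2_norm (\<lambda>x. (propagator h (\<lambda>x. f x - g x) x - (f x - g x)) / of_real h - (y x - z x))) \<longlongrightarrow> 0) (at 0)"
  proof (rule tendsto_sandwich[OF _ _ tendsto_const tendsto_add_zero[OF lim]])
    show "\<forall>\<^sub>F h in at 0. L2_norm (\<lambda>x. (propagator h (\<lambda>x. f x - g x) x - (f x - g x)) / of_real h - (y x - z x)) \<le>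
        L2_norm (\<lambda>x. (propagator h f x - f x) / of_real h - y x) +
        L2_norm (\<lambda>x. (propagator h g x - g x) / of_real h - z x)"
    proof (rule always_eventually, rule allI)
      fix h
      have d: "(\<lambda>x. (propagator h f x - f x) / of_real h - y x) \<in> L2"
        "(\<lambda>x. - 1 * ((propagator h g x - g x) / of_real h - z x)) \<in> L2"
        by (intro L2_scale L2_diff L2_divide propagator_L2 L2)+
      have "L2_norm (\<lambda>x. (propagator h (\<lambda>x. f x - g x) x - (f x - g x)) / of_real h - (y x - z x)) =
          L2_norm (\<lambda>x. ((propagator h f x - f x) / of_real h - y x) + - 1 * ((propagator h g x - g x) / of_real h - z x))"
        by (rule arg_cong[where f=L2_norm]) (simp add: propagator_diff fun_eq_iff diff_divide_distrib)
      also have "\<dots> \<le> L2_norm (\<lambda>x. (propagator h f x - f x) / of_real h - y x) +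
          L2_norm (\<lambda>x. - 1 * ((propagator h g x - g x) / of_real h - z x))"
        by (rule L2_norm_triangle[OF d])
      finally show "L2_norm (\<lambda>x. (propagator h (\<lambda>x. f x - g x) x - (f x - g x)) / of_real h - (y x - z x)) \<le>
          L2_norm (\<lambda>x. (propagator h f x - f x) / of_real h - y x) +
          L2_norm (\<lambda>x. (propagator h g x - g x) / of_real h - z x)"
        unfolding L2_norm_scale by simp
    qed
  qed simp
  then show ?thesis using L2 by (simp add: generates_def L2_diff)
qed

text \<open>Pulling S(t) out of the difference quotient carries differentiability at time 0 over to
  time t.\<close>

lemma propagator_increment_norm_le:
  assumes f: "f \<in> L2" and z: "z \<in> L2"
  shows "L2_norm (\<lambda>x. (propagator (t + h) f x - propagator t f x) / of_real h - propagator t z x) \<le>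
    exp (2 * \<bar>t\<bar>) * L2_norm (\<lambda>x. (propagator h f x - f x) / of_real h - z x)"
proof -
  have "propagator t (\<lambda>x. (propagator h f x - f x) / of_real h - z x) =
      (\<lambda>x. (propagator (t + h) f x - propagator t f x) / of_real h - propagator t z x)"
    by (simp add: propagator_diff propagator_divide propagator_propagator)
  then show ?thesis
    using propagator_norm_le[of "\<lambda>x. (propagator h f x - f x) / of_real h - z x" t]
    by (simp add: L2_diff L2_divide propagator_L2 f z)
qed

lemma generates_propagator:
  assumes "generates f z"
  shows "generates (propagator t f) (propagator t z)"
proof -
  have f: "f \<in> L2" and z: "z \<in> L2"
    and lim: "((\<lambda>h. L2_norm (\<lambda>x. (propagator h f x - f x) / of_real h - z x)) \<longlongrightarrow> 0) (at 0)"
    using assms by (auto simp: generates_def)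
  have "((\<lambda>h. L2_norm (\<lambda>x. (propagator h (propagator t f) x - propagator t f x) / of_real h - propagator t z x)) \<longlongrightarrow> 0) (at 0)"
    by (rule tendsto_sandwich[OF _ _ tendsto_const tendsto_mult_right_zero[OF lim, of "exp (2 * \<bar>t\<bar>)"]])
      (use propagator_increment_norm_le[OF f z, of t] in \<open>auto simp: propagator_propagator add.commute\<close>)
  then show ?thesis using f z by (simp add: generates_def propagator_L2)
qed

lemma propagator_L2_derivative:
  assumes "generates f z"
  shows "((\<lambda>s. L2_norm (\<lambda>x. (propagator s f x - propagator t f x) / of_real (s - t) - propagator t z x)) \<longlongrightarrow> 0) (at t)"
proof -
  have f: "f \<in> L2" and z: "z \<in> L2"
    and lim: "((\<lambda>h. L2_norm (\<lambda>x. (propagator h f x - f x) / of_real h - z x)) \<longlongrightarrow> 0) (at 0)"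
    using assms by (auto simp: generates_def)
  have "((\<lambda>h. L2_norm (\<lambda>x. (propagator (t + h) f x - propagator t f x) / of_real h - propagator t z x)) \<longlongrightarrow> 0) (at 0)"
    by (rule tendsto_sandwich[OF _ _ tendsto_const tendsto_mult_right_zero[OF lim, of "exp (2 * \<bar>t\<bar>)"]])
      (use propagator_increment_norm_le[OF f z, of t] in auto)
  from LIM_offset[OF this, of "- t"] show ?thesis by simp
qed

text \<open>Since \<open>L_op\<close> rests on a choice, it is linear only up to null sets. This
  linearity is obtained from the generator, which respects differences because it is a
  limit.\<close>

lemma L_op_propagator_diff:
  assumes f: "f \<in> Dom_L"
  shows "L2_norm (L_op (\<lambda>x. propagator s f x - propagator t f x)) =
    L2_norm (\<lambda>x. propagator s (L_op f) x - propagator t (L_op f) x)"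
proof -
  have "generates (\<lambda>x. propagator s f x - propagator t f x)
      (\<lambda>x. propagator s (L_op f) x - propagator t (L_op f) x)"
    by (intro generates_diff generates_propagator Dom_L_imp_generates f)
  note g = generates_imp_Dom_L[OF this]
  show ?thesis
    by (intro L2_norm_cong_AE g(2) L2_measurable[OF L_op_L2[OF g(1)]] L2_measurable L2_diff
        propagator_L2 L_op_L2 f)
qed

lemma tendsto_at_imp_within: "(f \<longlongrightarrow> l) (at x) \<Longrightarrow> (f \<longlongrightarrow> l) (at x within S)"
  by (rule tendsto_mono[OF at_le]) auto

lemma propagator_global_solution:
  assumes f: "f \<in> Dom_L"
  shows "global_solution f (\<lambda>t. propagator t f)"
proof -
  define z where "z = L_op f"
  have z: "z \<in> L2" and f2: "f \<in> L2" using L_op_L2[OF f] Dom_L_L2[OF f] by (simp_all add: z_def)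
  have gen: "generates f z" unfolding z_def by (rule Dom_L_imp_generates[OF f])
  have "continuous_into_Dom_L (\<lambda>t. propagator t f)"
    unfolding continuous_into_Dom_L_def
  proof (intro allI impI conjI)
    fix t :: real
    show "propagator t f \<in> Dom_L" by (rule generates_imp_Dom_L(1)[OF generates_propagator[OF gen]])
    have "((\<lambda>s. sqrt ((L2_norm (\<lambda>x. propagator s f x - propagator t f x))\<^sup>2 +
        (L2_norm (\<lambda>x. propagator s z x - propagator t z x))\<^sup>2)) \<longlongrightarrow> sqrt (0\<^sup>2 + 0\<^sup>2)) (at t within {0..})"
      by (intro tendsto_intros tendsto_at_imp_within[OF propagator_tendsto[OF f2]]
          tendsto_at_imp_within[OF propagator_tendsto[OF z]])
    then show "((\<lambda>s. graph_norm (\<lambda>\<xi>. propagator s f \<xi> - propagator t f \<xi>)) \<longlongrightarrow> 0) (at t within {0..})"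
      by (simp add: graph_norm_def L_op_propagator_diff[OF f] z_def)
  qed
  moreover have "has_L2_time_deriv (\<lambda>t. propagator t f) (\<lambda>t. propagator t z)"
    unfolding has_L2_time_deriv_def
    by (intro allI impI conjI propagator_L2 f2 z tendsto_at_imp_within[OF propagator_L2_derivative[OF gen]])
  moreover have "continuous_into_L2 (\<lambda>t. propagator t z)"
    unfolding continuous_into_L2_def
    by (intro allI impI conjI propagator_L2 z tendsto_at_imp_within[OF propagator_tendsto[OF z]])
  moreover have "AE \<xi> in lborel. propagator t z \<xi> = L_op (propagator t f) \<xi>" for t
    using generates_imp_Dom_L(2)[OF generates_propagator[OF gen, of t]] by eventually_elim simp
  ultimately show ?thesis unfolding global_solution_def by auto
qed

section \<open>Uniqueness of global solutions\<close>

lemma generates_cong_AE: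
  assumes gen: "generates f z" and d: "d \<in> L2" and eq: "AE x in lborel. d x = z x"
  shows "generates f d"
proof -
  have f: "f \<in> L2" and z: "z \<in> L2" using gen by (auto simp: generates_def)
  have "L2_norm (\<lambda>x. (propagator h f x - f x) / of_real h - z x) =
      L2_norm (\<lambda>x. (propagator h f x - f x) / of_real h - d x)" for h
    using eq by (intro L2_norm_cong_AE L2_measurable L2_diff L2_divide propagator_L2 f z d) auto
  then show ?thesis using gen d by (simp add: generates_def)
qed

text \<open>
  Uniqueness: transporting a solution back along the group gives a curve with zero derivative.
\<close>

lemma global_solution_unique:
  assumes sol: "global_solution f w" and f: "f \<in> Dom_L" and "t \<ge> 0"
  shows "AE x in lborel. w t x = propagator t f x"
proof -
  obtain dv where cont: "continuous_into_Dom_L w" and der: "has_L2_time_deriv w dv"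
    and eq: "\<And>t. t \<ge> 0 \<Longrightarrow> AE x in lborel. dv t x = L_op (w t) x"
    and init: "AE x in lborel. w 0 x = f x"
    using sol by (auto simp: global_solution_def)
  have w: "w s \<in> L2" and dv: "dv s \<in> L2" and wD: "w s \<in> Dom_L" if "s \<ge> 0" for s
    using der cont that by (auto simp: has_L2_time_deriv_def continuous_into_Dom_L_def)
  \<comment> \<open>A scalar substitute for the L2-valued curve: it vanishes at 0, and a zero
    derivative forces it to be constant.\<close>
  define n where "n s = L2_norm (\<lambda>x. propagator (- s) (w s) x - w 0 x)" for s
  have "(n has_field_derivative 0) (at t within {0..})" if "t \<in> {0..}" for t
  proof -
    have t: "t \<ge> 0" using that by simp
    define d where "d = dv t"
    have d: "d \<in> L2" using dv[OF t] by (simp add: d_def)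
    have "generates (w t) d"
      by (rule generates_cong_AE[OF Dom_L_imp_generates[OF wD[OF t]] d]) (use eq[OF t] in \<open>simp add: d_def\<close>)
    then have gen: "((\<lambda>h. L2_norm (\<lambda>x. (propagator h (w t) x - w t x) / of_real h - d x)) \<longlongrightarrow> 0) (at 0)"
      by (simp add: generates_def)
    define a where "a s = L2_norm (\<lambda>x. (w s x - w t x) / of_real (s - t) - d x)" for s
    define b where "b s = L2_norm (\<lambda>x. propagator (- (s - t)) d x - d x)" for s
    define c where "c s = L2_norm (\<lambda>x. (propagator (- (s - t)) (w t) x - w t x) / of_real (- (s - t)) - d x)" for s
    have neg: "filterlim (\<lambda>s. - (s - t)) (at 0) (at t within {0..})"
      by (auto simp: filterlim_at eventually_at_filter intro!: tendsto_eq_intros)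
    have lim_a: "(a \<longlongrightarrow> 0) (at t within {0..})"
      using der t unfolding a_def[abs_def] d_def by (simp add: has_L2_time_deriv_def)
    have lim_b: "(b \<longlongrightarrow> 0) (at t within {0..})"
      unfolding b_def[abs_def] by (rule filterlim_compose[OF propagator_tendsto_0[OF d] neg])
    have lim_c: "(c \<longlongrightarrow> 0) (at t within {0..})"
      unfolding c_def[abs_def] by (rule filterlim_compose[OF gen neg])
    have "((\<lambda>s. exp (2 * \<bar>t\<bar>) * (exp (2 * \<bar>s - t\<bar>) * a s + b s + c s)) \<longlongrightarrow>
        exp (2 * \<bar>t\<bar>) * (exp (2 * \<bar>t - t\<bar>) * 0 + 0 + 0)) (at t within {0..})"
      by (intro tendsto_intros lim_a lim_b lim_c)
    then have lim: "((\<lambda>s. exp (2 * \<bar>t\<bar>) * (exp (2 * \<bar>s - t\<bar>) * a s + b s + c s)) \<longlongrightarrow> 0) (at t within {0..})"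
      by simp
    have bound: "\<bar>(n s - n t) / (s - t)\<bar> \<le> exp (2 * \<bar>t\<bar>) * (exp (2 * \<bar>s - t\<bar>) * a s + b s + c s)"
      if s: "s \<in> {0..}" "s \<noteq> t" for s
    proof -
      define h where "h = s - t"
      have "h \<noteq> 0" using s by (simp add: h_def)
      have ws: "w s \<in> L2" and wt: "w t \<in> L2" and w0: "w 0 \<in> L2" using w s t by auto
      \<comment> \<open>The difference quotient of the curve transported back splits as S(-h) A + B
        + C: the error of the time derivative of w, the strong continuity error at d, and the
        generator error at time -h. In the sum the terms with d and S(-h) d cancel.\<close>
      define A where "A x = (w s x - w t x) / of_real h - d x" for x
      define B where "B x = propagator (- h) d x - d x" for x
      define C where "C x = - 1 * ((propagator (- h) (w t) x - w t x) / of_real (- h) - d x)" for x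
      have A: "A \<in> L2" and B: "B \<in> L2" and C: "C \<in> L2"
        unfolding A_def[abs_def] B_def[abs_def] C_def[abs_def]
        by (intro L2_scale L2_diff L2_divide propagator_L2 ws wt d)+
      have sum: "(\<lambda>x. propagator (- h) A x + (B x + C x)) = (\<lambda>x. (propagator (- h) (w s) x - w t x) / of_real h)"
        unfolding A_def B_def C_def propagator_diff propagator_divide
        using \<open>h \<noteq> 0\<close> by (auto simp: fun_eq_iff field_simps)
      have "L2_norm (\<lambda>x. (propagator (- h) (w s) x - w t x) / of_real h) \<le>
          L2_norm (propagator (- h) A) + (L2_norm B + L2_norm C)"
        unfolding sum[symmetric]
        using L2_norm_triangle[OF propagator_L2[OF A, of "- h"] L2_add[OF B C]] L2_norm_triangle[OF B C] by linarith
      also have "\<dots> \<le> exp (2 * \<bar>s - t\<bar>) * a s + b s + c s"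
        using propagator_norm_le[OF A, of "- h"]
        unfolding C_def[abs_def] L2_norm_scale
        by (simp add: a_def b_def c_def A_def[abs_def] B_def[abs_def] h_def abs_minus_commute)
      finally have le: "L2_norm (\<lambda>x. (propagator (- h) (w s) x - w t x) / of_real h) \<le>
          exp (2 * \<bar>s - t\<bar>) * a s + b s + c s" .
      define u where "u x = propagator (- h) (w s) x - w t x" for x
      have u: "u \<in> L2" unfolding u_def[abs_def] by (intro L2_diff propagator_L2 ws wt)
      have pu: "propagator (- t) u = (\<lambda>x. propagator (- s) (w s) x - propagator (- t) (w t) x)"
        unfolding u_def by (simp add: propagator_diff propagator_propagator h_def)
      have "\<bar>n s - n t\<bar> \<le> L2_norm (propagator (- t) u)"
        using L2_norm_triangle_diff[OF propagator_L2[OF ws] propagator_L2[OF wt] w0, of "- s" "- t"]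
          L2_norm_triangle_diff[OF propagator_L2[OF wt] propagator_L2[OF ws] w0, of "- t" "- s"]
          L2_norm_diff_commute[of "propagator (- s) (w s)" "propagator (- t) (w t)"]
        unfolding pu n_def by linarith
      also have "\<dots> \<le> exp (2 * \<bar>t\<bar>) * L2_norm u" using propagator_norm_le[OF u, of "- t"] by simp
      finally have "\<bar>(n s - n t) / h\<bar> \<le> exp (2 * \<bar>t\<bar>) * (L2_norm u / \<bar>h\<bar>)"
        using \<open>h \<noteq> 0\<close> by (simp add: abs_divide divide_right_mono)
      also have "L2_norm u / \<bar>h\<bar> = L2_norm (\<lambda>x. u x / of_real h)"
        using L2_norm_scale[of "1 / of_real h" u] by (simp add: norm_divide)
      also have "exp (2 * \<bar>t\<bar>) * L2_norm (\<lambda>x. u x / of_real h) \<le>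
          exp (2 * \<bar>t\<bar>) * (exp (2 * \<bar>s - t\<bar>) * a s + b s + c s)"
        using le by (intro mult_left_mono) (simp_all add: u_def)
      finally show ?thesis by (simp add: h_def)
    qed
    have "((\<lambda>s. (n s - n t) / (s - t)) \<longlongrightarrow> 0) (at t within {0..})"
      by (rule Lim_null_comparison[OF _ lim]) (use bound in \<open>auto simp: eventually_at_filter\<close>)
    then show ?thesis by (simp add: has_field_derivative_iff)
  qed
  then obtain k where k: "\<And>s. s \<ge> 0 \<Longrightarrow> n s = k"
    using has_field_derivative_zero_constant[of "{0..}" n] by auto
  have f2: "f \<in> L2" and wt: "w t \<in> L2" and w0: "w 0 \<in> L2" using Dom_L_L2[OF f] w \<open>t \<ge> 0\<close> by auto
  have "n 0 = 0" by (simp add: n_def L2_norm_eq)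
  then have "n t = 0" using k[of 0] k[OF \<open>t \<ge> 0\<close>] by simp
  moreover have "n t = L2_norm (\<lambda>x. propagator (- t) (w t) x - f x)"
    unfolding n_def using init by (intro L2_norm_cong_AE L2_measurable L2_diff propagator_L2 wt w0 f2) auto
  ultimately have 0: "L2_norm (\<lambda>x. propagator (- t) (w t) x - f x) = 0" by simp
  have "propagator t (\<lambda>x. propagator (- t) (w t) x - f x) = (\<lambda>x. w t x - propagator t f x)"
    by (simp add: propagator_diff propagator_propagator)
  then have "L2_norm (\<lambda>x. w t x - propagator t f x) \<le> 0"
    using propagator_norm_le[OF L2_diff[OF propagator_L2[OF wt] f2], of t "- t"] 0 by simp
  then have "L2_norm (\<lambda>x. w t x - propagator t f x) = 0"
    using L2_norm_nonneg[of "\<lambda>x. w t x - propagator t f x"] by linarith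
  from L2_norm_eq_0_AE[OF L2_diff[OF wt propagator_L2[OF f2]] this] show ?thesis by simp
qed

section \<open>Growing solutions on the negative axis\<close>

text \<open>
  \<open>L v = l v\<close> means \<open>a u' = l u\<close> for \<open>u = v / sqrt a\<close>; on the negative axis
  \<open>(e\<^sup>-\<^sup>2\<^sup>x - 1)\<^sup>-\<^sup>1\<^sup>/\<^sup>2\<close> solves this for \<open>l = 1\<close>, and its powers for the other \<open>l\<close>.
  Square integrability at \<open>-\<infinity>\<close> and at 0 needs \<open>l > 0\<close> and \<open>l < 2\<close>.
\<close>

definition eigenfunction :: "real \<Rightarrow> real \<Rightarrow> complex" where
  "eigenfunction l x =
     (if x < 0 then of_real (sqrt (1 - exp (2 * x)) * (exp (- 2 * x) - 1) powr (- l / 2)) else 0)"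

text \<open>The flow scales exp (-2x) - 1 by exp (-2t), so its power -l/2 acquires the factor exp (l
  t). The root of 1 - phi^2 compensates the weight of the propagator.\<close>

lemma propagator_eigenfunction: "propagator t (eigenfunction l) x = of_real (exp (l * t)) * eigenfunction l x"
proof (cases "x < 0")
  case True
  define Q where "Q = contraction t x"
  have "Q > 0" by (simp add: Q_def)
  have X: "flow t x < 0" using True by simp
  have 1: "1 - exp (2 * flow t x) = (1 - exp (2 * x)) / Q"
    using coefficient_flow[of t x] True X by (simp add: phi_power2 Q_def)
  have 2: "exp (- 2 * flow t x) - 1 = (exp (- 2 * x) - 1) * exp (- 2 * t)"
    using exp_flow_nonpos[of x t] True by simp
  have 3: "exp (- (2 * t)) powr - (l / 2) = exp (l * t)"
    by (simp add: powr_def)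
  have "sqrt Q * (sqrt ((1 - exp (2 * x)) / Q) * ((exp (- 2 * x) - 1) * exp (- 2 * t)) powr (- l / 2)) =
      exp (l * t) * (sqrt (1 - exp (2 * x)) * (exp (- 2 * x) - 1) powr (- l / 2))"
    using \<open>Q > 0\<close> True 3 by (simp add: powr_mult real_sqrt_divide)
  then have "of_real (sqrt Q * (sqrt ((1 - exp (2 * x)) / Q) * ((exp (- 2 * x) - 1) * exp (- 2 * t)) powr (- l / 2))) =
      (of_real (exp (l * t) * (sqrt (1 - exp (2 * x)) * (exp (- 2 * x) - 1) powr (- l / 2))) :: complex)"
    by (rule arg_cong)
  then show ?thesis using True X
    by (simp only: propagator_def eigenfunction_def if_True 1 2 Q_def[symmetric] of_real_mult)
next
  case False
  then show ?thesis by (simp add: propagator_def eigenfunction_def)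
qed

lemma eigenfunction_L2:
  assumes l: "0 < l" "l < 2"
  shows "eigenfunction l \<in> L2"
proof -
  \<comment> \<open>A majorant of the squared modulus with elementary antiderivative F. With s = exp
    (2x) that square is s^l (1 - s)^(1 - l), at most s^l for l < 1 and at most s (1 - s)^(1 - l) for
    l \<ge> 1. The condition l > 0 governs the limit of F at minus infinity, l < 2 the one at
    0.\<close>
  define f where "f x = exp (2 * l * x) + exp (2 * x) * (1 - exp (2 * x)) powr (1 - l)" for x
  define F where "F x = exp (2 * l * x) / (2 * l) - (1 - exp (2 * x)) powr (2 - l) / (2 * (2 - l))" for x
  have "set_integrable lborel (einterval (- \<infinity>) 0) f"
  proof (rule interval_integral_FTC_nonneg)
    show "DERIV F x :> f x" if "ereal x < 0" for x
    proof -
      have "1 - exp (2 * x) > 0" using that by simp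
      have "((\<lambda>x. 1 - exp (2 * x)) has_real_derivative - (2 * exp (2 * x))) (at x)"
        by (auto intro!: derivative_eq_intros)
      from DERIV_chain2[OF has_real_derivative_powr[OF \<open>1 - exp (2 * x) > 0\<close>] this]
      have 1: "((\<lambda>x. (1 - exp (2 * x)) powr (2 - l)) has_real_derivative
          (2 - l) * (1 - exp (2 * x)) powr (2 - l - 1) * - (2 * exp (2 * x))) (at x)" .
      have 2: "((\<lambda>x. exp (2 * l * x)) has_real_derivative 2 * l * exp (2 * l * x)) (at x)"
        by (auto intro!: derivative_eq_intros)
      have "(F has_real_derivative 2 * l * exp (2 * l * x) / (2 * l) -
          (2 - l) * (1 - exp (2 * x)) powr (2 - l - 1) * - (2 * exp (2 * x)) / (2 * (2 - l))) (at x)"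
        unfolding F_def[abs_def] by (intro DERIV_diff DERIV_cdivide 1 2)
      moreover have "2 * l * exp (2 * l * x) / (2 * l) -
          (2 - l) * (1 - exp (2 * x)) powr (2 - l - 1) * - (2 * exp (2 * x)) / (2 * (2 - l)) = f x"
      proof -
        have "2 - l \<noteq> 0" using l by simp
        have a: "2 * l * e / (2 * l) = e" for e using l by simp
        have b: "c * p * - (2 * e) / (2 * c) = - (e * p)" if "c \<noteq> 0" for c p e :: real
          using that by (simp add: field_simps)
        have "2 - l - 1 = 1 - l" by simp
        then show ?thesis unfolding f_def a b[OF \<open>2 - l \<noteq> 0\<close>] by simp
      qed
      ultimately show ?thesis by simp
    qed
    show "isCont f x" if "ereal x < 0" for x
      using that unfolding f_def isCont_def by (intro tendsto_intros) auto
    show "AE x in lborel. - \<infinity> < ereal x \<longrightarrow> ereal x < 0 \<longrightarrow> 0 \<le> f x" by (simp add: f_def)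
    have "filterlim (\<lambda>x. 2 * l * x) at_bot at_bot"
      using l by (intro filterlim_tendsto_pos_mult_at_bot[OF tendsto_const] filterlim_ident) auto
    then have e1: "((\<lambda>x. exp (2 * l * x)) \<longlongrightarrow> 0) at_bot" by (rule filterlim_compose[OF exp_at_bot])
    have "filterlim (\<lambda>x::real. 2 * x) at_bot at_bot"
      by (intro filterlim_tendsto_pos_mult_at_bot[OF tendsto_const] filterlim_ident) auto
    then have e2: "((\<lambda>x. exp (2 * x :: real)) \<longlongrightarrow> 0) at_bot" by (rule filterlim_compose[OF exp_at_bot])
    have "(F \<longlongrightarrow> 0 / (2 * l) - (1 - 0) powr (2 - l) / (2 * (2 - l))) at_bot"
      unfolding F_def[abs_def] using l by (intro tendsto_intros e1 e2) auto
    then show "((F \<circ> real_of_ereal) \<longlongrightarrow> 0 / (2 * l) - (1 - 0) powr (2 - l) / (2 * (2 - l))) (at_right (- \<infinity>))"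
      by (simp add: ereal_tendsto_simps)
    have "((\<lambda>x. 1 - exp (2 * x)) \<longlongrightarrow> 1 - exp (2 * 0)) (at_left (0::real))"
      by (intro tendsto_intros)
    then have "((\<lambda>x. (1 - exp (2 * x)) powr (2 - l)) \<longlongrightarrow> 0) (at_left 0)"
      using l by (intro tendsto_zero_powrI[OF _ tendsto_const]) (auto simp: eventually_at_filter)
    then have "(F \<longlongrightarrow> exp (2 * l * 0) / (2 * l) - 0 / (2 * (2 - l))) (at_left 0)"
      unfolding F_def[abs_def] using l by (intro tendsto_intros) auto
    then show "((F \<circ> real_of_ereal) \<longlongrightarrow> exp (2 * l * 0) / (2 * l) - 0 / (2 * (2 - l))) (at_left 0)"
      by (simp add: ereal_tendsto_simps zero_ereal_def)
  qed simp
  moreover have "einterval (- \<infinity>) 0 = {..<0::real}"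
    by (auto simp: einterval_def)
  ultimately have int: "integrable lborel (\<lambda>x. indicator {..<0} x * f x)"
    by (simp add: set_integrable_def)
  have meas: "eigenfunction l \<in> borel_measurable borel"
    unfolding eigenfunction_def[abs_def] by measurable
  have le: "(cmod (eigenfunction l x))\<^sup>2 \<le> indicator {..<0} x * f x" for x
  proof (cases "x < 0")
    case True
    define s where "s = exp (2 * x)"
    have s: "0 < s" "s < 1" using True by (auto simp: s_def)
    have inv: "exp (- 2 * x) - 1 = (1 - s) / s" using s by (simp add: s_def exp_minus field_simps)
    have sl: "exp (2 * l * x) = s powr l" by (simp add: s_def powr_def)
    have "(cmod (eigenfunction l x))\<^sup>2 = (sqrt (1 - s) * ((1 - s) / s) powr (- l / 2))\<^sup>2"
      unfolding eigenfunction_def inv using True by (simp only: if_True norm_of_real power2_abs s_def)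
    also have "\<dots> = (1 - s) * (((1 - s) / s) powr (- l / 2) * ((1 - s) / s) powr (- l / 2))"
      using s by (simp add: power_mult_distrib power2_eq_square[of "_ powr _"])
    also have "\<dots> = (1 - s) * ((1 - s) / s) powr (- l)"
      unfolding powr_add[symmetric] by simp
    also have "\<dots> = (1 - s) powr 1 * ((1 - s) powr (- l) * s powr l)"
    proof -
      have "((1 - s) / s) powr (- l) = (1 - s) powr (- l) / s powr (- l)"
        by (rule powr_divide)
      moreover have "s powr (- l) = inverse (s powr l)" by (rule powr_minus)
      ultimately have "((1 - s) / s) powr (- l) = (1 - s) powr (- l) * s powr l"
        by (simp only: divide_inverse inverse_inverse_eq)
      then show ?thesis using s by simp
    qed
    also have "\<dots> = s powr l * (1 - s) powr (1 - l)"
      using powr_add[of "1 - s" 1 "- l"] by simp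
    also have "\<dots> \<le> s powr l + s * (1 - s) powr (1 - l)"
    proof (cases "l \<ge> 1")
      case True
      have "s powr l \<le> s powr 1" using s True by (intro powr_mono') auto
      then have "s powr l * (1 - s) powr (1 - l) \<le> s * (1 - s) powr (1 - l)"
        using s by (intro mult_right_mono) auto
      then show ?thesis using powr_ge_zero[of s l] by linarith
    next
      case False
      have "(1 - s) powr (1 - l) \<le> 1" using s False by (intro powr_le1) auto
      then have "s powr l * (1 - s) powr (1 - l) \<le> s powr l * 1" by (intro mult_left_mono) auto
      moreover have "0 \<le> s * (1 - s) powr (1 - l)" using s by simp
      ultimately show ?thesis by linarith
    qed
    finally show ?thesis using True by (simp add: f_def sl s_def[symmetric])
  next
    case False
    then show ?thesis by (simp add: eigenfunction_def)
  qed
  have "integrable lborel (\<lambda>x. (cmod (eigenfunction l x))\<^sup>2)"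
  proof (rule Bochner_Integration.integrable_bound[OF int])
    show "AE x in lborel. norm ((cmod (eigenfunction l x))\<^sup>2) \<le> norm (indicator {..<0} x * f x)"
    proof (rule AE_I2)
      fix x
      show "norm ((cmod (eigenfunction l x))\<^sup>2) \<le> norm (indicator {..<0} x * f x)"
        using le[of x] zero_le_power2[of "cmod (eigenfunction l x)"] unfolding real_norm_def by linarith
    qed
  qed (use meas in measurable)
  then show ?thesis using meas by (simp add: L2_def)
qed

lemma generates_eigenfunction:
  assumes l: "0 < l" "l < 2"
  shows "generates (eigenfunction l) (\<lambda>x. of_real l * eigenfunction l x)"
proof -
  note e = eigenfunction_L2[OF l]
  have "((\<lambda>h. exp (l * h)) has_real_derivative l) (at 0)"
    by (auto intro!: derivative_eq_intros)
  then have "((\<lambda>h. (exp (l * h) - 1) / h) \<longlongrightarrow> l) (at 0)" by (simp add: DERIV_def)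
  then have "((\<lambda>h. \<bar>(exp (l * h) - 1) / h - l\<bar> * L2_norm (eigenfunction l)) \<longlongrightarrow> \<bar>l - l\<bar> * L2_norm (eigenfunction l)) (at 0)"
    by (intro tendsto_intros)
  moreover have "L2_norm (\<lambda>x. (propagator h (eigenfunction l) x - eigenfunction l x) / of_real h - of_real l * eigenfunction l x) =
      \<bar>(exp (l * h) - 1) / h - l\<bar> * L2_norm (eigenfunction l)" for h
  proof -
    have "(\<lambda>x. (propagator h (eigenfunction l) x - eigenfunction l x) / of_real h - of_real l * eigenfunction l x) =
        (\<lambda>x. of_real ((exp (l * h) - 1) / h - l) * eigenfunction l x)"
      by (auto simp: propagator_eigenfunction fun_eq_iff left_diff_distrib diff_divide_distrib)
    then show ?thesis by (simp only: L2_norm_scale norm_of_real)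
  qed
  ultimately show ?thesis using e by (simp add: generates_def L2_scale)
qed

lemma eigenfunction_not_AE_0: "\<not> (AE x in lborel. x < 0 \<longrightarrow> eigenfunction l x = 0)"
proof
  assume "AE x in lborel. x < 0 \<longrightarrow> eigenfunction l x = 0"
  then have "AE x in lborel. x \<notin> {-1<..<0::real}"
    by eventually_elim (auto simp: eigenfunction_def)
  then have "{-1<..<0::real} \<in> null_sets lborel"
    by (subst AE_iff_null_sets) auto
  then show False by (simp add: null_sets_def)
qed

lemma L2_norm_on_cong_AE:
  assumes "f \<in> L2" "g \<in> L2" "AE x in lborel. f x = g x" and [measurable]: "A \<in> sets borel"
  shows "L2_norm_on A f = L2_norm_on A g"
proof -
  note [measurable] = L2_measurable[OF assms(1)] L2_measurable[OF assms(2)]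
  have "(\<integral>x. indicator A x *\<^sub>R (cmod (f x))\<^sup>2 \<partial>lborel) = (\<integral>x. indicator A x *\<^sub>R (cmod (g x))\<^sup>2 \<partial>lborel)"
    using assms(3) by (intro integral_cong_AE) auto
  then show ?thesis by (simp add: L2_norm_on_def set_lebesgue_integral_def)
qed

lemma L2_norm_on_scale: "L2_norm_on A (\<lambda>x. c * f x) = cmod c * L2_norm_on A f"
  by (simp add: L2_norm_on_def set_lebesgue_integral_def norm_mult power_mult_distrib
      real_sqrt_mult mult.left_commute)

theorem proposition3p4:
  shows "(\<forall>v0\<in>Dom_L. \<exists>v. global_solution v0 v \<and>
            (\<forall>w. global_solution v0 w \<longrightarrow> (\<forall>t\<ge>0. AE \<xi> in lborel. w t \<xi> = v t \<xi>)) \<and>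
            (\<forall>t>0. L2_norm_on {0<..} (v t) \<le> L2_norm_on {0<..} v0 \<and>
                   L2_norm_on {..<0} (v t) \<le> exp (2 * t) * L2_norm_on {..<0} v0)) \<and>
         (\<forall>l0\<in>{0<..<2::real}. \<exists>v0\<in>Dom_L.
            \<not> (AE \<xi> in lborel. \<xi> < 0 \<longrightarrow> v0 \<xi> = 0) \<and>
            (\<forall>v. global_solution v0 v \<longrightarrow>
               (\<forall>t>0. L2_norm_on {..<0} (v t) = exp (l0 * t) * L2_norm_on {..<0} v0)))"
proof (intro conjI ballI)
  fix v0 assume v0: "v0 \<in> Dom_L"
  note v02 = Dom_L_L2[OF v0]
  have "L2_norm_on {0<..} (propagator t v0) \<le> L2_norm_on {0<..} v0" if "t > 0" for t
  proof -
    \<comment> \<open>For positive x and t the convex combination is between 1 and exp (-2t), so its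
      maximum is 1; on the left it is between 1 and exp (2t), which is the rate there.\<close>
    have "contraction t x \<le> 1" if "x \<in> {0<..}" for x
      using contraction_bounds(2)[of t x] that \<open>t > 0\<close> by (simp add: side_def)
    from propagator_norm_on_le(2)[OF v02 _ _ this, of "{0<..}"] show ?thesis by simp
  qed
  moreover have "L2_norm_on {..<0} (propagator t v0) \<le> exp (2 * t) * L2_norm_on {..<0} v0" if "t > 0" for t
  proof -
    have "contraction t x \<le> exp (2 * t)" for x
      using contraction_upper[of t x] \<open>t > 0\<close> by simp
    from propagator_norm_on_le(2)[OF v02 _ _ this, of "{..<0}"] show ?thesis by simp
  qed
  ultimately show "\<exists>v. global_solution v0 v \<and>
      (\<forall>w. global_solution v0 w \<longrightarrow> (\<forall>t\<ge>0. AE \<xi> in lborel. w t \<xi> = v t \<xi>)) \<and>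
      (\<forall>t>0. L2_norm_on {0<..} (v t) \<le> L2_norm_on {0<..} v0 \<and>
             L2_norm_on {..<0} (v t) \<le> exp (2 * t) * L2_norm_on {..<0} v0)"
    using propagator_global_solution[OF v0] global_solution_unique[OF _ v0]
    by (intro exI[of _ "\<lambda>t. propagator t v0"]) simp
next
  fix l0 :: real assume "l0 \<in> {0<..<2}"
  then have l: "0 < l0" "l0 < 2" by auto
  have dom: "eigenfunction l0 \<in> Dom_L" by (rule generates_imp_Dom_L(1)[OF generates_eigenfunction[OF l]])
  have "L2_norm_on {..<0} (v t) = exp (l0 * t) * L2_norm_on {..<0} (eigenfunction l0)"
    if v: "global_solution (eigenfunction l0) v" and "t > 0" for v t
  proof -
    have "v t \<in> L2"
      using v \<open>t > 0\<close> Dom_L_L2 by (simp add: global_solution_def continuous_into_Dom_L_def)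
    then have "L2_norm_on {..<0} (v t) = L2_norm_on {..<0} (\<lambda>x. of_real (exp (l0 * t)) * eigenfunction l0 x)"
      using global_solution_unique[OF v dom, of t] \<open>t > 0\<close>
      by (intro L2_norm_on_cong_AE L2_scale eigenfunction_L2 l) (simp_all add: propagator_eigenfunction)
    then show ?thesis by (simp only: L2_norm_on_scale norm_of_real abs_exp_cancel)
  qed
  then show "\<exists>v0\<in>Dom_L. \<not> (AE \<xi> in lborel. \<xi> < 0 \<longrightarrow> v0 \<xi> = 0) \<and>
      (\<forall>v. global_solution v0 v \<longrightarrow>
         (\<forall>t>0. L2_norm_on {..<0} (v t) = exp (l0 * t) * L2_norm_on {..<0} v0))"
    using dom eigenfunction_not_AE_0 by blast
qed

end
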